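(* Let $p\in(2,6)$, $q\in(2,4)$, $\alpha,\beta>0$, $\varepsilon>0$, and let $V\subset\mathbb V_{\mathcal G_\varepsilon}$ be $\mathbb Z$-periodic. Then: (i) if $p\in(2,4)$ or $q\in(2,3)$, then $\mathcal E_{\mathcal G_\varepsilon}(\mu)<0$ and a ground state of $E(\cdot,\mathcal G_\varepsilon)$ in $H^1_\mu(\mathcal G_\varepsilon)$ exists for every $\mu>0$; (ii) if $p\in[4,6)$ and $q\in[3,4)$, then there exists $\overline\mu=\overline\mu(p,q,\alpha,\beta,V,\varepsilon)>0$ such that $\mathcal E_{\mathcal G_\varepsilon}(\mu)=0$ for $\mu\in(0,\overline\mu]$ and $\mathcal E_{\mathcal G_\varepsilon}(\mu)<0$ for $\mu>\overline\mu$; moreover ground states exist for every $\mu>\overline\mu$ and do not exist for any $\mu\in(0,\overline\mu)$.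
   Context: For $\varepsilon>0$, $\mathcal G_\varepsilon$ is the metric graph embedded in $\mathbb R^2$ with vertex set $\mathbb V_{\mathcal G_\varepsilon}=\varepsilon\mathbb Z^2$ and an edge (a segment of length $\varepsilon$) joining every pair of vertices at Euclidean distance $\varepsilon$. $H^1(\mathcal G_\varepsilon)$ is the space of continuous functions $u:\mathcal G_\varepsilon\to\mathbb R$ whose restriction to each edge belongs to $H^1$ of that edge and with $\|u\|_{L^2(\mathcal G_\varepsilon)}^2+\|u'\|_{L^2(\mathcal G_\varepsilon)}^2<\infty$, where $L^r$ norms on $\mathcal G_\varepsilon$ are computed by summing the one-dimensional integrals over all edges. $H^1_\mu(\mathcal G_\varepsilon)=\{u\in H^1(\mathcal G_\varepsilon):\|u\|_{L^2(\mathcal G_\varepsilon)}^2=\mu\}$. For $V\subseteq\mathbb V_{\mathcal G_\varepsilon}$ and $\alpha,\beta>0$, $E(u,\mathcal G_\varepsilon)=\frac12\|u'\|_{L^2(\mathcal G_\varepsilon)}^2-\frac\alpha p\|u\|_{L^p(\mathcal G_\varepsilon)}^p-\frac\beta q\sum_{\mathrm v\in V}|u(\mathrm v)|^q$, and $\mathcal E_{\mathcal G_\varepsilon}(\mu)=\inf_{u\in H^1_\mu(\mathcal G_\varepsilon)}E(u,\mathcal G_\varepsilon)$. A ground state with mass $\mu$ is a $u\in H^1_\mu(\mathcal G_\varepsilon)$ with $E(u,\mathcal G_\varepsilon)=\mathcal E_{\mathcal G_\varepsilon}(\mu)$. $\mathbb Z$-periodic sets: a set $V'\subset\mathbb Z^2$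 is $\mathbb Z$-periodic if there is $\vec v\in\mathbb Z^2\setminus\{0\}$ with $V'=V'+k\vec v$ for all $k\in\mathbb Z$, and there exist $P_0\in\mathbb R^2$, $r>0$ with $|(\mathrm v-P_0)\cdot\vec v^\perp|\le r$ for all $\mathrm v\in V'$, where $\vec v^\perp=(-v_2,v_1)$ for $\vec v=(v_1,v_2)$. A set $V\subset\varepsilon\mathbb Z^2$ is $\mathbb Z$-periodic if $V=\varepsilon V'$ for some $\mathbb Z$-periodic $V'\subset\mathbb Z^2$.
   Formalization: The set V is assumed nonempty: the empty set satisfies the definition of Z-periodic vacuously, and for it part (i) fails when p is in [4,6) and q is in (2,3). *)

theory Defs
  imports "HOL-Analysis.Analysis"
begin

text \<open>The grid graph G_eps embedded in R^2.  Edges are indexed by (i,j,b) with i,j integers: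
  b = False : horizontal edge from (eps i, eps j) to (eps (i+1), eps j);
  b = True  : vertical edge from (eps i, eps j) to (eps i, eps (j+1)).
  Each edge is parametrised by arc length t in [0,eps] from its base vertex.
  Functions on the metric graph are represented by functions u on R^2, of which only
  the values on the graph matter.\<close>

type_synonym edge = "int \<times> int \<times> bool"

definition edge_pt :: "real \<Rightarrow> edge \<Rightarrow> real \<Rightarrow> real \<times> real" where
  "edge_pt \<epsilon> e t = (case e of (i, j, b) \<Rightarrow>
      (if b then (\<epsilon> * of_int i, \<epsilon> * of_int j + t) else (\<epsilon> * of_int i + t, \<epsilon> * of_int j)))"

definition grid_graph :: "real \<Rightarrow> (real \<times> real) set" where
  "grid_graph \<epsilon> = (\<Union>e. edge_pt \<epsilon> e ` {0..\<epsilon>})"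

definition edge_weak_deriv :: "real \<Rightarrow> (real \<times> real \<Rightarrow> real) \<Rightarrow> (edge \<Rightarrow> real \<Rightarrow> real) \<Rightarrow> bool" where
  "edge_weak_deriv \<epsilon> u g \<longleftrightarrow>
     (\<forall>e. set_integrable lborel {0..\<epsilon>} (g e)
        \<and> set_integrable lborel {0..\<epsilon>} (\<lambda>t. (g e t)\<^sup>2)
        \<and> (\<forall>x\<in>{0..\<epsilon>}. u (edge_pt \<epsilon> e x) = u (edge_pt \<epsilon> e 0) + (LINT t:{0..x}|lborel. g e t)))"

definition Lpow :: "real \<Rightarrow> real \<Rightarrow> (real \<times> real \<Rightarrow> real) \<Rightarrow> real" where
  "Lpow \<epsilon> r u = (\<Sum>\<^sub>\<infinity>e\<in>UNIV. (LINT t:{0..\<epsilon>}|lborel. \<bar>u (edge_pt \<epsilon> e t)\<bar> powr r))"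

definition dersq_sum :: "real \<Rightarrow> (edge \<Rightarrow> real \<Rightarrow> real) \<Rightarrow> real" where
  "dersq_sum \<epsilon> g = (\<Sum>\<^sub>\<infinity>e\<in>UNIV. (LINT t:{0..\<epsilon>}|lborel. (g e t)\<^sup>2))"

definition H1 :: "real \<Rightarrow> (real \<times> real \<Rightarrow> real) set" where
  "H1 \<epsilon> = {u. continuous_on (grid_graph \<epsilon>) u
      \<and> (\<lambda>e. LINT t:{0..\<epsilon>}|lborel. (u (edge_pt \<epsilon> e t))\<^sup>2) summable_on UNIV
      \<and> (\<exists>g. edge_weak_deriv \<epsilon> u g
             \<and> (\<lambda>e. LINT t:{0..\<epsilon>}|lborel. (g e t)\<^sup>2) summable_on UNIV)}"

text \<open>||u'||^2_{L^2(G_eps)} (well defined since weak derivatives are unique a.e.).\<close>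
definition Dnorm2 :: "real \<Rightarrow> (real \<times> real \<Rightarrow> real) \<Rightarrow> real" where
  "Dnorm2 \<epsilon> u = (THE s. \<exists>g. edge_weak_deriv \<epsilon> u g \<and> s = dersq_sum \<epsilon> g)"

definition H1_mass :: "real \<Rightarrow> real \<Rightarrow> (real \<times> real \<Rightarrow> real) set" where
  "H1_mass \<epsilon> \<mu> = {u \<in> H1 \<epsilon>. Lpow \<epsilon> 2 u = \<mu>}"

text \<open>V = eps * V' with V' a subset of Z^2.\<close>
definition energy :: "real \<Rightarrow> real \<Rightarrow> real \<Rightarrow> real \<Rightarrow> real \<Rightarrow> (int \<times> int) set
                        \<Rightarrow> (real \<times> real \<Rightarrow> real) \<Rightarrow> real" where
  "energy \<epsilon> p q \<alpha> \<beta> V' u = Dnorm2 \<epsilon> u / 2 - \<alpha> / p * Lpow \<epsilon> p u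
      - \<beta> / q * (\<Sum>\<^sub>\<infinity>v\<in>V'. \<bar>u (\<epsilon> * of_int (fst v), \<epsilon> * of_int (snd v))\<bar> powr q)"

definition ground_level :: "real \<Rightarrow> real \<Rightarrow> real \<Rightarrow> real \<Rightarrow> real \<Rightarrow> (int \<times> int) set \<Rightarrow> real \<Rightarrow> real" where
  "ground_level \<epsilon> p q \<alpha> \<beta> V' \<mu> = (INF u\<in>H1_mass \<epsilon> \<mu>. energy \<epsilon> p q \<alpha> \<beta> V' u)"

definition is_ground_state :: "real \<Rightarrow> real \<Rightarrow> real \<Rightarrow> real \<Rightarrow> real \<Rightarrow> (int \<times> int) set
                                 \<Rightarrow> real \<Rightarrow> (real \<times> real \<Rightarrow> real) \<Rightarrow> bool" where
  "is_ground_state \<epsilon> p q \<alpha> \<beta> V' \<mu> u \<longleftrightarrow>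
     u \<in> H1_mass \<epsilon> \<mu> \<and> energy \<epsilon> p q \<alpha> \<beta> V' u = ground_level \<epsilon> p q \<alpha> \<beta> V' \<mu>"

definition Z_periodic :: "(int \<times> int) set \<Rightarrow> bool" where
  "Z_periodic V' \<longleftrightarrow> (\<exists>v::int \<times> int. v \<noteq> (0, 0)
      \<and> (\<forall>k::int. V' = (\<lambda>w. (fst w + k * fst v, snd w + k * snd v)) ` V')
      \<and> (\<exists>P0::real \<times> real. \<exists>r>0. \<forall>w\<in>V'.
           \<bar>(of_int (fst w) - fst P0) * (- of_int (snd v)) + (of_int (snd w) - snd P0) * of_int (fst v)\<bar> \<le> r))"

end

theory Submission
  imports Defs "HOL-Complex_Analysis.Great_Picard" "HOL-Real_Asymp.Real_Asymp"
begin

text \<open>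
  Put \<open>\<sigma> = min p q / 2 > 1\<close>. For \<open>\<theta> \<ge> 1\<close> the energy of \<open>sqrt \<theta> u\<close> is at most \<open>\<theta>\<^sup>\<sigma>\<close> times that of \<open>u\<close>, so
  every \<open>u\<close> of mass \<open>m \<le> \<mu>\<close> has energy at least \<open>(m/\<mu>)\<^sup>\<sigma>\<close> times the level of \<open>\<mu>\<close>. A minimizing sequence at a negative level
  cannot vanish; translated so that a fixed edge keeps a definite mass, it converges pointwise to some \<open>U \<noteq> 0\<close>, and
  Brezis-Lieb splits its energy into that of \<open>U\<close> and that of the remainder. Since \<open>x\<^sup>\<sigma> + (1 - x)\<^sup>\<sigma> < 1\<close> on \<open>(0, 1)\<close>, \<open>U\<close> carries
  all the mass. The translates of \<open>V\<close> are either constant along a subsequence, by periodicity, or escape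
  to infinity, in which case the vertex term only helps; both give a ground state.

  The level is negative for \<open>p < 4\<close> or \<open>q < 3\<close> by testing with \<open>exp (- (\<bar>x\<bar> + \<bar>y\<bar>) / (\<epsilon> N))\<close>: its kinks lie at vertices, hence
  its kinetic energy is exactly its mass divided by \<open>(\<epsilon> N)\<^sup>2\<close>. For \<open>p \<ge> 4\<close> and \<open>q \<ge> 3\<close> a discrete Ladyzhenskaya inequality and a
  trace inequality on the lattice bound the potential energy by a small multiple of the kinetic energy when the
  mass is small.
\<close>

section \<open>Powers and the Brezis-Lieb lemma\<close>

text \<open>Locally the graph is one-dimensional; at scales much larger than \<epsilon> it behaves
  like the plane. The upper bounds 6 and 4 on the exponents are the critical ones of the line and
  give coercivity, while the thresholds 4 and 3 come from the plane. A profile of fixed mass spread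
  over N^2 cells has amplitude of order 1/N, kinetic energy of order N^-2, p-th power integral of
  order N^(2-p) and, on a vertex set that runs along one line, q-th power sum of order N^(1-q). The
  obstacle to compactness is that V is periodic in one direction only, so recentring a minimizing
  sequence changes the functional. For this reason the compactness estimates are uniform in the
  vertex set: they hold for arbitrary sets, for sequences \<open>W n\<close>, or for all translates
  of V. Pointwise convergence splits the mass and the potential terms. Derivatives converge only
  weakly, and the kinetic energy is split by evaluating one pairing, that with the derivative of the
  limit.\<close>

lemma power2_sum_le: "(x + y)\<^sup>2 \<le> 2 * x\<^sup>2 + 2 * (y :: real)\<^sup>2"
  using zero_le_power2[of "x - y"] by (simp add: power2_eq_square algebra_simps)

text \<open>A quadratic beats every power below two past the point \<open>X\<close> where the two
  balance; up to \<open>X\<close> the power is at most \<open>X powr a\<close>. The powers fed in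
  later are (p-2)/2 and q/2, so that a < 2 amounts to p < 6 and q < 4.\<close>

lemma powr_le_square:
  fixes a \<delta> :: real
  assumes "0 < a" "a < 2" "\<delta> > 0"
  shows "\<exists>K\<ge>0. \<forall>x\<ge>0. x powr a \<le> \<delta> * x\<^sup>2 + K"
proof -
  define X where "X = (1/\<delta>) powr (1/(2-a))"
  have X: "X > 0" using assms by (simp add: X_def)
  have Xa: "X powr (2-a) = 1/\<delta>" using assms by (simp add: X_def powr_powr)
  show ?thesis
  proof (intro exI[of _ "X powr a"] conjI allI impI)
    fix x :: real assume "x \<ge> 0"
    show "x powr a \<le> \<delta> * x\<^sup>2 + X powr a"
    proof (cases "x \<le> X")
      case True
      then show ?thesis using \<open>x \<ge> 0\<close> assms powr_mono2[of a x X] by (smt (verit) mult_nonneg_nonneg zero_le_power2)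
    next
      case False
      have "X powr (2-a) \<le> x powr (2-a)" using False X assms by (intro powr_mono2) auto
      then have "1 \<le> \<delta> * x powr (2-a)" using Xa assms by (simp add: field_simps)
      then have "x powr a * 1 \<le> x powr a * (\<delta> * x powr (2-a))" by (intro mult_left_mono) auto
      also have "\<dots> = \<delta> * (x powr a * x powr (2-a))" by simp
      also have "x powr a * x powr (2-a) = x\<^sup>2" using False X by (simp flip: powr_add)
      finally show ?thesis by (smt (verit) powr_ge_zero)
    qed
  qed simp
qed

text \<open>The point is a leading factor arbitrarily close to 1. With (1 + \<eta>)^r = 1 +
  \<delta>, either b is at most \<eta> a and is absorbed by a, or a is below b / \<eta> and is
  absorbed by b. No convexity enters, so every r > 0 is covered.\<close>

lemma powr_add_le:
  fixes r \<delta> :: real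
  assumes "r > 0" "\<delta> > 0"
  shows "\<exists>C\<ge>0. \<forall>a\<ge>0. \<forall>b\<ge>0. (a + b) powr r \<le> (1 + \<delta>) * a powr r + C * b powr r"
proof -
  define \<eta> where "\<eta> = (1 + \<delta>) powr (1/r) - 1"
  have \<eta>: "\<eta> > 0" using assms powr_less_mono2[of "1/r" 1 "1+\<delta>"] by (simp add: \<eta>_def)
  have e: "(1 + \<eta>) powr r = 1 + \<delta>" using assms by (simp add: \<eta>_def powr_powr)
  show ?thesis
  proof (intro exI[of _ "(1 + 1/\<eta>) powr r"] conjI allI impI)
    fix a b :: real assume a: "a \<ge> 0" and b: "b \<ge> 0"
    show "(a + b) powr r \<le> (1 + \<delta>) * a powr r + (1 + 1/\<eta>) powr r * b powr r"
    proof (cases "b \<le> \<eta> * a")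
      case True
      then have "(a + b) powr r \<le> ((1 + \<eta>) * a) powr r"
        using a b assms by (intro powr_mono2) (auto simp: algebra_simps)
      also have "\<dots> = (1 + \<delta>) * a powr r" using a \<eta> e by (simp add: powr_mult)
      finally show ?thesis by (smt (verit) powr_ge_zero mult_nonneg_nonneg)
    next
      case False
      then have "(a + b) powr r \<le> ((1 + 1/\<eta>) * b) powr r"
        using a b assms \<eta> by (intro powr_mono2) (auto simp: field_simps)
      also have "\<dots> = (1 + 1/\<eta>) powr r * b powr r" using b \<eta> by (simp add: powr_mult)
      finally show ?thesis using assms by (smt (verit) powr_ge_zero mult_nonneg_nonneg)
    qed
  qed simp
qed

text \<open>\<open>powr_add_le\<close> bounds the increase from a to a + b; applied to a = (a + b) -
  b it bounds the decrease.\<close>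

lemma abs_powr_add_diff_le:
  fixes r \<delta> :: real
  assumes "r > 0" "\<delta> > 0"
  shows "\<exists>C\<ge>0. \<forall>a b. \<bar>\<bar>a + b\<bar> powr r - \<bar>a\<bar> powr r\<bar> \<le> \<delta> * \<bar>a\<bar> powr r + C * \<bar>b\<bar> powr r"
proof -
  \<comment> \<open>Inserting the first bound into the second produces the coefficient d + d*d,
    which is at most 2*d once d is at most 1.\<close>
  define d where "d = min (\<delta>/2) 1"
  have d: "d > 0" "d \<le> 1" "2 * d \<le> \<delta>" using assms by (auto simp: d_def)
  obtain C where C: "C \<ge> 0" "\<And>a b. a \<ge> 0 \<Longrightarrow> b \<ge> 0 \<Longrightarrow> (a + b) powr r \<le> (1 + d) * a powr r + C * b powr r"
    using powr_add_le[OF assms(1) d(1)] by blast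
  show ?thesis
  proof (intro exI[of _ "2*C"] conjI allI)
    fix a b :: real
    let ?x = "\<bar>a + b\<bar> powr r" and ?y = "\<bar>a\<bar> powr r" and ?z = "\<bar>b\<bar> powr r"
    have "?x \<le> (\<bar>a\<bar> + \<bar>b\<bar>) powr r" using assms by (intro powr_mono2) auto
    also have "\<dots> \<le> (1 + d) * ?y + C * ?z" by (intro C) auto
    finally have 1: "?x \<le> (1 + d) * ?y + C * ?z" .
    have "?y \<le> (\<bar>a + b\<bar> + \<bar>b\<bar>) powr r" using assms by (intro powr_mono2) auto
    also have "\<dots> \<le> (1 + d) * ?x + C * ?z" by (intro C) auto
    finally have "?y - ?x \<le> d * ?x + C * ?z" by (simp add: algebra_simps)
    also have "d * ?x \<le> d * ((1 + d) * ?y + C * ?z)" using 1 d by (intro mult_left_mono) auto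
    also have "\<dots> = (d + d * d) * ?y + d * (C * ?z)" by (simp add: algebra_simps)
    also have "\<dots> \<le> \<delta> * ?y + 1 * (C * ?z)"
    proof (intro add_mono mult_right_mono)
      show "d + d * d \<le> \<delta>" using d mult_left_le[of d d] by linarith
    qed (use d C in auto)
    finally have 2: "?y - ?x \<le> \<delta> * ?y + 2 * C * ?z" by simp
    have "d * ?y \<le> \<delta> * ?y" using d assms by (intro mult_right_mono) auto
    moreover have "0 \<le> C * ?z" using C by simp
    ultimately have "?x - ?y \<le> \<delta> * ?y + 2 * C * ?z" using 1 by (simp add: algebra_simps)
    then show "\<bar>?x - ?y\<bar> \<le> \<delta> * ?y + 2 * C * ?z" using 2 by linarith
  qed (use C in auto)
qed

lemma fatou_real:
  fixes f :: "nat \<Rightarrow> 'a \<Rightarrow> real"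
  assumes int: "\<And>n. integrable M (f n)" and nn: "\<And>n x. f n x \<ge> 0"
    and K: "\<And>n. integral\<^sup>L M (f n) \<le> K"
    and meas: "F \<in> borel_measurable M" and lim: "AE x in M. (\<lambda>n. f n x) \<longlonglongrightarrow> F x" and Fnn: "\<And>x. F x \<ge> 0"
  shows "integrable M F" "integral\<^sup>L M F \<le> K"
proof -
  have "0 \<le> integral\<^sup>L M (f 0)" using nn by simp
  then have K0: "K \<ge> 0" using K[of 0] by linarith
  have "(\<integral>\<^sup>+x. ennreal (F x) \<partial>M) = (\<integral>\<^sup>+x. liminf (\<lambda>n. ennreal (f n x)) \<partial>M)"
  proof (rule nn_integral_cong_AE, use lim in eventually_elim)
    fix x assume "(\<lambda>n. f n x) \<longlonglongrightarrow> F x"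
    then have "(\<lambda>n. ennreal (f n x)) \<longlonglongrightarrow> ennreal (F x)" by (rule tendsto_ennrealI)
    then show "ennreal (F x) = liminf (\<lambda>n. ennreal (f n x))"
      by (simp add: lim_imp_Liminf)
  qed
  also have "\<dots> \<le> liminf (\<lambda>n. \<integral>\<^sup>+x. ennreal (f n x) \<partial>M)"
    using int by (intro nn_integral_liminf) auto
  also have "\<dots> \<le> ennreal K"
  proof -
    have "(\<integral>\<^sup>+x. ennreal (f n x) \<partial>M) \<le> ennreal K" for n
      using int nn K by (subst nn_integral_eq_integral) (auto intro: ennreal_leI)
    then show ?thesis by (intro Liminf_le) auto
  qed
  finally have *: "(\<integral>\<^sup>+x. ennreal (F x) \<partial>M) \<le> ennreal K" .
  show i: "integrable M F"
    using meas * Fnn by (intro integrableI_nonneg) (auto simp: le_less_trans)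
  show "integral\<^sup>L M F \<le> K"
    using * i Fnn K0 by (subst (asm) nn_integral_eq_integral) auto
qed

text \<open>The excess over \<delta> |f n - F|^r is dominated by a multiple of |F|^r and tends to 0
  pointwise, so dominated convergence disposes of it; the rest is \<delta> times a bounded integral.
  In the last conclusion the absolute value stays inside the integral: for counting measure this
  controls the splitting over any subset of the vertices at once, even one that changes with
  n.\<close>

lemma brezis_lieb:
  fixes f :: "nat \<Rightarrow> 'a \<Rightarrow> real"
  assumes r: "r > 0" and [measurable]: "\<And>n. f n \<in> borel_measurable M" "F \<in> borel_measurable M"
    and int: "\<And>n. integrable M (\<lambda>x. \<bar>f n x\<bar> powr r)"
    and K: "\<And>n. (\<integral>x. \<bar>f n x\<bar> powr r \<partial>M) \<le> K"
    and lim: "\<And>x. x \<in> space M \<Longrightarrow> (\<lambda>n. f n x) \<longlonglongrightarrow> F x"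
  shows "integrable M (\<lambda>x. \<bar>F x\<bar> powr r)"
    and "\<And>n. integrable M (\<lambda>x. \<bar>f n x - F x\<bar> powr r)"
    and "(\<lambda>n. \<integral>x. \<bar>\<bar>f n x\<bar> powr r - \<bar>f n x - F x\<bar> powr r - \<bar>F x\<bar> powr r\<bar> \<partial>M) \<longlonglongrightarrow> 0"
proof -
  show iF: "integrable M (\<lambda>x. \<bar>F x\<bar> powr r)"
  proof (rule fatou_real(1)[OF int _ K])
    show "AE x in M. (\<lambda>n. \<bar>f n x\<bar> powr r) \<longlonglongrightarrow> \<bar>F x\<bar> powr r"
    proof (rule AE_I2)
      fix x assume "x \<in> space M"
      then show "(\<lambda>n. \<bar>f n x\<bar> powr r) \<longlonglongrightarrow> \<bar>F x\<bar> powr r"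
        using lim r by (intro tendsto_powr' tendsto_intros) auto
    qed
  qed auto
  \<comment> \<open>The crude choice \<delta> = 1 already gives integrability of |f n - F|^r and a
    bound uniform in n.\<close>
  obtain C1 where C1: "C1 \<ge> 0" "\<And>a b. \<bar>\<bar>a + b\<bar> powr r - \<bar>a\<bar> powr r\<bar> \<le> 1 * \<bar>a\<bar> powr r + C1 * \<bar>b\<bar> powr r"
    using abs_powr_add_diff_le[OF r, of 1] by auto
  have w1: "\<bar>f n x - F x\<bar> powr r \<le> 2 * \<bar>f n x\<bar> powr r + C1 * \<bar>F x\<bar> powr r" for n x
    using C1(2)[of "f n x" "- F x"] by simp
  have iw: "integrable M (\<lambda>x. \<bar>f n x - F x\<bar> powr r)" for n
  proof (rule Bochner_Integration.integrable_bound)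
    show "integrable M (\<lambda>x. 2 * \<bar>f n x\<bar> powr r + C1 * \<bar>F x\<bar> powr r)" using int iF by auto
    show "AE x in M. norm (\<bar>f n x - F x\<bar> powr r) \<le> norm (2 * \<bar>f n x\<bar> powr r + C1 * \<bar>F x\<bar> powr r)"
      using w1 C1 by (intro AE_I2) (auto intro: order_trans[OF _ abs_ge_self])
  qed measurable
  then show "integrable M (\<lambda>x. \<bar>f n x - F x\<bar> powr r)" for n .
  define K2 where "K2 = 2 * K + C1 * (\<integral>x. \<bar>F x\<bar> powr r \<partial>M)"
  have K2: "(\<integral>x. \<bar>f n x - F x\<bar> powr r \<partial>M) \<le> K2" for n
  proof -
    have "(\<integral>x. \<bar>f n x - F x\<bar> powr r \<partial>M) \<le> (\<integral>x. 2 * \<bar>f n x\<bar> powr r + C1 * \<bar>F x\<bar> powr r \<partial>M)"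
      using int iF iw w1 by (intro integral_mono) auto
    also have "\<dots> = 2 * (\<integral>x. \<bar>f n x\<bar> powr r \<partial>M) + C1 * (\<integral>x. \<bar>F x\<bar> powr r \<partial>M)"
      using int iF by simp
    finally show ?thesis using K[of n] by (simp add: K2_def)
  qed
  have "0 \<le> (\<integral>x. \<bar>f 0 x - F x\<bar> powr r \<partial>M)" by simp
  then have K20: "K2 \<ge> 0" using K2[of 0] by linarith
  let ?h = "\<lambda>n x. \<bar>\<bar>f n x\<bar> powr r - \<bar>f n x - F x\<bar> powr r - \<bar>F x\<bar> powr r\<bar>"
  have ih: "integrable M (?h n)" for n using int iF iw by auto
  show "(\<lambda>n. \<integral>x. ?h n x \<partial>M) \<longlonglongrightarrow> 0"
  proof (rule LIMSEQ_I)
    fix e :: real assume e: "e > 0"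
    define \<delta> where "\<delta> = e / (2 * (K2 + 1))"
    have \<delta>: "\<delta> > 0" using e K20 by (simp add: \<delta>_def)
    have \<delta>K: "\<delta> * K2 < e / 2 + e/4"
    proof -
      have "\<delta> * K2 \<le> \<delta> * (K2+1)" using \<delta> by simp
      also have "\<dots> = e/2" using K20 by (simp add: \<delta>_def field_simps)
      finally show ?thesis using e by simp
    qed
    obtain C where C: "C \<ge> 0" "\<And>a b. \<bar>\<bar>a + b\<bar> powr r - \<bar>a\<bar> powr r\<bar> \<le> \<delta> * \<bar>a\<bar> powr r + C * \<bar>b\<bar> powr r"
      using abs_powr_add_diff_le[OF r \<delta>] by auto
    define p where "p n x = max 0 (?h n x - \<delta> * \<bar>f n x - F x\<bar> powr r)" for n x
    have h1: "?h n x \<le> \<delta> * \<bar>f n x - F x\<bar> powr r + (C + 1) * \<bar>F x\<bar> powr r" for n x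
    proof -
      have "\<bar>\<bar>f n x\<bar> powr r - \<bar>f n x - F x\<bar> powr r\<bar> \<le> \<delta> * \<bar>f n x - F x\<bar> powr r + C * \<bar>F x\<bar> powr r"
        using C(2)[of "f n x - F x" "F x"] by simp
      then show ?thesis using powr_ge_zero[of "\<bar>F x\<bar>" r] unfolding distrib_right by linarith
    qed
    have p: "p n x \<le> (C + 1) * \<bar>F x\<bar> powr r" "p n x \<ge> 0" for n x
      using h1[of n x] C by (auto simp: p_def)
    have "(\<lambda>n. integral\<^sup>L M (p n)) \<longlonglongrightarrow> (\<integral>x. 0 \<partial>M)"
    proof (rule integral_dominated_convergence)
      show "integrable M (\<lambda>x. (C + 1) * \<bar>F x\<bar> powr r)" using iF by auto
      show "AE x in M. norm (p n x) \<le> (C + 1) * \<bar>F x\<bar> powr r" for n using p by auto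
      show "AE x in M. (\<lambda>n. p n x) \<longlonglongrightarrow> 0"
      proof (rule AE_I2)
        fix x assume x: "x \<in> space M"
        have "(\<lambda>n. \<bar>f n x - F x\<bar> powr r) \<longlonglongrightarrow> \<bar>F x - F x\<bar> powr r"
          using lim[OF x] r by (intro tendsto_powr' tendsto_intros) auto
        then have w: "(\<lambda>n. \<bar>f n x - F x\<bar> powr r) \<longlonglongrightarrow> 0" using r by simp
        have f: "(\<lambda>n. \<bar>f n x\<bar> powr r) \<longlonglongrightarrow> \<bar>F x\<bar> powr r"
          using lim[OF x] r by (intro tendsto_powr' tendsto_intros) auto
        have "(\<lambda>n. max 0 (?h n x - \<delta> * \<bar>f n x - F x\<bar> powr r)) \<longlonglongrightarrow> max 0 (\<bar>\<bar>F x\<bar> powr r - 0 - \<bar>F x\<bar> powr r\<bar> - \<delta> * 0)"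
          by (intro tendsto_intros w f)
        then show "(\<lambda>n. p n x) \<longlonglongrightarrow> 0" by (simp add: p_def)
      qed
    qed (auto simp: p_def[abs_def])
    then have "\<forall>\<^sub>F n in sequentially. integral\<^sup>L M (p n) < e/4"
      using e by (intro order_tendstoD(2)[where y="0"]) auto
    then obtain N where N: "\<And>n. n \<ge> N \<Longrightarrow> integral\<^sup>L M (p n) < e/4"
      by (auto simp: eventually_sequentially)
    show "\<exists>N. \<forall>n\<ge>N. norm ((\<integral>x. ?h n x \<partial>M) - 0) < e"
    proof (intro exI[of _ N] allI impI)
      fix n assume n: "N \<le> n"
      have ip: "integrable M (p n)" using ih iw unfolding p_def[abs_def] by auto
      have "(\<integral>x. ?h n x \<partial>M) \<le> (\<integral>x. p n x + \<delta> * \<bar>f n x - F x\<bar> powr r \<partial>M)"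
      proof (intro integral_mono)
        show "?h n x \<le> p n x + \<delta> * \<bar>f n x - F x\<bar> powr r" for x unfolding p_def by linarith
      qed (use ih ip iw in auto)
      also have "\<dots> = integral\<^sup>L M (p n) + \<delta> * (\<integral>x. \<bar>f n x - F x\<bar> powr r \<partial>M)"
        using ip iw by simp
      also have "\<dots> < e/4 + \<delta> * K2 "
        using N[OF n] K2[of n] \<delta> by (intro add_less_le_mono mult_left_mono) auto
      finally have "(\<integral>x. ?h n x \<partial>M) < e" using \<delta>K by simp
      moreover have "(\<integral>x. ?h n x \<partial>M) \<ge> 0" by simp
      ultimately show "norm ((\<integral>x. ?h n x \<partial>M) - 0) < e" by simp
    qed
  qed
qed

section \<open>Square-integrable functions\<close>

lemma integrable_mult_L2:
  fixes f g :: "'a \<Rightarrow> real"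
  assumes [measurable]: "f \<in> borel_measurable M" "g \<in> borel_measurable M"
    and "integrable M (\<lambda>x. (f x)\<^sup>2)" "integrable M (\<lambda>x. (g x)\<^sup>2)"
  shows "integrable M (\<lambda>x. f x * g x)"
proof (rule Bochner_Integration.integrable_bound)
  show "integrable M (\<lambda>x. (f x)\<^sup>2 + (g x)\<^sup>2)" using assms by auto
  have "\<bar>a * b\<bar> \<le> a\<^sup>2 + b\<^sup>2" for a b :: real
    using sum_squares_bound[of "\<bar>a\<bar>" "\<bar>b\<bar>"] mult_nonneg_nonneg[of "\<bar>a\<bar>" "\<bar>b\<bar>"]
    unfolding abs_mult power2_abs by linarith
  then show "AE x in M. norm (f x * g x) \<le> norm ((f x)\<^sup>2 + (g x)\<^sup>2)"
    by (intro AE_I2) (auto intro: order_trans[OF _ abs_ge_self])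
qed measurable

lemma integrable_add_square:
  fixes f g :: "'a \<Rightarrow> real"
  assumes "f \<in> borel_measurable M" "g \<in> borel_measurable M"
    and "integrable M (\<lambda>x. (f x)\<^sup>2)" "integrable M (\<lambda>x. (g x)\<^sup>2)"
  shows "integrable M (\<lambda>x. (f x + g x)\<^sup>2)" "integrable M (\<lambda>x. (f x - g x)\<^sup>2)"
  using integrable_mult_L2[OF assms] assms
  by (auto simp: power2_sum power2_diff mult.assoc)

lemma Cauchy_Schwarz_integral:
  fixes f g :: "'a \<Rightarrow> real"
  assumes [measurable]: "f \<in> borel_measurable M" "g \<in> borel_measurable M"
    and i: "integrable M (\<lambda>x. (f x)\<^sup>2)" "integrable M (\<lambda>x. (g x)\<^sup>2)"
  shows "(\<integral>x. \<bar>f x * g x\<bar> \<partial>M)\<^sup>2 \<le> (\<integral>x. (f x)\<^sup>2 \<partial>M) * (\<integral>x. (g x)\<^sup>2 \<partial>M)"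
proof -
  have "(\<integral>\<^sup>+x. ennreal \<bar>f x\<bar> * ennreal \<bar>g x\<bar> \<partial>M)\<^sup>2
      \<le> (\<integral>\<^sup>+x. (ennreal \<bar>f x\<bar>)\<^sup>2 \<partial>M) * (\<integral>\<^sup>+x. (ennreal \<bar>g x\<bar>)\<^sup>2 \<partial>M)"
    by (rule Cauchy_Schwarz_nn_integral) measurable
  also have "(\<integral>\<^sup>+x. ennreal \<bar>f x\<bar> * ennreal \<bar>g x\<bar> \<partial>M) = (\<integral>\<^sup>+x. ennreal \<bar>f x * g x\<bar> \<partial>M)"
    by (simp add: abs_mult ennreal_mult)
  also have "\<dots> = ennreal (\<integral>x. \<bar>f x * g x\<bar> \<partial>M)"
    using integrable_mult_L2[OF assms] by (intro nn_integral_eq_integral) auto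
  also have "(\<integral>\<^sup>+x. (ennreal \<bar>f x\<bar>)\<^sup>2 \<partial>M) = ennreal (\<integral>x. (f x)\<^sup>2 \<partial>M)"
    using i by (subst nn_integral_eq_integral[symmetric]) (auto simp: ennreal_power)
  also have "(\<integral>\<^sup>+x. (ennreal \<bar>g x\<bar>)\<^sup>2 \<partial>M) = ennreal (\<integral>x. (g x)\<^sup>2 \<partial>M)"
    using i by (subst nn_integral_eq_integral[symmetric]) (auto simp: ennreal_power)
  finally show ?thesis
    by (subst (asm) ennreal_power, simp, subst (asm) ennreal_mult[symmetric]) (auto simp: ennreal_le_iff)
qed

lemma Cauchy_Schwarz_integral_sqrt:
  fixes f g :: "'a \<Rightarrow> real"
  assumes "f \<in> borel_measurable M" "g \<in> borel_measurable M"
    and "integrable M (\<lambda>x. (f x)\<^sup>2)" "integrable M (\<lambda>x. (g x)\<^sup>2)"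
  shows "(\<integral>x. \<bar>f x * g x\<bar> \<partial>M) \<le> sqrt (\<integral>x. (f x)\<^sup>2 \<partial>M) * sqrt (\<integral>x. (g x)\<^sup>2 \<partial>M)"
    "\<bar>\<integral>x. f x * g x \<partial>M\<bar> \<le> sqrt (\<integral>x. (f x)\<^sup>2 \<partial>M) * sqrt (\<integral>x. (g x)\<^sup>2 \<partial>M)"
proof -
  show "(\<integral>x. \<bar>f x * g x\<bar> \<partial>M) \<le> sqrt (\<integral>x. (f x)\<^sup>2 \<partial>M) * sqrt (\<integral>x. (g x)\<^sup>2 \<partial>M)"
    using Cauchy_Schwarz_integral[OF assms] by (simp add: real_le_rsqrt flip: real_sqrt_mult)
  then show "\<bar>\<integral>x. f x * g x \<partial>M\<bar> \<le> sqrt (\<integral>x. (f x)\<^sup>2 \<partial>M) * sqrt (\<integral>x. (g x)\<^sup>2 \<partial>M)"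
    using integral_abs_bound[of M "\<lambda>x. f x * g x"] by linarith
qed

text \<open>Riesz-Fischer by a fast subsequence: squared increments of size 4^-k stay summable after
  multiplication by 2^k, which yields almost everywhere convergence; Fatou then carries the Cauchy
  estimate to the limit.\<close>

lemma L2_complete:
  fixes a :: "nat \<Rightarrow> 'a \<Rightarrow> real"
  assumes [measurable]: "\<And>n. a n \<in> borel_measurable M"
    and int: "\<And>n. integrable M (\<lambda>x. (a n x)\<^sup>2)"
    and cauchy: "\<And>e. e > 0 \<Longrightarrow> \<exists>N. \<forall>m\<ge>N. \<forall>n\<ge>N. (\<integral>x. (a m x - a n x)\<^sup>2 \<partial>M) < e"
  obtains g where "g \<in> borel_measurable M" "integrable M (\<lambda>x. (g x)\<^sup>2)"
    "(\<lambda>n. \<integral>x. (a n x - g x)\<^sup>2 \<partial>M) \<longlonglongrightarrow> 0"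
proof -
  have id: "integrable M (\<lambda>x. (a m x - a n x)\<^sup>2)" for m n
    using int by (intro integrable_add_square) auto
  have "\<forall>k. \<exists>N. \<forall>m\<ge>N. \<forall>n\<ge>N. (\<integral>x. (a m x - a n x)\<^sup>2 \<partial>M) < (1/4)^k"
    using cauchy by simp
  then obtain N where N: "\<And>k m n. m \<ge> N k \<Longrightarrow> n \<ge> N k \<Longrightarrow> (\<integral>x. (a m x - a n x)\<^sup>2 \<partial>M) < (1/4)^k"
    by metis
  define s where "s k = (\<Sum>i\<le>k. N i)" for k
  have sN: "s k \<ge> N j" if "j \<le> k" for k j
    unfolding s_def using that by (intro member_le_sum) auto
  let ?x = "\<lambda>k x. \<bar>a (s (Suc k)) x - a (s k) x\<bar>"
  have "(\<integral>\<^sup>+x. (\<Sum>k. ennreal (2^k * (?x k x)\<^sup>2)) \<partial>M) = (\<Sum>k. \<integral>\<^sup>+x. ennreal (2^k * (?x k x)\<^sup>2) \<partial>M)"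
    by (intro nn_integral_suminf) measurable
  also have "\<dots> \<le> (\<Sum>k. ennreal ((1/2)^k))"
  proof (intro suminf_le)
    fix k
    have "(\<integral>\<^sup>+x. ennreal (2^k * (?x k x)\<^sup>2) \<partial>M) = ennreal (\<integral>x. 2^k * (?x k x)\<^sup>2 \<partial>M)"
      using id by (intro nn_integral_eq_integral) auto
    also have "(\<integral>x. 2^k * (?x k x)\<^sup>2 \<partial>M) = 2^k * (\<integral>x. (a (s (Suc k)) x - a (s k) x)\<^sup>2 \<partial>M)"
      by simp
    also have "\<dots> \<le> 2^k * (1/4)^k"
      using N[of k "s (Suc k)" "s k"] sN by (intro mult_left_mono) (auto intro: less_imp_le)
    also have "\<dots> = (1/2)^k" by (simp flip: power_mult_distrib)
    finally show "(\<integral>\<^sup>+x. ennreal (2^k * (?x k x)\<^sup>2) \<partial>M) \<le> ennreal ((1/2)^k)"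
      by (simp add: ennreal_leI)
  qed auto
  also have "\<dots> = ennreal (\<Sum>k. (1/2)^k)"
    by (intro suminf_ennreal2) auto
  also have "\<dots> < \<infinity>" by simp
  finally have fin: "(\<integral>\<^sup>+x. (\<Sum>k. ennreal (2^k * (?x k x)\<^sup>2)) \<partial>M) \<noteq> \<infinity>" by simp
  have "AE x in M. (\<Sum>k. ennreal (2^k * (?x k x)\<^sup>2)) \<noteq> \<infinity>"
    using fin by (intro nn_integral_PInf_AE) auto
  then have conv: "AE x in M. convergent (\<lambda>k. a (s k) x)"
  proof eventually_elim
    fix x assume "(\<Sum>k. ennreal (2^k * (?x k x)\<^sup>2)) \<noteq> \<infinity>"
    then have sm: "summable (\<lambda>k. 2^k * (?x k x)\<^sup>2)"
      by (intro summable_suminf_not_top) auto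
    have "summable (\<lambda>k. a (s (Suc k)) x - a (s k) x)"
    proof (rule summable_comparison_test')
      show "summable (\<lambda>k. (1/2)^k + 2^k * (?x k x)\<^sup>2)"
        using sm by (intro summable_add) auto
      fix k :: nat assume "k \<ge> 0"
      \<comment> \<open>Either y is at most 2^-k, or 2^k y exceeds 1. This converts weighted square
        summability into absolute summability of the increments.\<close>
      have "y \<le> (1/2)^k + 2^k * y\<^sup>2" if "y \<ge> 0" for y :: real
      proof (cases "y \<le> (1/2)^k")
        case True then show ?thesis by (smt (verit) mult_nonneg_nonneg zero_le_power2 zero_le_power)
      next
        case False
        then have "y * 1 \<le> y * (2^k * y)" using that by (intro mult_left_mono) (auto simp: field_simps)
        then show ?thesis by (smt (verit, ccfv_SIG) mult.assoc mult.commute power2_eq_square zero_le_power divide_nonneg_nonneg)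
      qed
      from this[of "?x k x"]
      show "norm (a (s (Suc k)) x - a (s k) x) \<le> (1/2)^k + 2^k * (?x k x)\<^sup>2" by simp
    qed
    then have "convergent (\<lambda>n. \<Sum>k<n. a (s (Suc k)) x - a (s k) x)"
      by (simp add: summable_iff_convergent)
    then have "convergent (\<lambda>n. (a (s n) x - a (s 0) x) + a (s 0) x)"
      by (intro convergent_add convergent_const) (simp add: sum_lessThan_telescope[of "\<lambda>k. a (s k) x"])
    then show "convergent (\<lambda>k. a (s k) x)" by simp
  qed
  define g where "g x = lim (\<lambda>k. a (s k) x)" for x
  have g[measurable]: "g \<in> borel_measurable M"
    unfolding g_def[abs_def] by (intro borel_measurable_lim_metric) auto
  have lim: "AE x in M. (\<lambda>k. a (s k) x) \<longlonglongrightarrow> g x"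
    using conv by eventually_elim (simp add: g_def convergent_LIMSEQ_iff)
  have key: "integrable M (\<lambda>x. (a n x - g x)\<^sup>2)" "(\<integral>x. (a n x - g x)\<^sup>2 \<partial>M) \<le> (1/4)^k"
    if "n \<ge> N k" for n k
  proof -
    have 1: "(\<integral>x. (a n x - a (s (j + k)) x)\<^sup>2 \<partial>M) \<le> (1/4)^k" for j
      using N[of k n "s (j+k)"] that sN by (auto intro: less_imp_le)
    have 2: "AE x in M. (\<lambda>j. (a n x - a (s (j + k)) x)\<^sup>2) \<longlonglongrightarrow> (a n x - g x)\<^sup>2"
      using lim
    proof eventually_elim
      fix x assume "(\<lambda>k. a (s k) x) \<longlonglongrightarrow> g x"
      then have "(\<lambda>j. a (s (j + k)) x) \<longlonglongrightarrow> g x" by (rule LIMSEQ_ignore_initial_segment)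
      then show "(\<lambda>j. (a n x - a (s (j + k)) x)\<^sup>2) \<longlonglongrightarrow> (a n x - g x)\<^sup>2"
        by (intro tendsto_intros)
    qed
    show "integrable M (\<lambda>x. (a n x - g x)\<^sup>2)"
      by (rule fatou_real(1)[OF id _ 1 _ 2]) auto
    show "(\<integral>x. (a n x - g x)\<^sup>2 \<partial>M) \<le> (1/4)^k"
      by (rule fatou_real(2)[OF id _ 1 _ 2]) auto
  qed
  show ?thesis
  proof (rule that[OF g])
    have "integrable M (\<lambda>x. (a (N 0) x - (a (N 0) x - g x))\<^sup>2)"
      using int key(1)[of 0 "N 0"]
      by (intro integrable_add_square(2)[of "a (N 0)" M "\<lambda>x. a (N 0) x - g x"]) auto
    then show "integrable M (\<lambda>x. (g x)\<^sup>2)" by simp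
    show "(\<lambda>n. \<integral>x. (a n x - g x)\<^sup>2 \<partial>M) \<longlonglongrightarrow> 0"
    proof (rule LIMSEQ_I)
      fix e :: real assume "e > 0"
      then obtain k where k: "(1/4)^k < e" using real_arch_pow_inv[of e "1/4"] by auto
      show "\<exists>N. \<forall>n\<ge>N. norm ((\<integral>x. (a n x - g x)\<^sup>2 \<partial>M) - 0) < e"
      proof (intro exI[of _ "N k"] allI impI)
        fix n assume "N k \<le> n"
        moreover have "0 \<le> (\<integral>x. (a n x - g x)\<^sup>2 \<partial>M)" by simp
        ultimately show "norm ((\<integral>x. (a n x - g x)\<^sup>2 \<partial>M) - 0) < e"
          using key(2)[of k n] k by simp
      qed
    qed
  qed
qed

text \<open>Iterated midpoints of a tail of the sequence, that is, convex combinations with dyadic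
  weights. Later tails have smaller hulls, which is what lets limits of pairings along the sequence
  pass to the hull.\<close>

inductive_set midhull :: "(nat \<Rightarrow> 'a \<Rightarrow> real) \<Rightarrow> nat \<Rightarrow> ('a \<Rightarrow> real) set" for G n where
  base: "k \<ge> n \<Longrightarrow> G k \<in> midhull G n"
| mid: "a \<in> midhull G n \<Longrightarrow> b \<in> midhull G n \<Longrightarrow> (\<lambda>x. (a x + b x) / 2) \<in> midhull G n"

lemma midhull_mono: "m \<le> n \<Longrightarrow> midhull G n \<subseteq> midhull G m"
proof
  fix a assume "m \<le> n" "a \<in> midhull G n"
  from this(2,1) show "a \<in> midhull G m" by induction (auto intro: midhull.intros)
qed

lemma midhull_L2:
  fixes G :: "nat \<Rightarrow> 'a \<Rightarrow> real"
  assumes "\<And>n. G n \<in> borel_measurable M" "\<And>n. integrable M (\<lambda>x. (G n x)\<^sup>2)"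
    and "a \<in> midhull G n"
  shows "a \<in> borel_measurable M \<and> integrable M (\<lambda>x. (a x)\<^sup>2)"
  using assms(3)
proof induction
  case (mid a b)
  then have "integrable M (\<lambda>x. (a x + b x)\<^sup>2 / 4)" by (intro integrable_divide integrable_add_square) auto
  then show ?case using mid by (auto simp: power_divide)
qed (use assms in auto)

text \<open>Of the convex hull in Mazur's lemma only the midpoints in the parallelogram identity are needed.\<close>

lemma mazur_midhull:
  fixes G :: "nat \<Rightarrow> 'a \<Rightarrow> real"
  assumes m: "\<And>n. G n \<in> borel_measurable M" and int: "\<And>n. integrable M (\<lambda>x. (G n x)\<^sup>2)"
    and K: "\<And>n. (\<integral>x. (G n x)\<^sup>2 \<partial>M) \<le> K"
  obtains a g where "\<And>n. a n \<in> midhull G n" "g \<in> borel_measurable M" "integrable M (\<lambda>x. (g x)\<^sup>2)"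
    "(\<lambda>n. \<integral>x. (a n x - g x)\<^sup>2 \<partial>M) \<longlonglongrightarrow> 0"
proof -
  let ?I = "\<lambda>a. \<integral>x. (a x)\<^sup>2 \<partial>M"
  define d where "d n = Inf (?I ` midhull G n)" for n
  have ne: "midhull G n \<noteq> {}" for n using midhull.base[of n n G] by auto
  have bb: "bdd_below (?I ` midhull G n)" for n by (rule bdd_belowI[of _ 0]) auto
  have dle: "d n \<le> ?I a" if "a \<in> midhull G n" for a n
    unfolding d_def using that bb by (intro cInf_lower) auto
  have dmono: "d m \<le> d n" if "m \<le> n" for m n
    unfolding d_def using that midhull_mono[OF that, of G] bb ne
    by (intro cInf_superset_mono) auto
  have dK: "d n \<le> K" for n using dle[OF midhull.base[of n n G]] K[of n] by auto
  have "incseq d" using dmono by (simp add: incseq_def)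
  then obtain l where "d \<longlonglongrightarrow> l" using incseq_convergent[of d K] dK by metis
  then have "convergent d" by (rule convergentI)
  then have dC: "Cauchy d" by (rule convergent_Cauchy)
  have "\<exists>a\<in>midhull G n. ?I a < d n + 1 / real (Suc n)" for n
    using cInf_lessD[of "?I ` midhull G n" "d n + 1 / real (Suc n)"] ne unfolding d_def by auto
  then obtain a where a: "\<And>n. a n \<in> midhull G n" "\<And>n. ?I (a n) < d n + 1 / real (Suc n)" by metis
  have aL[measurable]: "a n \<in> borel_measurable M" and ai: "integrable M (\<lambda>x. (a n x)\<^sup>2)" for n
    using midhull_L2[OF m int a(1)] by auto
  \<comment> \<open>\<open>d n\<close> is the least squared norm over the hull of the tail from n;
    it increases and is bounded by \<open>K\<close>. The midpoint of two near-minimizers still has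
    squared norm at least \<open>d N\<close>, so the parallelogram identity forces them close
    together.\<close>
  have par: "(\<integral>x. (a p x - a q x)\<^sup>2 \<partial>M) \<le> 4 / real (Suc N) + 2 * \<bar>d p - d N\<bar> + 2 * \<bar>d q - d N\<bar>"
    if "N \<le> p" "N \<le> q" for N p q
  proof -
    have ip: "integrable M (\<lambda>x. (a p x + a q x)\<^sup>2)" "integrable M (\<lambda>x. (a p x - a q x)\<^sup>2)"
      using ai by (auto intro: integrable_add_square)
    have h: "(\<lambda>x. (a p x + a q x) / 2) \<in> midhull G N"
      using a(1) midhull_mono that by (intro midhull.mid) blast+
    have "d N \<le> (\<integral>x. (a p x + a q x)\<^sup>2 \<partial>M) / 4"
      using dle[OF h] by (simp add: power_divide)
    moreover have "(\<integral>x. (a p x - a q x)\<^sup>2 \<partial>M) + (\<integral>x. (a p x + a q x)\<^sup>2 \<partial>M) = 2 * ?I (a p) + 2 * ?I (a q)"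
    proof -
      have "(\<integral>x. (a p x - a q x)\<^sup>2 \<partial>M) + (\<integral>x. (a p x + a q x)\<^sup>2 \<partial>M)
         = (\<integral>x. (a p x - a q x)\<^sup>2 + (a p x + a q x)\<^sup>2 \<partial>M)" using ip by simp
      also have "\<dots> = (\<integral>x. 2 * (a p x)\<^sup>2 + 2 * (a q x)\<^sup>2 \<partial>M)"
        by (intro Bochner_Integration.integral_cong) (auto simp: power2_eq_square algebra_simps)
      also have "\<dots> = 2 * ?I (a p) + 2 * ?I (a q)" using ai by simp
      finally show ?thesis .
    qed
    moreover define s where "s = 1 / real (Suc N)"
    have "1 / real (Suc p) \<le> s" "1 / real (Suc q) \<le> s"
      using that by (auto simp: s_def intro!: divide_left_mono)
    then have "?I (a p) < d p + s" "?I (a q) < d q + s"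
      using a(2)[of p] a(2)[of q] by (auto intro: less_le_trans)
    moreover have s4: "4 / real (Suc N) = 4 * s" by (simp add: s_def)
    moreover have "A \<le> 4 * s + 2 * \<bar>dp - dN\<bar> + 2 * \<bar>dq - dN\<bar>"
      if "dN \<le> B / 4" "A + B = 2 * C + 2 * D" "C < dp + s" "D < dq + s" for A B C D dp dq dN :: real
    proof -
      have "A + 4 * dN \<le> 2 * C + 2 * D" using that by argo
      then have "A \<le> 4 * s + 2 * (dp - dN) + 2 * (dq - dN)" using that by argo
      then show ?thesis by argo
    qed
    ultimately show ?thesis unfolding s4 by blast
  qed
  have cau: "\<exists>N. \<forall>m\<ge>N. \<forall>n\<ge>N. (\<integral>x. (a m x - a n x)\<^sup>2 \<partial>M) < e" if "e > 0" for e
  proof -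
    obtain N1 where N1: "\<And>m n. m \<ge> N1 \<Longrightarrow> n \<ge> N1 \<Longrightarrow> \<bar>d m - d n\<bar> < e/12"
      using CauchyD[OF dC, of "e/12"] \<open>e > 0\<close> by (auto simp: real_norm_def)
    obtain N2 where N2: "4 / real (Suc N2) < e/3"
      using reals_Archimedean[of "e/12"] \<open>e > 0\<close> by (auto simp: field_simps)
    define N where "N = max N1 N2"
    have "4 / real (Suc N) \<le> 4 / real (Suc N2)" by (intro divide_left_mono) (auto simp: N_def)
    then have 4: "4 / real (Suc N) < e / 3" using N2 by linarith
    show ?thesis
    proof (intro exI[of _ N] allI impI)
      fix m n assume mn: "N \<le> m" "N \<le> n"
      have "\<bar>d m - d N\<bar> < e/12" "\<bar>d n - d N\<bar> < e/12"
        using mn by (intro N1; simp add: N_def)+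
      then show "(\<integral>x. (a m x - a n x)\<^sup>2 \<partial>M) < e"
        using par[OF mn] 4 \<open>e > 0\<close> by argo
    qed
  qed
  obtain g where "g \<in> borel_measurable M" "integrable M (\<lambda>x. (g x)\<^sup>2)"
    "(\<lambda>n. \<integral>x. (a n x - g x)\<^sup>2 \<partial>M) \<longlonglongrightarrow> 0"
    by (rule L2_complete[OF aL ai cau])
  then show ?thesis using that a(1) by blast
qed

text \<open>The positive and negative parts of h, cut off outside [0, L], are densities of two
  finite measures that agree on all half-lines. Half-lines are an intersection-stable generator of
  the Borel sets, so the measures coincide.\<close>

lemma AE_zero_of_interval_integrals:
  fixes h :: "real \<Rightarrow> real"
  assumes i: "set_integrable lborel {0..L} h"
    and z: "\<And>x. x \<in> {0..L} \<Longrightarrow> (LINT t:{0..x}|lborel. h t) = 0"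
  shows "AE t in lborel. t \<in> {0..L} \<longrightarrow> h t = 0"
proof -
  define F where "F t = indicator {0..L} t * h t" for t
  have F: "integrable lborel F" using i by (simp add: F_def[abs_def] set_integrable_def)
  have down: "(LINT t:{..x}|lborel. F t) = 0" for x
  proof -
    have "(LINT t:{..x}|lborel. F t) = (LINT t:{0..min x L}|lborel. h t)"
      unfolding F_def set_lebesgue_integral_def
      by (intro Bochner_Integration.integral_cong) (auto simp: indicator_def)
    also have "\<dots> = 0"
    proof (cases "0 \<le> min x L")
      case True then show ?thesis using z[of "min x L"] by auto
    next
      case False then show ?thesis by (simp add: set_lebesgue_integral_def)
    qed
    finally show ?thesis .
  qed
  have all: "(LINT t:A|lborel. F t) = 0" if "A \<in> sets lborel" for A
  proof -
    have Fm[measurable]: "F \<in> borel_measurable borel" using F by (auto dest: borel_measurable_integrable)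
    define P where "P t = max 0 (F t)" for t
    define Q where "Q t = max 0 (- F t)" for t
    have iP: "integrable lborel P" "integrable lborel Q" using F by (auto simp: P_def[abs_def] Q_def[abs_def])
    have PQ: "F t = P t - Q t" for t by (auto simp: P_def Q_def)
    have mm: "emeasure (density lborel P) B = ennreal (LINT t:B|lborel. P t)"
      "emeasure (density lborel Q) B = ennreal (LINT t:B|lborel. Q t)" if "B \<in> sets borel" for B
    proof -
      have *: "(\<integral>\<^sup>+ t. ennreal (R t) * indicator B t \<partial>lborel) = ennreal (LINT t:B|lborel. R t)"
        if R: "integrable lborel R" "\<And>t. R t \<ge> 0" for R :: "real \<Rightarrow> real"
      proof -
        have "(\<integral>\<^sup>+ t. ennreal (R t) * indicator B t \<partial>lborel) = (\<integral>\<^sup>+ t. ennreal (indicator B t * R t) \<partial>lborel)"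
          by (intro nn_integral_cong) (auto simp: indicator_def)
        also have "\<dots> = ennreal (\<integral>t. indicator B t * R t \<partial>lborel)"
        proof (rule nn_integral_eq_integral)
          show "integrable lborel (\<lambda>t. indicator B t * R t)"
            using integrable_mult_indicator[of B lborel R] R \<open>B \<in> sets borel\<close> by simp
        qed (use R in auto)
        finally show ?thesis by (simp add: set_lebesgue_integral_def)
      qed
      show "emeasure (density lborel P) B = ennreal (LINT t:B|lborel. P t)"
        "emeasure (density lborel Q) B = ennreal (LINT t:B|lborel. Q t)"
        using that *[OF iP(1)] *[OF iP(2)] by (auto simp: emeasure_density P_def[abs_def] Q_def[abs_def])
    qed
    have si: "set_integrable lborel B P" "set_integrable lborel B Q" if "B \<in> sets borel" for B
      using that iP integrable_mult_indicator[of B lborel P] integrable_mult_indicator[of B lborel Q]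
      by (auto simp: set_integrable_def)
    have sub: "(LINT t:B|lborel. F t) = (LINT t:B|lborel. P t) - (LINT t:B|lborel. Q t)" if "B \<in> sets borel" for B
      using set_integral_diff(2)[OF si[OF that]] by (simp add: PQ)
    have eqm: "density lborel P = density lborel Q"
    proof (rule measure_eqI_generator_eq[where E="range (\<lambda>x::real. {..x})" and A="\<lambda>n. {..real n}" and \<Omega>=UNIV])
      show "Int_stable (range (\<lambda>x::real. {..x}))"
        by (auto simp: Int_stable_def)
      show "\<And>X. X \<in> range (\<lambda>x::real. {..x}) \<Longrightarrow> emeasure (density lborel P) X = emeasure (density lborel Q) X"
        using mm sub down by fastforce
      show "sets (density lborel P) = sigma_sets UNIV (range (\<lambda>x::real. {..x}))"
        "sets (density lborel Q) = sigma_sets UNIV (range (\<lambda>x::real. {..x}))"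
        by (auto simp: borel_eq_atMost)
      show "(\<Union>n. {..real n}) = (UNIV::real set)" by (auto intro: real_arch_simple)
      show "\<And>n. emeasure (density lborel P) {..real n} \<noteq> \<infinity>" using mm by auto
    qed auto
    have A: "A \<in> sets borel" using that by simp
    have "(LINT t:A|lborel. P t) = (LINT t:A|lborel. Q t)"
    proof -
      have "ennreal (LINT t:A|lborel. P t) = ennreal (LINT t:A|lborel. Q t)"
        using mm[OF A] eqm by simp
      moreover have "(LINT t:A|lborel. P t) \<ge> 0" "(LINT t:A|lborel. Q t) \<ge> 0"
        by (auto simp: set_lebesgue_integral_def P_def Q_def intro!: Bochner_Integration.integral_nonneg)
      ultimately show ?thesis by simp
    qed
    then show ?thesis using sub[OF A] by simp
  qed
  have "AE t in lborel. F t = 0"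
    using density_unique_real[of lborel F "\<lambda>_. 0"] F all by (auto simp: set_lebesgue_integral_def)
  then show ?thesis by eventually_elim (auto simp: F_def)
qed

section \<open>The grid as a measure space\<close>

text \<open>The bridge from infinite sums to integrals against counting measure. Through it Fubini,
  Cauchy-Schwarz, dominated convergence and the Brezis-Lieb lemma become available for sums over
  edges and vertices.\<close>

lemma count_space_nonneg:
  fixes f :: "'a \<Rightarrow> real"
  assumes "\<And>x. x \<in> A \<Longrightarrow> f x \<ge> 0"
  shows "integrable (count_space A) f \<longleftrightarrow> f summable_on A"
    "f summable_on A \<Longrightarrow> integral\<^sup>L (count_space A) f = infsum f A"
proof -
  have "f summable_on A \<longleftrightarrow> (\<lambda>x. norm (f x)) summable_on A"
    using assms by (intro summable_on_cong) auto
  then show 1: "integrable (count_space A) f \<longleftrightarrow> f summable_on A"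
    using abs_summable_equivalent[of f A] by (simp add: abs_summable_on_def)
  assume "f summable_on A"
  then show "integral\<^sup>L (count_space A) f = infsum f A"
    using infsetsum_infsum[of f A] 1 by (simp add: infsetsum_def abs_summable_on_def)
qed

(* Otherwise the simplifier splits every quantified edge into its three components. *)
declare split_paired_All[simp del] split_paired_Ex[simp del]

locale grid =
  fixes \<epsilon> :: real
  assumes eps_pos: "0 < \<epsilon>"
begin

definition seg :: "real measure" where
  "seg = restrict_space lborel {0..\<epsilon>}"

text \<open>Counting measure on the edges times Lebesgue measure on [0, \<epsilon>]. The graph is
  cut into disjoint edges, so a vertex occurs once for each edge ending there; these points form a
  null set, and every norm becomes a single integral.\<close>

definition gmeas :: "(edge \<times> real) measure" where
  "gmeas = count_space UNIV \<Otimes>\<^sub>M seg"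

definition lift :: "(real \<times> real \<Rightarrow> real) \<Rightarrow> edge \<times> real \<Rightarrow> real" where
  "lift u p = u (edge_pt \<epsilon> (fst p) (snd p))"

text \<open>Uncurried weak derivative. Square integrability is demanded over all edges together, so
  the summability condition in \<open>H1\<close> is built in.\<close>

definition wd :: "(real \<times> real \<Rightarrow> real) \<Rightarrow> (edge \<times> real \<Rightarrow> real) \<Rightarrow> bool" where
  "wd u g \<longleftrightarrow> g \<in> borel_measurable gmeas \<and> integrable gmeas (\<lambda>p. (g p)\<^sup>2) \<and>
     (\<forall>e. \<forall>x\<in>{0..\<epsilon>}. lift u (e, x) = lift u (e, 0) + (LINT t:{0..x}|lborel. g (e, t)))"

lemma space_seg[simp]: "space seg = {0..\<epsilon>}" by (simp add: seg_def)
lemma space_gmeas[simp]: "space gmeas = UNIV \<times> {0..\<epsilon>}" by (simp add: gmeas_def space_pair_measure)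

lemma integral_seg: "(\<integral>t. h t \<partial>seg) = (LINT t:{0..\<epsilon>}|lborel. h t)" for h :: "real \<Rightarrow> real"
  by (simp add: seg_def set_lebesgue_integral_def integral_restrict_space)

lemma integrable_seg: "integrable seg h \<longleftrightarrow> set_integrable lborel {0..\<epsilon>} h" for h :: "real \<Rightarrow> real"
  by (simp add: seg_def set_integrable_def integrable_restrict_space)

lemma finite_seg: "finite_measure seg"
  by (intro finite_measureI) (use eps_pos in \<open>simp add: seg_def emeasure_restrict_space\<close>)

lemma measure_seg_space: "measure seg {0..\<epsilon>} = \<epsilon>"
  using eps_pos by (simp add: seg_def measure_restrict_space)

lemma pair_sf: "pair_sigma_finite (count_space (UNIV::edge set)) seg"
  using finite_seg unfolding finite_measure_def
  by (intro pair_sigma_finite.intro sigma_finite_measure_count_space_countable) auto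

lemma section_measurable: "f \<in> borel_measurable gmeas \<Longrightarrow> (\<lambda>t. f (e, t)) \<in> borel_measurable seg"
  unfolding gmeas_def by (rule measurable_compose[OF measurable_Pair1']) auto

lemma seg_measurable_continuous:
  "continuous_on {0..\<epsilon>} h \<Longrightarrow> h \<in> borel_measurable seg" for h :: "real \<Rightarrow> real"
  using borel_measurable_continuous_on_restrict[of "{0..\<epsilon>}" h]
    measurable_cong_sets[OF sets_restrict_space_cong[OF sets_lborel, of "{0..\<epsilon>}"] refl, of "borel :: real measure"]
  unfolding seg_def by metis

lemma gmeas_measurableI:
  "(\<And>e. (\<lambda>t. f (e, t)) \<in> borel_measurable seg) \<Longrightarrow> f \<in> borel_measurable gmeas"
  unfolding gmeas_def by (rule measurable_pair_measure_countable1) auto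

text \<open>Tonelli: integrals against \<open>gmeas\<close> are the edgewise sums in the definitions
  of the norms, and integrability encodes both integrability on each edge and summability over the
  edges.\<close>

lemma gmeas_nonneg:
  fixes f :: "edge \<times> real \<Rightarrow> real"
  assumes m: "f \<in> borel_measurable gmeas" and nn: "\<And>p. f p \<ge> 0"
  shows "integrable gmeas f \<longleftrightarrow> (\<forall>e. integrable seg (\<lambda>t. f (e, t))) \<and> (\<lambda>e. \<integral>t. f (e, t) \<partial>seg) summable_on UNIV"
    and "integrable gmeas f \<Longrightarrow> integral\<^sup>L gmeas f = (\<Sum>\<^sub>\<infinity>e. \<integral>t. f (e, t) \<partial>seg)"
proof -
  interpret pair_sigma_finite "count_space (UNIV::edge set)" seg by (rule pair_sf)
  have 1: "(\<forall>e. integrable seg (\<lambda>t. f (e, t))) \<and> (\<lambda>e. \<integral>t. f (e, t) \<partial>seg) summable_on UNIV"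
    if i: "integrable gmeas f"
    using AE_integrable_fst'[of f] integrable_fst'[of f] i nn
    by (simp add: gmeas_def AE_count_space count_space_nonneg(1))
  have 2: "integrable gmeas f"
    if "(\<forall>e. integrable seg (\<lambda>t. f (e, t)))" "(\<lambda>e. \<integral>t. f (e, t) \<partial>seg) summable_on UNIV"
    unfolding gmeas_def using m that nn
    by (intro Fubini_integrable) (auto simp: gmeas_def AE_count_space count_space_nonneg(1))
  show "integrable gmeas f \<longleftrightarrow> (\<forall>e. integrable seg (\<lambda>t. f (e, t))) \<and> (\<lambda>e. \<integral>t. f (e, t) \<partial>seg) summable_on UNIV"
    using 1 2 by blast
  assume i: "integrable gmeas f"
  have "integral\<^sup>L gmeas f = (\<integral>e. (\<integral>t. f (e, t) \<partial>seg) \<partial>count_space UNIV)"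
    using integral_fst'[of f] i by (simp add: gmeas_def)
  also have "\<dots> = (\<Sum>\<^sub>\<infinity>e. \<integral>t. f (e, t) \<partial>seg)"
    using 1[OF i] nn by (intro count_space_nonneg(2)) auto
  finally show "integral\<^sup>L gmeas f = (\<Sum>\<^sub>\<infinity>e. \<integral>t. f (e, t) \<partial>seg)" .
qed

lemma seg_integrable_of_square:
  assumes "h \<in> borel_measurable seg" "integrable seg (\<lambda>t. (h t)\<^sup>2)"
  shows "integrable seg (h :: real \<Rightarrow> real)"
proof -
  interpret finite_measure seg by (rule finite_seg)
  show ?thesis using integrable_mult_L2[of h seg "\<lambda>_. 1"] assms by simp
qed

lemma wdD:
  assumes "wd u g"
  shows "g \<in> borel_measurable gmeas" "integrable gmeas (\<lambda>p. (g p)\<^sup>2)"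
    "(\<lambda>t. g (e, t)) \<in> borel_measurable seg" "integrable seg (\<lambda>t. (g (e, t))\<^sup>2)" "integrable seg (\<lambda>t. g (e, t))"
    "x \<in> {0..\<epsilon>} \<Longrightarrow> lift u (e, x) = lift u (e, 0) + (LINT t:{0..x}|lborel. g (e, t))"
proof -
  show g: "g \<in> borel_measurable gmeas" "integrable gmeas (\<lambda>p. (g p)\<^sup>2)" using assms by (auto simp: wd_def)
  show ge: "(\<lambda>t. g (e, t)) \<in> borel_measurable seg" by (rule section_measurable[OF g(1)])
  show ge2: "integrable seg (\<lambda>t. (g (e, t))\<^sup>2)" using gmeas_nonneg(1)[of "\<lambda>p. (g p)\<^sup>2"] g by simp
  show "integrable seg (\<lambda>t. g (e, t))" by (rule seg_integrable_of_square[OF ge ge2])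
  show "x \<in> {0..\<epsilon>} \<Longrightarrow> lift u (e, x) = lift u (e, 0) + (LINT t:{0..x}|lborel. g (e, t))"
    using assms unfolding wd_def by blast
qed

lemma wd_of_edge_weak_deriv:
  assumes "edge_weak_deriv \<epsilon> u g" "(\<lambda>e. LINT t:{0..\<epsilon>}|lborel. (g e t)\<^sup>2) summable_on UNIV"
  shows "wd u (\<lambda>(e, t). g e t)"
proof -
  have 1: "integrable seg (g e)" "integrable seg (\<lambda>t. (g e t)\<^sup>2)" for e
    using assms(1) by (auto simp: edge_weak_deriv_def integrable_seg)
  have m: "(\<lambda>(e, t). g e t) \<in> borel_measurable gmeas"
    using 1 by (intro gmeas_measurableI) auto
  moreover have "integrable gmeas (\<lambda>p. ((\<lambda>(e, t). g e t) p)\<^sup>2)"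
    using 1 assms(2) m by (subst gmeas_nonneg(1)) (auto simp: integral_seg)
  moreover have "lift u (e, x) = lift u (e, 0) + (LINT t:{0..x}|lborel. g e t)" if "x \<in> {0..\<epsilon>}" for e x
    using assms(1) that unfolding edge_weak_deriv_def lift_def fst_conv snd_conv by blast
  ultimately show ?thesis unfolding wd_def prod.case by blast
qed

lemma edge_weak_deriv_of_wd:
  assumes "wd u g"
  shows "edge_weak_deriv \<epsilon> u (curry g)"
    "(\<lambda>e. LINT t:{0..\<epsilon>}|lborel. (curry g e t)\<^sup>2) summable_on UNIV"
    "dersq_sum \<epsilon> (curry g) = (\<integral>p. (g p)\<^sup>2 \<partial>gmeas)"
proof -
  note w = wdD[OF assms]
  show "edge_weak_deriv \<epsilon> u (curry g)"
    using w(4-6) unfolding edge_weak_deriv_def integrable_seg[symmetric] curry_def lift_def fst_conv snd_conv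
    by blast
  show "(\<lambda>e. LINT t:{0..\<epsilon>}|lborel. (curry g e t)\<^sup>2) summable_on UNIV"
    "dersq_sum \<epsilon> (curry g) = (\<integral>p. (g p)\<^sup>2 \<partial>gmeas)"
    using gmeas_nonneg[of "\<lambda>p. (g p)\<^sup>2"] w by (auto simp: dersq_sum_def integral_seg)
qed

lemma weak_deriv_unique:
  assumes "edge_weak_deriv \<epsilon> u g" "edge_weak_deriv \<epsilon> u h"
  shows "AE t in lborel. t \<in> {0..\<epsilon>} \<longrightarrow> g e t = h e t"
proof -
  have i: "set_integrable lborel {0..\<epsilon>} (g e)" "set_integrable lborel {0..\<epsilon>} (h e)"
    using assms unfolding edge_weak_deriv_def by blast+
  have "AE t in lborel. t \<in> {0..\<epsilon>} \<longrightarrow> g e t - h e t = 0"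
  proof (rule AE_zero_of_interval_integrals)
    show "set_integrable lborel {0..\<epsilon>} (\<lambda>t. g e t - h e t)" using i by (rule set_integral_diff)
    fix x assume x: "x \<in> {0..\<epsilon>}"
    have "set_integrable lborel {0..x} (g e)" "set_integrable lborel {0..x} (h e)"
      using i x by (auto intro: set_integrable_subset)
    then have "(LINT t:{0..x}|lborel. g e t - h e t) = (LINT t:{0..x}|lborel. g e t) - (LINT t:{0..x}|lborel. h e t)"
      by (rule set_integral_diff)
    also have "\<dots> = 0" using assms x unfolding edge_weak_deriv_def by (metis add_left_cancel cancel_comm_monoid_add_class.diff_cancel)
    finally show "(LINT t:{0..x}|lborel. g e t - h e t) = 0" .
  qed
  then show ?thesis by eventually_elim auto
qed

text \<open>Competitors in the description operator need not be square integrable over the whole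
  graph, so they are compared with g edge by edge, where weak derivatives are unique almost
  everywhere.\<close>

lemma Dnorm2_eq:
  assumes "wd u g"
  shows "Dnorm2 \<epsilon> u = (\<integral>p. (g p)\<^sup>2 \<partial>gmeas)"
proof -
  have "dersq_sum \<epsilon> h = dersq_sum \<epsilon> (curry g)" if h: "edge_weak_deriv \<epsilon> u h" for h
    unfolding dersq_sum_def
  proof (intro infsum_cong)
    fix e
    have i: "set_integrable lborel {0..\<epsilon>} (\<lambda>t. (h e t)\<^sup>2)" "set_integrable lborel {0..\<epsilon>} (\<lambda>t. (curry g e t)\<^sup>2)"
      using h edge_weak_deriv_of_wd(1)[OF assms] unfolding edge_weak_deriv_def by blast+
    show "(LINT t:{0..\<epsilon>}|lborel. (h e t)\<^sup>2) = (LINT t:{0..\<epsilon>}|lborel. (curry g e t)\<^sup>2)"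
      unfolding set_lebesgue_integral_def
    proof (rule integral_cong_AE)
      show "AE t in lborel. indicator {0..\<epsilon>} t *\<^sub>R (h e t)\<^sup>2 = indicator {0..\<epsilon>} t *\<^sub>R (curry g e t)\<^sup>2"
        using weak_deriv_unique[OF h edge_weak_deriv_of_wd(1)[OF assms], of e]
        by eventually_elim (auto simp: indicator_def)
    qed (use i in \<open>auto simp: set_integrable_def dest: borel_measurable_integrable\<close>)
  qed
  then have "Dnorm2 \<epsilon> u = dersq_sum \<epsilon> (curry g)"
    unfolding Dnorm2_def using edge_weak_deriv_of_wd(1)[OF assms] by (intro the_equality) blast+
  then show ?thesis using edge_weak_deriv_of_wd(3)[OF assms] by simp
qed

lemma wd_unique:
  assumes "wd u g" "wd u h"
  shows "(\<integral>p. (g p - h p)\<^sup>2 \<partial>gmeas) = 0"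
proof -
  have i: "integrable gmeas (\<lambda>p. (g p - h p)\<^sup>2)"
    using wdD(1,2)[OF assms(1)] wdD(1,2)[OF assms(2)] by (intro integrable_add_square)
  have "(\<integral>t. (g (e, t) - h (e, t))\<^sup>2 \<partial>seg) = 0" for e
  proof -
    have "AE t in seg. (g (e, t) - h (e, t))\<^sup>2 = 0"
      using weak_deriv_unique[OF edge_weak_deriv_of_wd(1)[OF assms(1)] edge_weak_deriv_of_wd(1)[OF assms(2)], of e]
      unfolding seg_def by (subst AE_restrict_space_iff) auto
    then show ?thesis
      by (subst integral_cong_AE[where g="\<lambda>_. 0"]) (use wdD(3)[OF assms(1)] wdD(3)[OF assms(2)] in auto)
  qed
  then show ?thesis using gmeas_nonneg(2)[of "\<lambda>p. (g p - h p)\<^sup>2"] i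
    by (simp add: borel_measurable_integrable)
qed

lemma wd_lincomb:
  assumes "wd u g" "wd v h"
  shows "wd (\<lambda>x. a * u x + b * v x) (\<lambda>p. a * g p + b * h p)"
proof -
  note 1 = wdD[OF assms(1)] and 2 = wdD[OF assms(2)]
  have m: "(\<lambda>p. a * g p) \<in> borel_measurable gmeas" "(\<lambda>p. b * h p) \<in> borel_measurable gmeas"
    using 1(1) 2(1) by auto
  have "integrable gmeas (\<lambda>p. (a * g p + b * h p)\<^sup>2)"
    by (rule integrable_add_square(1)[OF m]) (use 1(2) 2(2) in \<open>auto simp: power_mult_distrib\<close>)
  moreover have "lift (\<lambda>x. a * u x + b * v x) (e, x) = lift (\<lambda>x. a * u x + b * v x) (e, 0)
      + (LINT t:{0..x}|lborel. a * g (e, t) + b * h (e, t))" if x: "x \<in> {0..\<epsilon>}" for e x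
  proof -
    have s: "set_integrable lborel {0..x} (\<lambda>t. g (e, t))" "set_integrable lborel {0..x} (\<lambda>t. h (e, t))"
      using 1(5)[of e] 2(5)[of e] x by (auto simp: integrable_seg intro: set_integrable_subset)
    have "(LINT t:{0..x}|lborel. a * g (e, t) + b * h (e, t))
       = a * (LINT t:{0..x}|lborel. g (e, t)) + b * (LINT t:{0..x}|lborel. h (e, t))"
      using s by (subst set_integral_add) auto
    then show ?thesis using 1(6)[OF x, of e] 2(6)[OF x, of e] by (simp add: lift_def algebra_simps)
  qed
  ultimately show ?thesis using borel_measurable_add[OF m] unfolding wd_def by blast
qed

lemma wd_scale: "wd u g \<Longrightarrow> wd (\<lambda>x. a * u x) (\<lambda>p. a * g p)"
  using wd_lincomb[of u g u g a 0] by simp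

lemma wd_diff: "wd u g \<Longrightarrow> wd v h \<Longrightarrow> wd (\<lambda>x. u x - v x) (\<lambda>p. g p - h p)"
  using wd_lincomb[of u g v h 1 "-1"] by simp

lemma edge_pt_in_grid: "t \<in> {0..\<epsilon>} \<Longrightarrow> edge_pt \<epsilon> e t \<in> grid_graph \<epsilon>"
  unfolding grid_graph_def by blast

lemma continuous_edge_pt: "continuous_on A (edge_pt \<epsilon> e)"
proof -
  obtain i j b where "e = (i, j, b)" by (cases e)
  then show ?thesis by (cases b) (auto simp: edge_pt_def[abs_def] intro!: continuous_intros)
qed

lemma lift_continuous:
  assumes "continuous_on (grid_graph \<epsilon>) u"
  shows "continuous_on {0..\<epsilon>} (\<lambda>t. lift u (e, t))"
  unfolding lift_def fst_conv snd_conv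
  by (rule continuous_on_compose2[OF assms continuous_edge_pt]) (use edge_pt_in_grid in blast)

lemma lift_measurable:
  assumes "continuous_on (grid_graph \<epsilon>) u"
  shows "lift u \<in> borel_measurable gmeas"
  by (intro gmeas_measurableI seg_measurable_continuous lift_continuous assms)

lemma H1_iff:
  "u \<in> H1 \<epsilon> \<longleftrightarrow> continuous_on (grid_graph \<epsilon>) u \<and> integrable gmeas (\<lambda>p. (lift u p)\<^sup>2) \<and> (\<exists>g. wd u g)"
proof -
  have "(\<lambda>e. LINT t:{0..\<epsilon>}|lborel. (u (edge_pt \<epsilon> e t))\<^sup>2) summable_on UNIV \<longleftrightarrow> integrable gmeas (\<lambda>p. (lift u p)\<^sup>2)"
    if c: "continuous_on (grid_graph \<epsilon>) u"
  proof -
    have "integrable seg (\<lambda>t. (lift u (e, t))\<^sup>2)" for e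
      unfolding integrable_seg
      by (intro borel_integrable_atLeastAtMost' continuous_intros lift_continuous c)
    then show ?thesis
      using lift_measurable[OF c] gmeas_nonneg(1)[of "\<lambda>p. (lift u p)\<^sup>2"]
      by (simp add: integral_seg) (simp add: lift_def)
  qed
  moreover have "(\<exists>g. edge_weak_deriv \<epsilon> u g \<and> (\<lambda>e. LINT t:{0..\<epsilon>}|lborel. (g e t)\<^sup>2) summable_on UNIV) \<longleftrightarrow> (\<exists>g. wd u g)"
    using wd_of_edge_weak_deriv[of u] edge_weak_deriv_of_wd(1,2)[of u] by metis
  ultimately show ?thesis unfolding H1_def mem_Collect_eq by metis
qed

section \<open>Pointwise and vertex bounds in terms of mass and kinetic energy\<close>

definition vtx :: "int \<times> int \<Rightarrow> real \<times> real" where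
  "vtx k = (\<epsilon> * of_int (fst k), \<epsilon> * of_int (snd k))"

definition mass :: "(real \<times> real \<Rightarrow> real) \<Rightarrow> real" where
  "mass u = (\<integral>p. (lift u p)\<^sup>2 \<partial>gmeas)"

definition edge_mass :: "(real \<times> real \<Rightarrow> real) \<Rightarrow> edge \<Rightarrow> real" where
  "edge_mass u e = (\<integral>t. (lift u (e, t))\<^sup>2 \<partial>seg)"

definition edge_sq :: "(edge \<times> real \<Rightarrow> real) \<Rightarrow> edge \<Rightarrow> real" where
  "edge_sq g e = (\<integral>t. (g (e, t))\<^sup>2 \<partial>seg)"

definition vsum :: "real \<Rightarrow> (int \<times> int) set \<Rightarrow> (real \<times> real \<Rightarrow> real) \<Rightarrow> real" where
  "vsum r W u = (\<Sum>\<^sub>\<infinity>k\<in>W. \<bar>u (vtx k)\<bar> powr r)"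

lemma H1_wd: "u \<in> H1 \<epsilon> \<Longrightarrow> \<exists>g. wd u g"
  by (simp add: H1_iff)

lemma H1_lift:
  assumes "u \<in> H1 \<epsilon>"
  shows "continuous_on {0..\<epsilon>} (\<lambda>t. lift u (e, t))" "lift u \<in> borel_measurable gmeas"
    "integrable gmeas (\<lambda>p. (lift u p)\<^sup>2)" "integrable seg (\<lambda>t. (lift u (e, t))\<^sup>2)"
proof -
  show m: "lift u \<in> borel_measurable gmeas" "integrable gmeas (\<lambda>p. (lift u p)\<^sup>2)"
    using assms by (auto simp: H1_iff intro: lift_measurable)
  show "continuous_on {0..\<epsilon>} (\<lambda>t. lift u (e, t))" using assms by (auto simp: H1_iff intro: lift_continuous)
  show "integrable seg (\<lambda>t. (lift u (e, t))\<^sup>2)"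
    using gmeas_nonneg(1)[of "\<lambda>p. (lift u p)\<^sup>2"] m by simp
qed

lemma vtx_eq_lift: "u (vtx k) = lift u ((fst k, snd k, False), 0)"
  by (simp add: vtx_def lift_def edge_pt_def)

lemma measure_seg:
  assumes "0 \<le> a" "a \<le> b" "b \<le> \<epsilon>"
  shows "(\<integral>t. indicator {a..b} t \<partial>seg) = b - a"
proof -
  have "(\<integral>t. indicator {a..b} t \<partial>seg) = (\<integral>t. (indicator {a..b} t :: real) \<partial>lborel)"
    unfolding seg_def integral_restrict_space[of "{0..\<epsilon>}" lborel, simplified]
    using assms by (intro Bochner_Integration.integral_cong) (auto simp: indicator_def)
  then show ?thesis using assms by simp
qed

lemma integrable_seg_indicator: "integrable seg (\<lambda>t. indicator {a..b} t :: real)"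
proof -
  interpret finite_measure seg by (rule finite_seg)
  have "(\<lambda>t. indicator {a..b} t :: real) \<in> borel_measurable seg"
    unfolding seg_def by (intro measurable_restrict_space1) auto
  then show ?thesis by (intro integrable_const_bound[where B=1]) (auto simp: indicator_def)
qed

text \<open>Cauchy-Schwarz on the interval between x and y: the one-dimensional Hoelder-1/2
  estimate. Only the derivative on that one edge enters, so the bound can be summed over
  edges.\<close>

lemma edge_holder:
  assumes "wd u g" "x \<in> {0..\<epsilon>}" "y \<in> {0..\<epsilon>}"
  shows "(lift u (e, x) - lift u (e, y))\<^sup>2 \<le> \<bar>x - y\<bar> * edge_sq g e"
proof -
  have *: "(lift u (e, y) - lift u (e, x))\<^sup>2 \<le> (y - x) * edge_sq g e"
    if x: "x \<in> {0..\<epsilon>}" and y: "y \<in> {0..\<epsilon>}" and xy: "x \<le> y" for x y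
  proof -
    note w = wdD[OF assms(1)]
    have s: "(LINT t:{0..z}|lborel. g (e, t)) = (\<integral>t. indicator {0..z} t * g (e, t) \<partial>seg)" if "z \<in> {0..\<epsilon>}" for z
      unfolding set_lebesgue_integral_def seg_def
      by (subst integral_restrict_space) (use that in \<open>auto intro!: Bochner_Integration.integral_cong simp: indicator_def\<close>)
    have im: "(\<lambda>t. indicator {a..b} t :: real) \<in> borel_measurable seg" for a b :: real
      using integrable_seg_indicator by blast
    have ii: "integrable seg (\<lambda>t. indicator {a..b} t * g (e, t))" for a b
      using integrable_mult_L2[OF im w(3), of a b e] w(4)[of e] integrable_seg_indicator[of a b]
      by (simp add: power2_eq_square indicator_inter_arith[symmetric])
    \<comment> \<open>The indicator of the half-open interval from x to y, written with initial
      segments because these are what the weak derivative integrates over; it equals its own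
      square.\<close>
    let ?h = "\<lambda>t. indicator {0..y} t - indicator {0..x} t :: real"
    have h2: "(?h t)\<^sup>2 = indicator {0..y} t - indicator {0..x} t" for t
      using xy x by (auto simp: indicator_def)
    have hm: "?h \<in> borel_measurable seg" using im by auto
    have "lift u (e, y) - lift u (e, x) = (\<integral>t. ?h t * g (e, t) \<partial>seg)"
      using w(6)[OF x, of e] w(6)[OF y, of e] ii by (simp add: s[OF x] s[OF y] left_diff_distrib)
    then have "\<bar>lift u (e, y) - lift u (e, x)\<bar> \<le> (\<integral>t. \<bar>?h t * g (e, t)\<bar> \<partial>seg)"
      by (simp add: integral_abs_bound)
    then have "(lift u (e, y) - lift u (e, x))\<^sup>2 \<le> (\<integral>t. \<bar>?h t * g (e, t)\<bar> \<partial>seg)\<^sup>2"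
      by (intro abs_le_square_iff[THEN iffD1]) auto
    also have "\<dots> \<le> (\<integral>t. (?h t)\<^sup>2 \<partial>seg) * (\<integral>t. (g (e, t))\<^sup>2 \<partial>seg)"
      using integrable_seg_indicator w(4) by (intro Cauchy_Schwarz_integral hm w(3)) (auto simp only: h2 intro!: Bochner_Integration.integrable_diff)
    also have "(\<integral>t. (?h t)\<^sup>2 \<partial>seg) = y - x"
      unfolding h2 using x y integrable_seg_indicator measure_seg[of 0 x] measure_seg[of 0 y]
      by (subst Bochner_Integration.integral_diff) auto
    finally show ?thesis by (simp add: edge_sq_def)
  qed
  show ?thesis
  proof (cases "x \<le> y")
    case True then show ?thesis using *[OF assms(2,3)] by (simp add: power2_commute)
  next
    case False then show ?thesis using *[OF assms(3,2)] by simp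
  qed
qed

lemma edge_sq_nonneg: "edge_sq g e \<ge> 0" and edge_mass_nonneg: "edge_mass u e \<ge> 0"
  by (auto simp: edge_sq_def edge_mass_def)

text \<open>The Hoelder bound is averaged over a subinterval of length l that contains t. The
  restriction l \<le> \<epsilon>/2 guarantees that [t, t + l] or [t - l, t] fits into the edge, and
  l stays free for a later optimization.\<close>

lemma edge_sup:
  assumes u: "u \<in> H1 \<epsilon>" and w: "wd u g" and l: "0 < l" "l \<le> \<epsilon> / 2" and t: "t \<in> {0..\<epsilon>}"
  shows "(lift u (e, t))\<^sup>2 \<le> 2 / l * edge_mass u e + 2 * l * edge_sq g e"
proof -
  obtain a where a: "0 \<le> a" "a + l \<le> \<epsilon>" "t \<in> {a..a + l}"
  proof (cases "t \<le> \<epsilon> / 2")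
    case True then show ?thesis using that[of t] l t by auto
  next
    case False then show ?thesis using that[of "t - l"] l t by auto
  qed
  let ?I = "{a..a + l}"
  have pt: "indicator ?I y * (lift u (e, t))\<^sup>2 \<le> 2 * (lift u (e, y))\<^sup>2 + (2 * l * edge_sq g e) * indicator ?I y" (is "?L \<le> ?R")
    if "y \<in> {0..\<epsilon>}" for y
  proof (cases "y \<in> ?I")
    case True
    have "(lift u (e, t) - lift u (e, y))\<^sup>2 \<le> \<bar>t - y\<bar> * edge_sq g e" by (rule edge_holder[OF w t that])
    also have "\<dots> \<le> l * edge_sq g e" using True a by (intro mult_right_mono edge_sq_nonneg) auto
    finally have "(lift u (e, t) - lift u (e, y))\<^sup>2 \<le> l * edge_sq g e" .
    moreover have "(lift u (e, t))\<^sup>2 \<le> 2 * (lift u (e, y))\<^sup>2 + 2 * (lift u (e, t) - lift u (e, y))\<^sup>2"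
      using power2_sum_le[of "lift u (e, y)" "lift u (e, t) - lift u (e, y)"] by simp
    ultimately have "(lift u (e, t))\<^sup>2 \<le> 2 * (lift u (e, y))\<^sup>2 + 2 * (l * edge_sq g e)" by (smt (verit))
    then show ?thesis using True by simp
  next
    case False
    then show ?thesis by simp
  qed
  have i2: "integrable seg (\<lambda>y. 2 * (lift u (e, y))\<^sup>2 + (2 * l * edge_sq g e) * indicator ?I y)"
    using H1_lift(4)[OF u] integrable_seg_indicator by auto
  have "(\<integral>y. indicator ?I y * (lift u (e, t))\<^sup>2 \<partial>seg)
      \<le> (\<integral>y. 2 * (lift u (e, y))\<^sup>2 + (2 * l * edge_sq g e) * indicator ?I y \<partial>seg)"
    using integrable_seg_indicator i2 pt by (intro integral_mono) auto
  also have "\<dots> = 2 * edge_mass u e + 2 * l * edge_sq g e * l"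
    using H1_lift(4)[OF u] integrable_seg_indicator measure_seg[of a "a+l"] a l by (simp add: edge_mass_def)
  finally have "l * (lift u (e, t))\<^sup>2 \<le> 2 * edge_mass u e + 2 * l * edge_sq g e * l"
    using measure_seg[of a "a+l"] a l by simp
  then show ?thesis using l by (simp add: field_simps)
qed

lemma mass_sum:
  assumes "u \<in> H1 \<epsilon>"
  shows "edge_mass u summable_on UNIV" "infsum (edge_mass u) UNIV = mass u" "edge_mass u e \<le> mass u"
proof -
  show 1: "edge_mass u summable_on UNIV" "infsum (edge_mass u) UNIV = mass u"
    using gmeas_nonneg[of "\<lambda>p. (lift u p)\<^sup>2"] H1_lift(2,3)[OF assms]
    unfolding edge_mass_def[abs_def] mass_def by auto
  show "edge_mass u e \<le> mass u"
    using finite_sum_le_infsum[OF 1(1), of "{e}"] 1(2) edge_mass_nonneg by auto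
qed

lemma Dnorm2_sum:
  assumes "wd u g"
  shows "edge_sq g summable_on UNIV" "infsum (edge_sq g) UNIV = Dnorm2 \<epsilon> u" "edge_sq g e \<le> Dnorm2 \<epsilon> u"
proof -
  show 1: "edge_sq g summable_on UNIV" "infsum (edge_sq g) UNIV = Dnorm2 \<epsilon> u"
    using gmeas_nonneg[of "\<lambda>p. (g p)\<^sup>2"] wdD(1,2)[OF assms]
    unfolding edge_sq_def[abs_def] Dnorm2_eq[OF assms] by auto
  show "edge_sq g e \<le> Dnorm2 \<epsilon> u"
    using finite_sum_le_infsum[OF 1(1), of "{e}"] 1(2) edge_sq_nonneg by auto
qed

lemma mass_nonneg: "mass u \<ge> 0" by (simp add: mass_def)

lemma Dnorm2_nonneg: "u \<in> H1 \<epsilon> \<Longrightarrow> Dnorm2 \<epsilon> u \<ge> 0"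
  using H1_wd Dnorm2_eq by fastforce

lemma sup_bound_l:
  assumes "u \<in> H1 \<epsilon>" "0 < l" "l \<le> \<epsilon> / 2" "p \<in> space gmeas"
  shows "(lift u p)\<^sup>2 \<le> 2 / l * mass u + 2 * l * Dnorm2 \<epsilon> u"
proof -
  obtain g where g: "wd u g" using H1_wd assms by blast
  obtain e t where p: "p = (e, t)" "t \<in> {0..\<epsilon>}" using assms(4) by auto
  have "(lift u p)\<^sup>2 \<le> 2 / l * edge_mass u e + 2 * l * edge_sq g e"
    using edge_sup[OF assms(1) g assms(2,3)] p by auto
  also have "\<dots> \<le> 2 / l * mass u + 2 * l * Dnorm2 \<epsilon> u"
    using assms mass_sum(3)[OF assms(1)] Dnorm2_sum(3)[OF g] by (intro add_mono mult_left_mono) auto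
  finally show ?thesis .
qed

text \<open>Each vertex is the base of its own horizontal edge; summing \<open>edge_sup\<close> at t
  = 0 over this injection costs no more than the total mass and kinetic energy.\<close>

lemma vertex_bound_l:
  assumes "u \<in> H1 \<epsilon>" "0 < l" "l \<le> \<epsilon> / 2"
  shows "(\<lambda>k. (u (vtx k))\<^sup>2) summable_on UNIV"
    "(\<Sum>\<^sub>\<infinity>k. (u (vtx k))\<^sup>2) \<le> 2 / l * mass u + 2 * l * Dnorm2 \<epsilon> u"
proof -
  obtain g where g: "wd u g" using H1_wd assms by blast
  define f where "f e = 2 / l * edge_mass u e + 2 * l * edge_sq g e" for e
  have f: "(f has_sum (2 / l * mass u + 2 * l * Dnorm2 \<epsilon> u)) UNIV"
    unfolding f_def[abs_def] using mass_sum(1,2)[OF assms(1)] Dnorm2_sum(1,2)[OF g]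
    by (intro has_sum_add has_sum_cmult_right) (simp_all add: has_sum_iff)
  have f0: "f e \<ge> 0" for e
    using assms edge_mass_nonneg[of u e] edge_sq_nonneg[of g e] by (simp add: f_def)
  let ?\<iota> = "\<lambda>k::int \<times> int. (fst k, snd k, False)"
  have inj: "inj ?\<iota>" by (auto simp: inj_def prod_eq_iff)
  have s: "f summable_on range ?\<iota>" by (rule summable_on_subset_banach[OF has_sum_imp_summable[OF f]]) simp
  then have s2: "(\<lambda>k. f (?\<iota> k)) summable_on UNIV"
    using summable_on_reindex[OF inj, of f] by (simp add: o_def)
  have le: "(u (vtx k))\<^sup>2 \<le> f (?\<iota> k)" for k
    unfolding f_def vtx_eq_lift using edge_sup[OF assms(1) g assms(2,3), of 0] eps_pos by auto
  show 1: "(\<lambda>k. (u (vtx k))\<^sup>2) summable_on UNIV"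
    using le by (intro summable_on_comparison_test[OF s2]) auto
  have "(\<Sum>\<^sub>\<infinity>k. (u (vtx k))\<^sup>2) \<le> (\<Sum>\<^sub>\<infinity>k. f (?\<iota> k))"
    using le by (intro infsum_mono 1 s2) auto
  also have "\<dots> = infsum f (range ?\<iota>)" using infsum_reindex[OF inj, of f] by (simp add: o_def)
  also have "\<dots> \<le> infsum f UNIV" by (rule infsum_mono2[OF s has_sum_imp_summable[OF f]]) (use f0 in auto)
  finally show "(\<Sum>\<^sub>\<infinity>k. (u (vtx k))\<^sup>2) \<le> 2 / l * mass u + 2 * l * Dnorm2 \<epsilon> u"
    using infsumI[OF f] by simp
qed

text \<open>Up to constants, the minimum of 2 m / l + 2 l D over 0 < l \<le> \<epsilon>/2. The
  square root is the Gagliardo-Nirenberg bound of the line, and m / \<epsilon> pays for the finite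
  length of an edge. It bounds both the squared sup norm and the sum of squares over the
  vertices.\<close>

definition supb :: "real \<Rightarrow> real \<Rightarrow> real" where
  "supb m D = 4 * m / \<epsilon> + 4 * sqrt (m * D)"

lemma supb_nonneg: "m \<ge> 0 \<Longrightarrow> D \<ge> 0 \<Longrightarrow> supb m D \<ge> 0"
  using eps_pos by (simp add: supb_def)

text \<open>The best length is sqrt (m / D), with value 4 sqrt (m D). If it exceeds \<epsilon>/2,
  the length \<epsilon>/2 gives 4 m / \<epsilon> + \<epsilon> D, and then \<epsilon> D is at most 2
  sqrt (m D). For m = 0 the length is sent to 0; for D = 0 it is \<epsilon>/2.\<close>

lemma supb_optimal:
  assumes "m \<ge> 0" "D \<ge> 0" and x: "\<And>l. 0 < l \<Longrightarrow> l \<le> \<epsilon> / 2 \<Longrightarrow> x \<le> 2 / l * m + 2 * l * D"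
  shows "x \<le> supb m D"
proof (cases "m = 0 \<or> D = 0")
  case True
  show ?thesis
  proof (cases "m = 0")
    case True
    have "x \<le> 0 + e" if e: "e > 0" for e
    proof -
      define l where "l = min (\<epsilon>/2) (e / (2 * (D+1)))"
      have l: "0 < l" "l \<le> \<epsilon>/2" "l \<le> e / (2 * (D+1))"
        unfolding l_def by (use eps_pos e assms in simp) (rule min.cobounded1 min.cobounded2)+
      have "x \<le> 2 * l * D" using x[OF l(1,2)] True by simp
      also have "\<dots> \<le> 2 * l * (D+1)" using l by simp
      also have "\<dots> \<le> e" using l(3) assms by (simp add: field_simps)
      finally show ?thesis by simp
    qed
    then have "x \<le> 0" by (rule field_le_epsilon)
    then show ?thesis using True by (simp add: supb_def)
  next
    case False
    then show ?thesis using x[of "\<epsilon>/2"] True eps_pos by (simp add: supb_def)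
  qed
next
  case False
  then have mD: "m > 0" "D > 0" using assms by auto
  define s where "s = sqrt (m / D)"
  have s: "s > 0" "m / s = sqrt (m * D)" "s * D = sqrt (m * D)"
  proof -
    show "s > 0" using mD by (simp add: s_def)
    have "s * s = m / D" using mD by (simp add: s_def)
    moreover have "(s * D)\<^sup>2 = (s * s) * D * D" by (simp add: power2_eq_square)
    ultimately have "(s * D)\<^sup>2 = m * D" using mD by (simp add: field_simps)
    then show sD: "s * D = sqrt (m * D)" using \<open>s > 0\<close> mD by (metis real_sqrt_unique mult_nonneg_nonneg less_imp_le)
    have "m = s * s * D" using \<open>s * s = m / D\<close> mD by simp
    then show "m / s = sqrt (m * D)" using sD \<open>s > 0\<close> by simp
  qed
  show ?thesis
  proof (cases "s \<le> \<epsilon> / 2")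
    case True
    then have "x \<le> 2 * (m / s) + 2 * (s * D)" using x[of s] s by simp
    then show ?thesis using s mD eps_pos by (simp add: supb_def add_increasing)
  next
    case False
    have "x \<le> 4 * m / \<epsilon> + \<epsilon> * D" using x[of "\<epsilon>/2"] eps_pos by simp
    moreover have "\<epsilon> * D \<le> (2 * s) * D" using False mD by (intro mult_right_mono) auto
    moreover have "0 \<le> sqrt (m * D)" using mD by simp
    ultimately show ?thesis using s(3) unfolding supb_def mult.assoc by linarith
  qed
qed

lemma sup_bound:
  assumes "u \<in> H1 \<epsilon>" "p \<in> space gmeas"
  shows "(lift u p)\<^sup>2 \<le> supb (mass u) (Dnorm2 \<epsilon> u)"
  using assms sup_bound_l by (intro supb_optimal mass_nonneg Dnorm2_nonneg) auto

lemma vertex_bound: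
  assumes "u \<in> H1 \<epsilon>"
  shows "(\<lambda>k. (u (vtx k))\<^sup>2) summable_on UNIV"
    "(\<Sum>\<^sub>\<infinity>k. (u (vtx k))\<^sup>2) \<le> supb (mass u) (Dnorm2 \<epsilon> u)"
  using assms vertex_bound_l(1)[of u "\<epsilon>/2"] eps_pos vertex_bound_l(2)[OF assms]
  by (auto intro!: supb_optimal mass_nonneg Dnorm2_nonneg)

lemma abs_powr_le:
  fixes x S r :: real
  assumes "r \<ge> 2" "x\<^sup>2 \<le> S"
  shows "\<bar>x\<bar> powr r \<le> S powr ((r - 2) / 2) * x\<^sup>2"
proof (cases "x = 0")
  case False
  have "\<bar>x\<bar> powr r = \<bar>x\<bar> powr (r - 2) * \<bar>x\<bar> powr 2"
    using powr_add[of "\<bar>x\<bar>" "r - 2" 2] by simp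
  also have "\<bar>x\<bar> powr (r - 2) = (\<bar>x\<bar> powr 2) powr ((r - 2) / 2)"
  proof -
    have "2 * ((r - 2) / 2) = r - 2" by simp
    then show ?thesis unfolding powr_powr by (rule arg_cong[where f="\<lambda>z. _ powr z", symmetric])
  qed
  also have "\<bar>x\<bar> powr 2 = x\<^sup>2" by simp
  also have "(x\<^sup>2) powr ((r - 2) / 2) \<le> S powr ((r - 2) / 2)" using assms by (intro powr_mono2) auto
  finally show ?thesis by (simp add: mult_right_mono)
qed simp

text \<open>The sup bound \<open>S\<close> is left free: \<open>supb\<close> serves in general,
  while a vanishing sequence supplies a bound that tends to 0 although mass and kinetic energy do
  not.\<close>

lemma Lpow_bound:
  assumes u: "u \<in> H1 \<epsilon>" and r: "r \<ge> 2" and S: "\<And>p. p \<in> space gmeas \<Longrightarrow> (lift u p)\<^sup>2 \<le> S"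
  shows "Lpow \<epsilon> r u \<le> S powr ((r - 2) / 2) * mass u"
    "integrable gmeas (\<lambda>p. \<bar>lift u p\<bar> powr r)" "Lpow \<epsilon> r u = (\<integral>p. \<bar>lift u p\<bar> powr r \<partial>gmeas)"
proof -
  note m[measurable] = H1_lift(2)[OF u]
  have i: "integrable gmeas (\<lambda>p. S powr ((r - 2) / 2) * (lift u p)\<^sup>2)" using H1_lift(3)[OF u] by auto
  show 1: "integrable gmeas (\<lambda>p. \<bar>lift u p\<bar> powr r)"
  proof (rule Bochner_Integration.integrable_bound[OF i])
    show "AE p in gmeas. norm (\<bar>lift u p\<bar> powr r) \<le> norm (S powr ((r - 2) / 2) * (lift u p)\<^sup>2)"
      using abs_powr_le[OF r S] by (intro AE_I2) (auto intro: order_trans[OF _ abs_ge_self])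
  qed measurable
  show 2: "Lpow \<epsilon> r u = (\<integral>p. \<bar>lift u p\<bar> powr r \<partial>gmeas)"
    using gmeas_nonneg(2)[of "\<lambda>p. \<bar>lift u p\<bar> powr r"] 1
    by (simp add: Lpow_def integral_seg lift_def borel_measurable_integrable)
  have "(\<integral>p. \<bar>lift u p\<bar> powr r \<partial>gmeas) \<le> (\<integral>p. S powr ((r - 2) / 2) * (lift u p)\<^sup>2 \<partial>gmeas)"
    using abs_powr_le[OF r S] by (intro integral_mono 1 i) auto
  then show "Lpow \<epsilon> r u \<le> S powr ((r - 2) / 2) * mass u" by (simp add: 2 mass_def)
qed

lemma Lpow_eq:
  assumes "u \<in> H1 \<epsilon>" "r \<ge> 2"
  shows "integrable gmeas (\<lambda>p. \<bar>lift u p\<bar> powr r)" "Lpow \<epsilon> r u = (\<integral>p. \<bar>lift u p\<bar> powr r \<partial>gmeas)"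
  using Lpow_bound(2,3)[OF assms sup_bound[OF assms(1)]] by blast+

lemma Lpow2: "u \<in> H1 \<epsilon> \<Longrightarrow> Lpow \<epsilon> 2 u = mass u"
  using Lpow_eq(2)[of u 2] by (simp add: mass_def)

lemma H1_mass_iff: "u \<in> H1_mass \<epsilon> \<mu> \<longleftrightarrow> u \<in> H1 \<epsilon> \<and> mass u = \<mu>"
  by (auto simp: H1_mass_def Lpow2)

lemma vsum_bound:
  assumes u: "u \<in> H1 \<epsilon>" and r: "r \<ge> 2" and S: "\<And>k. (u (vtx k))\<^sup>2 \<le> S"
  shows "(\<lambda>k. \<bar>u (vtx k)\<bar> powr r) summable_on W"
    "vsum r W u \<le> S powr ((r - 2) / 2) * (\<Sum>\<^sub>\<infinity>k. (u (vtx k))\<^sup>2)"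
proof -
  note s = vertex_bound(1)[OF u]
  have s2: "(\<lambda>k. S powr ((r - 2) / 2) * (u (vtx k))\<^sup>2) summable_on UNIV" by (intro summable_on_cmult_right s)
  have t: "(\<lambda>k. \<bar>u (vtx k)\<bar> powr r) summable_on UNIV"
    using abs_powr_le[OF r S] by (intro summable_on_comparison_test[OF s2]) auto
  then show t': "(\<lambda>k. \<bar>u (vtx k)\<bar> powr r) summable_on W"
    by (rule summable_on_subset_banach) auto
  have "vsum r W u \<le> (\<Sum>\<^sub>\<infinity>k. \<bar>u (vtx k)\<bar> powr r)"
    unfolding vsum_def by (intro infsum_mono2 t t') auto
  also have "\<dots> \<le> (\<Sum>\<^sub>\<infinity>k. S powr ((r - 2) / 2) * (u (vtx k))\<^sup>2)"
    using abs_powr_le[OF r S] by (intro infsum_mono t s2) auto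
  finally show "vsum r W u \<le> S powr ((r - 2) / 2) * (\<Sum>\<^sub>\<infinity>k. (u (vtx k))\<^sup>2)"
    by (simp add: infsum_cmult_right')
qed

lemma vtx_sup:
  assumes "\<And>p. p \<in> space gmeas \<Longrightarrow> (lift u p)\<^sup>2 \<le> S"
  shows "(u (vtx k))\<^sup>2 \<le> S"
  unfolding vtx_eq_lift using eps_pos by (intro assms) auto

lemma vsum_summable:
  assumes "u \<in> H1 \<epsilon>" "r \<ge> 2"
  shows "(\<lambda>k. \<bar>u (vtx k)\<bar> powr r) summable_on W"
  using vsum_bound(1)[OF assms vtx_sup[OF sup_bound[OF assms(1)]]] .

lemma vsum_nonneg: "vsum r W u \<ge> 0"
  by (simp add: vsum_def infsum_nonneg)

lemma Lpow_nonneg: "u \<in> H1 \<epsilon> \<Longrightarrow> r \<ge> 2 \<Longrightarrow> Lpow \<epsilon> r u \<ge> 0"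
  by (simp add: Lpow_eq)

lemma supb_mono: "m \<le> m' \<Longrightarrow> D \<le> D' \<Longrightarrow> 0 \<le> m \<Longrightarrow> 0 \<le> D \<Longrightarrow> supb m D \<le> supb m' D'"
  unfolding supb_def using eps_pos by (intro add_mono divide_right_mono mult_left_mono real_sqrt_le_mono mult_mono) auto

lemma H1_lincomb:
  assumes "u \<in> H1 \<epsilon>" "v \<in> H1 \<epsilon>"
  shows "(\<lambda>x. a * u x + b * v x) \<in> H1 \<epsilon>"
proof -
  have "integrable gmeas (\<lambda>p. (a * lift u p + b * lift v p)\<^sup>2)"
    using H1_lift(2,3)[OF assms(1)] H1_lift(2,3)[OF assms(2)]
    by (intro integrable_add_square(1)) (auto simp: power_mult_distrib)
  moreover have "continuous_on (grid_graph \<epsilon>) (\<lambda>x. a * u x + b * v x)"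
    using assms by (auto simp: H1_iff intro!: continuous_intros)
  moreover have "\<exists>g. wd (\<lambda>x. a * u x + b * v x) g"
    using H1_wd[OF assms(1)] H1_wd[OF assms(2)] wd_lincomb by blast
  ultimately show ?thesis unfolding H1_iff by (simp add: lift_def)
qed

lemma H1_scale: "u \<in> H1 \<epsilon> \<Longrightarrow> (\<lambda>x. c * u x) \<in> H1 \<epsilon>"
  using H1_lincomb[of u u c 0] by simp

lemma H1_diff: "u \<in> H1 \<epsilon> \<Longrightarrow> v \<in> H1 \<epsilon> \<Longrightarrow> (\<lambda>x. u x - v x) \<in> H1 \<epsilon>"
  using H1_lincomb[of u v 1 "-1"] by simp

lemma lift_scale: "lift (\<lambda>x. c * u x) p = c * lift u p"
  by (simp add: lift_def)

lemma mass_scale: "mass (\<lambda>x. c * u x) = c\<^sup>2 * mass u"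
  by (simp add: mass_def lift_scale power_mult_distrib)

lemma Dnorm2_scale: "u \<in> H1 \<epsilon> \<Longrightarrow> Dnorm2 \<epsilon> (\<lambda>x. c * u x) = c\<^sup>2 * Dnorm2 \<epsilon> u"
  using H1_wd[of u] Dnorm2_eq Dnorm2_eq[OF wd_scale[of u _ c]] by (auto simp: power_mult_distrib)

lemma Lpow_scale: "u \<in> H1 \<epsilon> \<Longrightarrow> r \<ge> 2 \<Longrightarrow> Lpow \<epsilon> r (\<lambda>x. c * u x) = \<bar>c\<bar> powr r * Lpow \<epsilon> r u"
  by (simp add: Lpow_eq H1_scale lift_scale abs_mult powr_mult)

lemma vsum_scale: "vsum r W (\<lambda>x. c * u x) = \<bar>c\<bar> powr r * vsum r W u"
  by (simp add: vsum_def abs_mult powr_mult infsum_cmult_right')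

section \<open>Lattice translations\<close>

definition eshift :: "int \<times> int \<Rightarrow> edge \<Rightarrow> edge" where
  "eshift k e = (fst e + fst k, fst (snd e) + snd k, snd (snd e))"

text \<open>The sign is chosen so that values of u near \<open>vtx k\<close> are brought to the
  origin.\<close>

definition tr :: "int \<times> int \<Rightarrow> (real \<times> real \<Rightarrow> real) \<Rightarrow> real \<times> real \<Rightarrow> real" where
  "tr k u x = u (x + vtx k)"

lemma bij_eshift: "bij (eshift k)"
proof (rule bijI)
  show "inj (eshift k)" by (auto simp: inj_def eshift_def prod_eq_iff)
  have "eshift k (fst e - fst k, fst (snd e) - snd k, snd (snd e)) = e" for e
    by (simp add: eshift_def)
  then show "surj (eshift k)" unfolding surj_def by metis
qed

lemma edge_pt_shift: "edge_pt \<epsilon> e t + vtx k = edge_pt \<epsilon> (eshift k e) t"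
  by (auto simp: edge_pt_def eshift_def vtx_def prod_eq_iff split: prod.splits) (auto simp: algebra_simps)

lemma lift_tr: "lift (tr k u) (e, t) = lift u (eshift k e, t)"
  by (simp add: lift_def tr_def edge_pt_shift)

lemma gmeas_shift:
  fixes f :: "edge \<times> real \<Rightarrow> real"
  assumes i: "integrable gmeas f" and nn: "\<And>p. f p \<ge> 0"
  shows "(\<lambda>p. f (eshift k (fst p), snd p)) \<in> borel_measurable gmeas"
    "integrable gmeas (\<lambda>p. f (eshift k (fst p), snd p))"
    "(\<integral>p. f (eshift k (fst p), snd p) \<partial>gmeas) = integral\<^sup>L gmeas f"
proof -
  have m: "f \<in> borel_measurable gmeas" using i by auto
  show ms: "(\<lambda>p. f (eshift k (fst p), snd p)) \<in> borel_measurable gmeas"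
    using section_measurable[OF m] by (intro gmeas_measurableI) simp
  have s: "\<And>e. integrable seg (\<lambda>t. f (e, t))" "(\<lambda>e. \<integral>t. f (e, t) \<partial>seg) summable_on UNIV"
    using gmeas_nonneg(1)[OF m nn] i by blast+
  have "(\<lambda>e. \<integral>t. f (eshift k e, t) \<partial>seg) summable_on UNIV"
    using summable_on_reindex_bij_betw[OF bij_eshift, of "\<lambda>e. \<integral>t. f (e, t) \<partial>seg" k] s(2) by simp
  then show ish: "integrable gmeas (\<lambda>p. f (eshift k (fst p), snd p))"
    using s(1) gmeas_nonneg(1)[OF ms nn] unfolding fst_conv snd_conv by blast
  have "(\<integral>p. f (eshift k (fst p), snd p) \<partial>gmeas) = (\<Sum>\<^sub>\<infinity>e. \<integral>t. f (eshift k e, t) \<partial>seg)"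
    using gmeas_nonneg(2)[OF ms nn ish] by simp
  also have "\<dots> = (\<Sum>\<^sub>\<infinity>e. \<integral>t. f (e, t) \<partial>seg)"
    by (rule infsum_reindex_bij_betw[OF bij_eshift])
  also have "\<dots> = integral\<^sup>L gmeas f" using gmeas_nonneg(2)[OF m nn i] by simp
  finally show "(\<integral>p. f (eshift k (fst p), snd p) \<partial>gmeas) = integral\<^sup>L gmeas f" .
qed

lemma wd_tr:
  assumes "wd u g"
  shows "wd (tr k u) (\<lambda>p. g (eshift k (fst p), snd p))"
proof -
  note w = wdD[OF assms]
  have "(\<lambda>p. g (eshift k (fst p), snd p)) \<in> borel_measurable gmeas"
    using w(3) by (intro gmeas_measurableI) simp
  moreover have "lift (tr k u) (e, x) = lift (tr k u) (e, 0) + (LINT t:{0..x}|lborel. g (eshift k e, t))"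
    if "x \<in> {0..\<epsilon>}" for e x
    unfolding lift_tr by (rule w(6)[OF that])
  ultimately show ?thesis
    using gmeas_shift(2)[OF w(2) zero_le_power2, of k] unfolding wd_def fst_conv snd_conv by blast
qed

lemma H1_tr:
  assumes "u \<in> H1 \<epsilon>"
  shows "tr k u \<in> H1 \<epsilon>" "mass (tr k u) = mass u" "Dnorm2 \<epsilon> (tr k u) = Dnorm2 \<epsilon> u"
    "edge_mass (tr k u) e = edge_mass u (eshift k e)"
    "r \<ge> 2 \<Longrightarrow> Lpow \<epsilon> r (tr k u) = Lpow \<epsilon> r u"
proof -
  obtain g where g: "wd u g" using H1_wd assms by blast
  have lt: "lift (tr k u) = (\<lambda>p. lift u (eshift k (fst p), snd p))"
    by (rule ext) (metis lift_tr prod.collapse)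
  have c: "continuous_on (grid_graph \<epsilon>) u" using assms by (auto simp: H1_iff)
  have "x + vtx k \<in> grid_graph \<epsilon>" if "x \<in> grid_graph \<epsilon>" for x
    using that edge_pt_shift[of _ _ k] unfolding grid_graph_def by fastforce
  then have "continuous_on (grid_graph \<epsilon>) (tr k u)"
    unfolding tr_def[abs_def] by (intro continuous_on_compose2[OF c] continuous_intros) auto
  then show t: "tr k u \<in> H1 \<epsilon>"
    using wd_tr[OF g, of k] gmeas_shift(2)[OF H1_lift(3)[OF assms], of k] by (auto simp: H1_iff lt)
  show "mass (tr k u) = mass u"
    using gmeas_shift(3)[OF H1_lift(3)[OF assms], of k] by (simp add: mass_def lt)
  show "Dnorm2 \<epsilon> (tr k u) = Dnorm2 \<epsilon> u"
    using gmeas_shift(3)[OF wdD(2)[OF g], of k] Dnorm2_eq[OF g] Dnorm2_eq[OF wd_tr[OF g, of k]] by simp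
  show "edge_mass (tr k u) e = edge_mass u (eshift k e)"
    by (simp add: edge_mass_def lift_tr)
  show "Lpow \<epsilon> r (tr k u) = Lpow \<epsilon> r u" if "r \<ge> 2"
    using gmeas_shift(3)[OF Lpow_eq(1)[OF assms that], of k] Lpow_eq(2)[OF assms that] Lpow_eq(2)[OF t that]
    by (simp add: lt)
qed

text \<open>Only the vertex sum notices a translation, and moving the function amounts to moving the
  vertex set. Hence translates of V appear wherever a sequence is recentred.\<close>

lemma vsum_tr: "vsum r W (tr k u) = vsum r ((\<lambda>w. w + k) ` W) u"
proof -
  have "tr k u (vtx w) = u (vtx (w + k))" for w
    by (simp add: tr_def vtx_def algebra_simps)
  then show ?thesis
    unfolding vsum_def by (subst infsum_reindex) (auto simp: o_def)
qed

end

section \<open>Coercivity, vanishing and scaling of the energy\<close>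

locale nls = grid +
  fixes p q \<alpha> \<beta> :: real
  assumes p: "2 < p" "p < 6" and q: "2 < q" "q < 4" and \<alpha>: "\<alpha> > 0" and \<beta>: "\<beta> > 0"
begin

abbreviation En :: "(int \<times> int) set \<Rightarrow> (real \<times> real \<Rightarrow> real) \<Rightarrow> real" where
  "En \<equiv> energy \<epsilon> p q \<alpha> \<beta>"

definition pot :: "(int \<times> int) set \<Rightarrow> (real \<times> real \<Rightarrow> real) \<Rightarrow> real" where
  "pot W u = \<alpha> / p * Lpow \<epsilon> p u + \<beta> / q * vsum q W u"

lemma energy_eq: "En W u = Dnorm2 \<epsilon> u / 2 - pot W u"
  by (simp add: energy_def pot_def vsum_def vtx_def)

lemma pot_nonneg: "u \<in> H1 \<epsilon> \<Longrightarrow> pot W u \<ge> 0"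
  using p q \<alpha> \<beta> Lpow_nonneg[of u p] vsum_nonneg[of q W u] by (simp add: pot_def)

lemma pot_bound:
  assumes u: "u \<in> H1 \<epsilon>" and S: "\<And>p. p \<in> space gmeas \<Longrightarrow> (lift u p)\<^sup>2 \<le> S"
  shows "pot W u \<le> \<alpha> / p * (S powr ((p-2)/2) * mass u) + \<beta> / q * (S powr ((q-2)/2) * supb (mass u) (Dnorm2 \<epsilon> u))"
proof -
  have "vsum q W u \<le> S powr ((q-2)/2) * (\<Sum>\<^sub>\<infinity>k. (u (vtx k))\<^sup>2)"
    by (rule vsum_bound(2)[OF u _ vtx_sup[OF S]]) (use q in simp)
  also have "\<dots> \<le> S powr ((q-2)/2) * supb (mass u) (Dnorm2 \<epsilon> u)"
    by (intro mult_left_mono vertex_bound u) auto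
  finally show ?thesis
    unfolding pot_def using p q \<alpha> \<beta> Lpow_bound(1)[OF u _ S, of p] by (intro add_mono mult_left_mono) auto
qed

text \<open>At bounded mass \<open>supb\<close> grows like the square root of the kinetic energy D.
  The potential energy is controlled by its powers (p-2)/2 and q/2, both below 2 because p < 6 and q
  < 4, so a small multiple of D plus a constant suffices. The constant is the same for all vertex
  sets.\<close>

lemma coercive: "\<exists>K. \<forall>u W. u \<in> H1 \<epsilon> \<and> mass u \<le> \<mu> \<longrightarrow> pot W u \<le> Dnorm2 \<epsilon> u / 4 + K"
proof (cases "\<mu> \<ge> 0")
  case False
  then show ?thesis using mass_nonneg by (metis order_trans)
next
  case True
  define A where "A = \<alpha> / p * \<mu> + \<beta> / q"
  have A: "A > 0" using True p q \<alpha> \<beta> by (auto simp: A_def intro!: add_nonneg_pos)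
  \<comment> \<open>With the square of \<open>B\<close> at most 32 (\<mu>/\<epsilon>)^2 + 32 \<mu>
    D, this makes the coefficient of D equal to \<mu> / (\<mu> + 1) / 4, below 1/4. Half of the
    kinetic term of the energy thus survives.\<close>
  define \<delta> where "\<delta> = 1 / (128 * A * (\<mu> + 1))"
  have \<delta>: "\<delta> > 0" using A True by (simp add: \<delta>_def)
  obtain K1 where K1: "\<And>x. x \<ge> 0 \<Longrightarrow> x powr ((p-2)/2) \<le> \<delta> * x\<^sup>2 + K1"
    using powr_le_square[of "(p-2)/2" \<delta>] p \<delta> by auto
  obtain K2 where K2: "\<And>x. x \<ge> 0 \<Longrightarrow> x powr (q/2) \<le> \<delta> * x\<^sup>2 + K2"
    using powr_le_square[of "q/2" \<delta>] q \<delta> by auto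
  define K3 where "K3 = \<bar>K1\<bar> + \<bar>K2\<bar>"
  define K where "K = A * (\<delta> * (32 * (\<mu>/\<epsilon>)\<^sup>2) + K3)"
  have "pot W u \<le> Dnorm2 \<epsilon> u / 4 + K" if u: "u \<in> H1 \<epsilon>" and m: "mass u \<le> \<mu>" for u W
  proof -
    let ?D = "Dnorm2 \<epsilon> u"
    have D: "?D \<ge> 0" by (rule Dnorm2_nonneg[OF u])
    define B where "B = supb \<mu> ?D"
    have B: "B \<ge> 0" "supb (mass u) ?D \<le> B"
      unfolding B_def using True D m by (auto intro: supb_nonneg supb_mono mass_nonneg)
    have S: "(lift u p)\<^sup>2 \<le> B" if "p \<in> space gmeas" for p
      using sup_bound[OF u that] B by linarith
    have "pot W u \<le> \<alpha> / p * (B powr ((p-2)/2) * mass u) + \<beta> / q * (B powr ((q-2)/2) * supb (mass u) ?D)"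
      by (rule pot_bound[OF u S])
    also have "\<dots> \<le> \<alpha> / p * (B powr ((p-2)/2) * \<mu>) + \<beta> / q * (B powr ((q-2)/2) * B)"
      using p q \<alpha> \<beta> B m by (intro add_mono mult_left_mono) auto
    also have "B powr ((q-2)/2) * B = B powr (q/2)"
    proof (cases "B = 0")
      case False
      then have "B powr ((q-2)/2) * B powr 1 = B powr (q/2)" by (subst powr_add[symmetric]) (simp add: field_simps)
      then show ?thesis using B by simp
    qed simp
    also have "\<alpha> / p * (B powr ((p-2)/2) * \<mu>) + \<beta> / q * B powr (q/2)
        \<le> \<alpha> / p * ((\<delta> * B\<^sup>2 + K3) * \<mu>) + \<beta> / q * (\<delta> * B\<^sup>2 + K3)"
    proof -
      have "B powr ((p-2)/2) \<le> \<delta> * B\<^sup>2 + K3" "B powr (q/2) \<le> \<delta> * B\<^sup>2 + K3"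
        using K1[OF B(1)] K2[OF B(1)] by (auto simp: K3_def)
      then show ?thesis using p q \<alpha> \<beta> True by (intro add_mono mult_left_mono mult_right_mono) auto
    qed
    also have "\<dots> = A * (\<delta> * B\<^sup>2 + K3)" by (simp add: A_def algebra_simps)
    also have "\<dots> \<le> A * (\<delta> * (32 * (\<mu>/\<epsilon>)\<^sup>2 + 32 * (\<mu> * ?D)) + K3)"
    proof (intro mult_left_mono add_right_mono)
      show "B\<^sup>2 \<le> 32 * (\<mu>/\<epsilon>)\<^sup>2 + 32 * (\<mu> * ?D)"
        using power2_sum_le[of "4 * \<mu> / \<epsilon>" "4 * sqrt (\<mu> * ?D)"] True D by (simp add: B_def supb_def power_mult_distrib power_divide)
    qed (use A \<delta> in auto)
    also have "\<dots> = A * \<delta> * 32 * \<mu> * ?D + K" by (simp add: K_def algebra_simps)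
    also have "A * \<delta> * 32 * \<mu> = \<mu> / (\<mu> + 1) / 4"
    proof -
      have "A * \<delta> = 1 / (128 * (\<mu> + 1))" using A by (simp add: \<delta>_def)
      then have "A * \<delta> * 32 * \<mu> = 1 / (128 * (\<mu> + 1)) * 32 * \<mu>" by simp
      also have "\<dots> = \<mu> / (\<mu> + 1) / 4" using True by (simp add: divide_simps)
      finally show ?thesis .
    qed
    also have "\<mu> / (\<mu> + 1) / 4 * ?D \<le> 1/4 * ?D" using True D by (intro mult_right_mono) (auto simp: field_simps)
    finally show ?thesis by simp
  qed
  then show ?thesis by blast
qed

text \<open>Vanishing in the sense of Lions. If no edge keeps mass, \<open>edge_sup\<close> with the
  local mass \<open>\<eta> n\<close> and the global derivative bound makes the sup norm tend to 0,
  and p, q > 2 leave a positive power of it in front of bounded quantities. The vertex sets may vary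
  with n.\<close>

lemma pot_vanishing:
  assumes u: "\<And>n. u n \<in> H1 \<epsilon>" and m: "\<And>n. mass (u n) \<le> \<mu>" and K: "\<And>n. Dnorm2 \<epsilon> (u n) \<le> K"
    and e: "\<And>n e. edge_mass (u n) e \<le> \<eta> n" and \<eta>: "\<eta> \<longlonglongrightarrow> 0"
  shows "(\<lambda>n. pot (W n) (u n)) \<longlonglongrightarrow> 0"
proof -
  have \<mu>0: "\<mu> \<ge> 0" using mass_nonneg m order_trans by blast
  have K0: "K \<ge> 0" using Dnorm2_nonneg[OF u] K order_trans by blast
  have \<eta>0: "\<eta> n \<ge> 0" for n using edge_mass_nonneg e order_trans by blast
  have S: "(lift (u n) p)\<^sup>2 \<le> supb (\<eta> n) K" if p: "p \<in> space gmeas" for n p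
  proof (rule supb_optimal[OF \<eta>0 K0])
    fix l :: real assume l: "0 < l" "l \<le> \<epsilon>/2"
    obtain g where g: "wd (u n) g" using H1_wd u by blast
    obtain e t where pe: "p = (e, t)" "t \<in> {0..\<epsilon>}" using p by auto
    have "(lift (u n) p)\<^sup>2 \<le> 2 / l * edge_mass (u n) e + 2 * l * edge_sq g e"
      using edge_sup[OF u g l] pe by auto
    also have "\<dots> \<le> 2 / l * \<eta> n + 2 * l * K"
      using l e Dnorm2_sum(3)[OF g, of e] K[of n] by (intro add_mono mult_left_mono) auto
    finally show "(lift (u n) p)\<^sup>2 \<le> 2 / l * \<eta> n + 2 * l * K" .
  qed
  let ?F = "\<lambda>n. \<alpha> / p * (supb (\<eta> n) K powr ((p-2)/2) * \<mu>) + \<beta> / q * (supb (\<eta> n) K powr ((q-2)/2) * supb \<mu> K)"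
  have le: "pot (W n) (u n) \<le> ?F n" for n
  proof -
    have "pot (W n) (u n) \<le> \<alpha> / p * (supb (\<eta> n) K powr ((p-2)/2) * mass (u n))
        + \<beta> / q * (supb (\<eta> n) K powr ((q-2)/2) * supb (mass (u n)) (Dnorm2 \<epsilon> (u n)))"
      by (rule pot_bound[OF u S])
    also have "\<dots> \<le> ?F n"
      using p q \<alpha> \<beta> m K by (intro add_mono mult_left_mono supb_mono mass_nonneg Dnorm2_nonneg u) auto
    finally show ?thesis .
  qed
  have s0: "(\<lambda>n. supb (\<eta> n) K) \<longlonglongrightarrow> 0"
  proof -
    have "(\<lambda>n. 4 * \<eta> n / \<epsilon> + 4 * sqrt (\<eta> n * K)) \<longlonglongrightarrow> 4 * 0 / \<epsilon> + 4 * sqrt (0 * K)"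
      using eps_pos by (intro tendsto_intros \<eta>) auto
    then show ?thesis by (simp add: supb_def)
  qed
  have "(\<lambda>n. supb (\<eta> n) K powr r) \<longlonglongrightarrow> 0 powr r" if "r > 0" for r
    using s0 that supb_nonneg[OF \<eta>0 K0] by (intro tendsto_powr2 tendsto_const) auto
  then have s1: "(\<lambda>n. supb (\<eta> n) K powr r) \<longlonglongrightarrow> 0" if "r > 0" for r
    using that by simp
  have "?F \<longlonglongrightarrow> \<alpha> / p * (0 * \<mu>) + \<beta> / q * (0 * supb \<mu> K)"
    using p q by (intro tendsto_intros s1) auto
  then have F: "?F \<longlonglongrightarrow> 0" by simp
  show ?thesis
    by (rule tendsto_sandwich[OF always_eventually always_eventually tendsto_const F])
      (intro allI le pot_nonneg u)+
qed

text \<open>Zero mass speaks only of almost every point, while the vertex sum needs values at single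
  points; the vanishing lemma for a constant sequence supplies them.\<close>

lemma pot_zero_mass:
  assumes "u \<in> H1 \<epsilon>" "mass u = 0"
  shows "pot W u = 0"
proof -
  have "(\<lambda>n. pot W u) \<longlonglongrightarrow> 0"
    by (rule pot_vanishing[where u="\<lambda>_. u" and W="\<lambda>_. W" and \<mu>=0 and K="Dnorm2 \<epsilon> u" and \<eta>="\<lambda>_. 0"])
      (use assms mass_sum(3)[OF assms(1)] in auto)
  then show ?thesis by (simp add: LIMSEQ_const_iff)
qed

definition \<sigma> :: real where "\<sigma> = min p q / 2"

lemma \<sigma>: "\<sigma> > 1" using p q by (simp add: \<sigma>_def)

lemma energy_scale:
  assumes "u \<in> H1 \<epsilon>" "\<theta> \<ge> 0"
  shows "En W (\<lambda>x. sqrt \<theta> * u x) = \<theta> * Dnorm2 \<epsilon> u / 2 - \<alpha> / p * (\<theta> powr (p/2) * Lpow \<epsilon> p u) - \<beta> / q * (\<theta> powr (q/2) * vsum q W u)"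
proof -
  have s: "sqrt \<theta> powr r = \<theta> powr (r/2)" for r
    using assms(2) by (simp add: powr_half_sqrt[symmetric] powr_powr)
  show ?thesis
    using assms p by (simp add: energy_eq pot_def Dnorm2_scale Lpow_scale vsum_scale s)
qed

text \<open>Both potential terms gain at least the factor \<theta>^\<sigma>, the kinetic term only
  \<theta>. The surplus (\<theta>^\<sigma> - \<theta>) D / 2 is recorded because its strict
  positivity later excludes ground states below the critical mass.\<close>

lemma energy_scale_le:
  assumes u: "u \<in> H1 \<epsilon>" and \<theta>: "\<theta> \<ge> 1"
  shows "En W (\<lambda>x. sqrt \<theta> * u x) \<le> \<theta> powr \<sigma> * En W u - (\<theta> powr \<sigma> - \<theta>) * Dnorm2 \<epsilon> u / 2"
proof -
  have "\<theta> powr \<sigma> \<le> \<theta> powr (p/2)" "\<theta> powr \<sigma> \<le> \<theta> powr (q/2)"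
    using \<theta> by (intro powr_mono; simp add: \<sigma>_def)+
  then have "\<alpha> / p * (\<theta> powr \<sigma> * Lpow \<epsilon> p u) \<le> \<alpha> / p * (\<theta> powr (p/2) * Lpow \<epsilon> p u)"
    "\<beta> / q * (\<theta> powr \<sigma> * vsum q W u) \<le> \<beta> / q * (\<theta> powr (q/2) * vsum q W u)"
    by (intro mult_left_mono mult_right_mono; use p q \<alpha> \<beta> Lpow_nonneg[OF u, of p] vsum_nonneg in simp)+
  moreover have "\<theta> powr \<sigma> * En W u - (\<theta> powr \<sigma> - \<theta>) * Dnorm2 \<epsilon> u / 2
    = \<theta> * Dnorm2 \<epsilon> u / 2 - \<alpha> / p * (\<theta> powr \<sigma> * Lpow \<epsilon> p u) - \<beta> / q * (\<theta> powr \<sigma> * vsum q W u)"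
    by (simp add: energy_eq pot_def algebra_simps diff_divide_distrib add_divide_distrib)
  ultimately show ?thesis using energy_scale[OF u, of \<theta> W] \<theta> by linarith
qed

lemma energy_tr: "u \<in> H1 \<epsilon> \<Longrightarrow> En W (tr k u) = En ((\<lambda>w. w + k) ` W) u"
  using p by (simp add: energy_eq pot_def H1_tr vsum_tr)

end

section \<open>Weak limits of derivatives and compactness\<close>

text \<open>A weak limit without a weak topology: g has the right pairing with every
  square-integrable h whose pairings with \<open>G n\<close> converge. Being within e of L is
  preserved by midpoints, so the limit passes from \<open>G\<close> to the hull elements
  \<open>a n\<close>, which converge to g in norm.\<close>

lemma mazur:
  fixes G :: "nat \<Rightarrow> 'a \<Rightarrow> real"
  assumes m: "\<And>n. G n \<in> borel_measurable M" and int: "\<And>n. integrable M (\<lambda>x. (G n x)\<^sup>2)"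
    and K: "\<And>n. (\<integral>x. (G n x)\<^sup>2 \<partial>M) \<le> K"
  obtains g where "g \<in> borel_measurable M" "integrable M (\<lambda>x. (g x)\<^sup>2)"
    "\<And>h L. h \<in> borel_measurable M \<Longrightarrow> integrable M (\<lambda>x. (h x)\<^sup>2) \<Longrightarrow>
       (\<lambda>n. \<integral>x. h x * G n x \<partial>M) \<longlonglongrightarrow> L \<Longrightarrow> (\<integral>x. h x * g x \<partial>M) = L"
proof -
  obtain a g where a: "\<And>n. a n \<in> midhull G n" and g: "g \<in> borel_measurable M" "integrable M (\<lambda>x. (g x)\<^sup>2)"
    and lim: "(\<lambda>n. \<integral>x. (a n x - g x)\<^sup>2 \<partial>M) \<longlonglongrightarrow> 0"
    using mazur_midhull[of G M K, OF m int K] by blast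
  have aL: "a n \<in> borel_measurable M" "integrable M (\<lambda>x. (a n x)\<^sup>2)" for n
    using midhull_L2[OF m int a] by auto
  have "(\<integral>x. h x * g x \<partial>M) = L"
    if h: "h \<in> borel_measurable M" "integrable M (\<lambda>x. (h x)\<^sup>2)" and L: "(\<lambda>n. \<integral>x. h x * G n x \<partial>M) \<longlonglongrightarrow> L" for h L
  proof -
    have hull: "\<bar>(\<integral>x. h x * b x \<partial>M) - L\<bar> \<le> e"
      if "b \<in> midhull G n" "\<And>k. k \<ge> n \<Longrightarrow> \<bar>(\<integral>x. h x * G k x \<partial>M) - L\<bar> \<le> e" for b n e
      using that
    proof induction
      case (mid b c)
      have "integrable M (\<lambda>x. h x * b x)" "integrable M (\<lambda>x. h x * c x)"
        using midhull_L2[OF m int mid(1)] midhull_L2[OF m int mid(2)] h by (auto intro: integrable_mult_L2)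
      then have "(\<integral>x. h x * ((b x + c x) / 2) \<partial>M) = ((\<integral>x. h x * b x \<partial>M) + (\<integral>x. h x * c x \<partial>M)) / 2"
        by (simp add: distrib_left)
      moreover have "\<bar>(\<integral>x. h x * b x \<partial>M) - L\<bar> \<le> e" by (rule mid.IH(1)) (rule mid.prems)
      moreover have "\<bar>(\<integral>x. h x * c x \<partial>M) - L\<bar> \<le> e" by (rule mid.IH(2)) (rule mid.prems)
      ultimately show ?case by argo
    qed auto
    have "(\<lambda>n. \<integral>x. h x * a n x \<partial>M) \<longlonglongrightarrow> L"
    proof (rule LIMSEQ_I)
      fix e :: real assume "e > 0"
      then obtain N where N: "\<And>k. k \<ge> N \<Longrightarrow> \<bar>(\<integral>x. h x * G k x \<partial>M) - L\<bar> < e/2"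
        using LIMSEQ_D[OF L, of "e/2"] by auto
      show "\<exists>N. \<forall>n\<ge>N. norm ((\<integral>x. h x * a n x \<partial>M) - L) < e"
      proof (intro exI[of _ N] allI impI)
        fix n assume "N \<le> n"
        then have "\<bar>(\<integral>x. h x * a n x \<partial>M) - L\<bar> \<le> e/2"
          by (intro hull[OF a] less_imp_le[OF N]) auto
        then show "norm ((\<integral>x. h x * a n x \<partial>M) - L) < e" using \<open>e > 0\<close> by simp
      qed
    qed
    moreover have "(\<lambda>n. \<integral>x. h x * a n x \<partial>M) \<longlonglongrightarrow> (\<integral>x. h x * g x \<partial>M)"
    proof (rule Lim_null[THEN iffD2, OF Lim_null_comparison])
      have "norm ((\<integral>x. h x * a n x \<partial>M) - (\<integral>x. h x * g x \<partial>M))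
          \<le> sqrt (\<integral>x. (h x)\<^sup>2 \<partial>M) * sqrt (\<integral>x. (a n x - g x)\<^sup>2 \<partial>M)" for n
      proof -
        have "(\<integral>x. h x * a n x \<partial>M) - (\<integral>x. h x * g x \<partial>M) = (\<integral>x. h x * (a n x - g x) \<partial>M)"
          using integrable_mult_L2[OF h(1) aL(1) h(2) aL(2)] integrable_mult_L2[OF h(1) g(1) h(2) g(2)]
          by (simp add: right_diff_distrib)
        then show ?thesis
          using Cauchy_Schwarz_integral_sqrt(2)[OF h(1) _ h(2) integrable_add_square(2)[OF aL(1) g(1) aL(2) g(2)]] aL g
          by simp
      qed
      then show "\<forall>\<^sub>F n in sequentially. norm ((\<integral>x. h x * a n x \<partial>M) - (\<integral>x. h x * g x \<partial>M))
          \<le> sqrt (\<integral>x. (h x)\<^sup>2 \<partial>M) * sqrt (\<integral>x. (a n x - g x)\<^sup>2 \<partial>M)"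
        by (intro always_eventually) auto
      have "(\<lambda>n. sqrt (\<integral>x. (h x)\<^sup>2 \<partial>M) * sqrt (\<integral>x. (a n x - g x)\<^sup>2 \<partial>M)) \<longlonglongrightarrow> sqrt (\<integral>x. (h x)\<^sup>2 \<partial>M) * sqrt 0"
        by (intro tendsto_intros lim)
      then show "(\<lambda>n. sqrt (\<integral>x. (h x)\<^sup>2 \<partial>M) * sqrt (\<integral>x. (a n x - g x)\<^sup>2 \<partial>M)) \<longlonglongrightarrow> 0" by simp
    qed
    ultimately show ?thesis by (rule LIMSEQ_unique[symmetric])
  qed
  then show ?thesis using that g by blast
qed

context grid
begin

text \<open>The edges are closed and locally finite. Near a point the graph is therefore a finite
  union of closed pieces, on which continuity can be glued.\<close>

lemma grid_continuousI:
  assumes c: "\<And>e. continuous_on {0..\<epsilon>} (\<lambda>t. lift u (e, t))"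
  shows "continuous_on (grid_graph \<epsilon>) u"
proof -
  let ?A = "\<lambda>e. edge_pt \<epsilon> e ` {0..\<epsilon>}"
  define \<tau> where "\<tau> e x = (if snd (snd e) then snd x - \<epsilon> * of_int (fst (snd e)) else fst x - \<epsilon> * of_int (fst e))"
    for e :: edge and x :: "real \<times> real"
  have \<tau>: "\<tau> e (edge_pt \<epsilon> e t) = t" for e t
    by (auto simp: \<tau>_def edge_pt_def split: prod.splits)
  have closed: "closed (?A e)" for e
    by (intro compact_imp_closed compact_continuous_image continuous_edge_pt) auto
  have cA: "continuous_on (?A e) u" for e
  proof (rule continuous_on_eq)
    have "continuous_on (?A e) (\<tau> e)"
      unfolding \<tau>_def[abs_def] by (cases "snd (snd e)") (auto intro!: continuous_intros)
    moreover have "\<tau> e ` ?A e \<subseteq> {0..\<epsilon>}" by (simp add: image_image \<tau>)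
    ultimately show "continuous_on (?A e) (\<lambda>x. lift u (e, \<tau> e x))"
      by (intro continuous_on_compose2[OF c])
    show "lift u (e, \<tau> e x) = u x" if x: "x \<in> ?A e" for x
    proof -
      obtain t where "x = edge_pt \<epsilon> e t" using x by blast
      then show ?thesis by (simp add: lift_def \<tau>)
    qed
  qed
  show ?thesis
    unfolding continuous_on_eq_continuous_within
  proof
    fix x assume x: "x \<in> grid_graph \<epsilon>"
    \<comment> \<open>The edges that meet the unit ball around x. Their base indices lie in the
      bounded ranges \<open>?J\<close>, so there are finitely many, and near x the graph is their
      union.\<close>
    define F where "F = {e. ?A e \<inter> ball x 1 \<noteq> {}}"
    let ?J = "\<lambda>a. {\<lfloor>(a - 1 - \<epsilon>) / \<epsilon>\<rfloor>..\<lceil>(a + 1) / \<epsilon>\<rceil>}"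
    have "F \<subseteq> ?J (fst x) \<times> ?J (snd x) \<times> UNIV"
    proof
      fix e assume "e \<in> F"
      then obtain t where t: "0 \<le> t" "t \<le> \<epsilon>" "dist x (edge_pt \<epsilon> e t) < 1" by (auto simp: F_def)
      obtain i j b where e: "e = (i, j, b)" by (cases e)
      have "\<bar>fst x - fst (edge_pt \<epsilon> e t)\<bar> < 1" "\<bar>snd x - snd (edge_pt \<epsilon> e t)\<bar> < 1"
        using dist_fst_le[of x "edge_pt \<epsilon> e t"] dist_snd_le[of x "edge_pt \<epsilon> e t"] t(3) by (auto simp: dist_real_def)
      then have "fst x - 1 - \<epsilon> \<le> \<epsilon> * of_int i" "\<epsilon> * of_int i \<le> fst x + 1"
        "snd x - 1 - \<epsilon> \<le> \<epsilon> * of_int j" "\<epsilon> * of_int j \<le> snd x + 1"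
        using t(1,2) by (auto simp: e edge_pt_def split: if_splits)
      then have "(fst x - 1 - \<epsilon>) / \<epsilon> \<le> of_int i" "of_int i \<le> (fst x + 1) / \<epsilon>"
        "(snd x - 1 - \<epsilon>) / \<epsilon> \<le> of_int j" "of_int j \<le> (snd x + 1) / \<epsilon>"
        using eps_pos by (auto simp: field_simps)
      then show "e \<in> ?J (fst x) \<times> ?J (snd x) \<times> UNIV"
        by (auto simp: e intro: order_trans[OF floor_mono, of _ "of_int i"] order_trans[OF floor_mono, of _ "of_int j"] simp: le_ceiling_iff floor_le_iff)
    qed
    then have finF: "finite F" by (rule finite_subset) auto
    have cF: "continuous_on (\<Union>e\<in>F. ?A e) u"
      by (rule continuous_on_closed_Union[OF finF closed cA])
    have "grid_graph \<epsilon> \<inter> ball x 1 - {x} = (\<Union>e\<in>F. ?A e) \<inter> ball x 1 - {x}"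
      unfolding grid_graph_def F_def by blast
    then have w: "at x within grid_graph \<epsilon> = at x within (\<Union>e\<in>F. ?A e)"
      by (intro at_within_nhd[of x "ball x 1"]) auto
    have "x \<in> (\<Union>e\<in>F. ?A e)"
    proof -
      obtain e where "x \<in> ?A e" using x unfolding grid_graph_def by blast
      moreover have "x \<in> ball x 1" by simp
      ultimately show ?thesis unfolding F_def by blast
    qed
    then show "continuous (at x within grid_graph \<epsilon>) u"
      using cF unfolding w continuous_on_eq_continuous_within by blast
  qed
qed

text \<open>These indicators are the test functions for weak limits: paired with a weak derivative
  they return the increment of the function along an edge.\<close>

lemma integral_edge_segment:
  fixes f :: "edge \<times> real \<Rightarrow> real"
  assumes f: "f \<in> borel_measurable gmeas" "integrable gmeas (\<lambda>p. (f p)\<^sup>2)" and x: "x \<in> {0..\<epsilon>}"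
  shows "(indicator ({e} \<times> {0..x}) :: edge \<times> real \<Rightarrow> real) \<in> borel_measurable gmeas"
    "integrable gmeas (\<lambda>p. (indicator ({e} \<times> {0..x}) p :: real)\<^sup>2)"
    "(\<integral>p. indicator ({e} \<times> {0..x}) p * f p \<partial>gmeas) = (LINT t:{0..x}|lborel. f (e, t))"
proof -
  interpret pair_sigma_finite "count_space (UNIV::edge set)" seg by (rule pair_sf)
  let ?h = "indicator ({e} \<times> {0..x}) :: edge \<times> real \<Rightarrow> real"
  have hs: "(\<lambda>t. ?h (e', t)) = (\<lambda>t. if e' = e then indicator {0..x} t else 0)" for e'
    by (auto simp: indicator_def)
  have im: "(\<lambda>t. indicator {0..x} t :: real) \<in> borel_measurable seg"
    using integrable_seg_indicator by blast
  show hm: "?h \<in> borel_measurable gmeas"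
  proof (rule gmeas_measurableI)
    show "(\<lambda>t. ?h (e', t)) \<in> borel_measurable seg" for e'
      unfolding hs using im by (cases "e' = e") auto
  qed
  have h2: "(?h p)\<^sup>2 = ?h p" for p by (simp add: indicator_def)
  have "(\<lambda>e'. \<integral>t. ?h (e', t) \<partial>seg) summable_on UNIV"
  proof (rule finite_nonzero_values_imp_summable_on)
    have "e' = e" if "(\<integral>t. ?h (e', t) \<partial>seg) \<noteq> 0" for e'
      using that by (rule contrapos_np) (simp add: hs)
    then have "{e' \<in> UNIV. (\<integral>t. ?h (e', t) \<partial>seg) \<noteq> 0} \<subseteq> {e}" by blast
    then show "finite {e' \<in> UNIV. (\<integral>t. ?h (e', t) \<partial>seg) \<noteq> 0}" by (rule finite_subset) simp
  qed
  moreover have "integrable seg (\<lambda>t. ?h (e', t))" for e'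
    unfolding hs using integrable_seg_indicator[of 0 x] by (cases "e' = e") auto
  ultimately show hi: "integrable gmeas (\<lambda>p. (?h p)\<^sup>2)"
    unfolding h2 using gmeas_nonneg(1)[OF hm] by (metis indicator_pos_le)
  have i: "integrable gmeas (\<lambda>p. ?h p * f p)" by (rule integrable_mult_L2[OF hm f(1) hi f(2)])
  have s: "(\<integral>t. ?h (e', t) * f (e', t) \<partial>seg) = (if e' = e then (LINT t:{0..x}|lborel. f (e, t)) else 0)" for e'
  proof (cases "e' = e")
    case True
    have "(\<integral>t. ?h (e, t) * f (e, t) \<partial>seg) = (\<integral>t. indicator {0..x} t * f (e, t) \<partial>seg)"
      by (intro Bochner_Integration.integral_cong) (auto simp: indicator_def)
    also have "\<dots> = (LINT t:{0..x}|lborel. f (e, t))"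
      unfolding integral_seg set_lebesgue_integral_def
      using x by (intro Bochner_Integration.integral_cong) (auto simp: indicator_def)
    finally show ?thesis using True by simp
  next
    case False
    then have "?h (e', t) * f (e', t) = 0" for t by (simp add: indicator_def)
    then show ?thesis using False by simp
  qed
  have "(\<integral>p. ?h p * f p \<partial>gmeas) = (\<integral>e'. (\<integral>t. ?h (e', t) * f (e', t) \<partial>seg) \<partial>count_space UNIV)"
    using integral_fst'[of "\<lambda>p. ?h p * f p"] i by (simp add: gmeas_def)
  also have "\<dots> = (\<integral>e'. indicator {e} e' * (LINT t:{0..x}|lborel. f (e, t)) \<partial>count_space UNIV)"
    unfolding s by (intro Bochner_Integration.integral_cong) (auto simp: indicator_def)
  also have "\<dots> = (LINT t:{0..x}|lborel. f (e, t))"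
    by (subst Bochner_Integration.integral_mult_left) (auto simp: integrable_indicator_iff)
  finally show "(\<integral>p. ?h p * f p \<partial>gmeas) = (LINT t:{0..x}|lborel. f (e, t))" .
qed

text \<open>Paired with initial segments of edges, \<open>G n\<close> gives increments of
  \<open>v n\<close>, which converge pointwise; the weak limit g therefore integrates to the
  increments of \<open>U\<close>. The second conclusion is passed on for pairings with other
  square-integrable functions.\<close>

lemma weak_limit:
  assumes w: "\<And>n. wd (v n) (G n)" and K: "\<And>n. (\<integral>p. (G n p)\<^sup>2 \<partial>gmeas) \<le> K"
    and lim: "\<And>p. p \<in> space gmeas \<Longrightarrow> (\<lambda>n. lift (v n) p) \<longlonglongrightarrow> lift U p"
  obtains g where "wd U g"
    "\<And>h L. h \<in> borel_measurable gmeas \<Longrightarrow> integrable gmeas (\<lambda>x. (h x)\<^sup>2) \<Longrightarrow>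
       (\<lambda>n. \<integral>x. h x * G n x \<partial>gmeas) \<longlonglongrightarrow> L \<Longrightarrow> (\<integral>x. h x * g x \<partial>gmeas) = L"
proof -
  obtain g where g: "g \<in> borel_measurable gmeas" "integrable gmeas (\<lambda>x. (g x)\<^sup>2)"
    and wk: "\<And>h L. h \<in> borel_measurable gmeas \<Longrightarrow> integrable gmeas (\<lambda>x. (h x)\<^sup>2) \<Longrightarrow>
       (\<lambda>n. \<integral>x. h x * G n x \<partial>gmeas) \<longlonglongrightarrow> L \<Longrightarrow> (\<integral>x. h x * g x \<partial>gmeas) = L"
    by (rule mazur[of G gmeas K, OF wdD(1)[OF w] wdD(2)[OF w] K]) blast
  have "lift U (e, x) = lift U (e, 0) + (LINT t:{0..x}|lborel. g (e, t))" if x: "x \<in> {0..\<epsilon>}" for e x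
  proof -
    have "(\<integral>p. indicator ({e} \<times> {0..x}) p * G n p \<partial>gmeas) = lift (v n) (e, x) - lift (v n) (e, 0)" for n
      using integral_edge_segment(3)[OF wdD(1,2)[OF w] x, of e] wdD(6)[OF w x, of n e] by simp
    moreover have "(\<lambda>n. lift (v n) (e, x) - lift (v n) (e, 0)) \<longlonglongrightarrow> lift U (e, x) - lift U (e, 0)"
      using x eps_pos by (intro tendsto_diff lim) auto
    ultimately have "(\<integral>p. indicator ({e} \<times> {0..x}) p * g p \<partial>gmeas) = lift U (e, x) - lift U (e, 0)"
      using integral_edge_segment(1,2)[OF g x, of e] by (intro wk) auto
    then show ?thesis using integral_edge_segment(3)[OF g x, of e] by simp
  qed
  then have "wd U g" using g unfolding wd_def by blast
  then show ?thesis using that wk by blast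
qed

text \<open>Pointwise convergence comes from an Arzela-Ascoli argument with the uniform Hoelder
  bound. The last conclusion is the Brezis-Lieb identity for the derivatives, which weak convergence
  already yields in a Hilbert space.\<close>

lemma H1_compact:
  assumes u: "\<And>n. u n \<in> H1 \<epsilon>" and m: "\<And>n. mass (u n) \<le> \<mu>" and K: "\<And>n. Dnorm2 \<epsilon> (u n) \<le> K"
  obtains r U where "strict_mono (r :: nat \<Rightarrow> nat)" "U \<in> H1 \<epsilon>"
    "\<And>p. p \<in> space gmeas \<Longrightarrow> (\<lambda>n. lift (u (r n)) p) \<longlonglongrightarrow> lift U p"
    "(\<lambda>n. Dnorm2 \<epsilon> (u (r n)) - Dnorm2 \<epsilon> (\<lambda>x. u (r n) x - U x)) \<longlonglongrightarrow> Dnorm2 \<epsilon> U"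
proof -
  have \<mu>0: "\<mu> \<ge> 0" using mass_nonneg m order_trans by blast
  have K0: "K \<ge> 0" using Dnorm2_nonneg[OF u] K order_trans by blast
  have bd: "\<bar>lift (u n) p\<bar> \<le> sqrt (supb \<mu> K)" if "p \<in> space gmeas" for n p
  proof -
    have "(lift (u n) p)\<^sup>2 \<le> supb (mass (u n)) (Dnorm2 \<epsilon> (u n))" by (rule sup_bound[OF u that])
    also have "\<dots> \<le> supb \<mu> K" by (intro supb_mono m K mass_nonneg Dnorm2_nonneg u)
    finally show ?thesis by (rule real_le_rsqrt[of "\<bar>_\<bar>", simplified])
  qed
  have hold: "(lift (u n) (e, x) - lift (u n) (e, y))\<^sup>2 \<le> \<bar>x - y\<bar> * K"
    if "x \<in> {0..\<epsilon>}" "y \<in> {0..\<epsilon>}" for n e x y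
  proof -
    obtain g where g: "wd (u n) g" using H1_wd u by blast
    have "(lift (u n) (e, x) - lift (u n) (e, y))\<^sup>2 \<le> \<bar>x - y\<bar> * edge_sq g e"
      by (rule edge_holder[OF g that])
    also have "\<dots> \<le> \<bar>x - y\<bar> * K"
      using Dnorm2_sum(3)[OF g, of e] K[of n] by (intro mult_left_mono) auto
    finally show ?thesis .
  qed
  \<comment> \<open>Countably many points allow a diagonal subsequence; equicontinuity then extends
    convergence from rational parameters to every point of every edge.\<close>
  define S where "S = (UNIV :: edge set) \<times> (\<rat> \<inter> {0..\<epsilon>})"
  have "countable S" unfolding S_def by (intro countable_SIGMA countable_Int1 countable_rat) auto
  moreover have "norm (lift (u n) x) \<le> sqrt (supb \<mu> K)" if "x \<in> S" for n x
    using bd[of x n] that by (auto simp: S_def)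
  ultimately obtain r where r: "strict_mono (r :: nat \<Rightarrow> nat)"
    and rS: "\<And>x. x \<in> S \<Longrightarrow> \<exists>l. (\<lambda>n. lift (u (r n)) x) \<longlonglongrightarrow> l"
    using function_convergent_subsequence[of S "\<lambda>n x. lift (u n) x" "sqrt (supb \<mu> K)"] by blast
  have conv: "convergent (\<lambda>n. lift (u (r n)) (e, t))" if t: "t \<in> {0..\<epsilon>}" for e t
  proof (rule Cauchy_convergent, rule CauchyI)
    fix d :: real assume d: "d > 0"
    define \<eta> where "\<eta> = d\<^sup>2 / 16 / (K + 1)"
    have \<eta>: "\<eta> > 0" using d K0 by (simp add: \<eta>_def)
    obtain s where s: "s \<in> \<rat>" "s \<in> {0..\<epsilon>}" "\<bar>t - s\<bar> < \<eta>"
    proof (cases "t < \<epsilon>")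
      case True
      then obtain s where "s \<in> \<rat>" "t < s" "s < min \<epsilon> (t + \<eta>)"
        using Rats_dense_in_real[of t "min \<epsilon> (t + \<eta>)"] \<eta> by auto
      then show ?thesis using that[of s] t by auto
    next
      case False
      then obtain s where "s \<in> \<rat>" "max 0 (t - \<eta>) < s" "s < t"
        using Rats_dense_in_real[of "max 0 (t - \<eta>)" t] \<eta> t eps_pos by auto
      then show ?thesis using that[of s] t by auto
    qed
    have near: "\<bar>lift (u n) (e, t) - lift (u n) (e, s)\<bar> \<le> d/4" for n
    proof -
      have "(lift (u n) (e, t) - lift (u n) (e, s))\<^sup>2 \<le> \<bar>t - s\<bar> * K" by (rule hold[OF t s(2)])
      also have "\<dots> \<le> \<eta> * (K + 1)" using s(3) K0 by (intro mult_mono) auto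
      also have "\<dots> = (d/4)\<^sup>2"
      proof -
        have "K + 1 \<noteq> 0" using K0 by simp
        then have "\<eta> * (K + 1) = d\<^sup>2 / 16" unfolding \<eta>_def by (metis nonzero_eq_divide_eq)
        then show ?thesis by (simp add: power_divide)
      qed
      finally show ?thesis using abs_le_square_iff[of "lift (u n) (e, t) - lift (u n) (e, s)" "d/4"] d by simp
    qed
    have "(e, s) \<in> S" using s by (simp add: S_def)
    then have "Cauchy (\<lambda>n. lift (u (r n)) (e, s))"
      using rS LIMSEQ_imp_Cauchy by blast
    from CauchyD[OF this, of "d/4"]
    obtain N where N: "\<And>i j. i \<ge> N \<Longrightarrow> j \<ge> N \<Longrightarrow> \<bar>lift (u (r i)) (e, s) - lift (u (r j)) (e, s)\<bar> < d/4"
      using d unfolding real_norm_def by (metis divide_pos_pos zero_less_numeral)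
    show "\<exists>M. \<forall>i\<ge>M. \<forall>j\<ge>M. norm (lift (u (r i)) (e, t) - lift (u (r j)) (e, t)) < d"
    proof (intro exI[of _ N] allI impI)
      fix i j assume ij: "N \<le> i" "N \<le> j"
      have "\<bar>A - B\<bar> \<le> \<bar>A - a\<bar> + \<bar>a - b\<bar> + \<bar>B - b\<bar>" for A B a b :: real by linarith
      then have "\<bar>lift (u (r i)) (e, t) - lift (u (r j)) (e, t)\<bar> \<le> \<bar>lift (u (r i)) (e, t) - lift (u (r i)) (e, s)\<bar>
          + \<bar>lift (u (r i)) (e, s) - lift (u (r j)) (e, s)\<bar> + \<bar>lift (u (r j)) (e, t) - lift (u (r j)) (e, s)\<bar>" .
      also have "\<dots> < d/4 + d/4 + d/4"
        using near[of "r i"] near[of "r j"] N[OF ij] by (intro add_less_le_mono add_le_less_mono)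
      finally show "norm (lift (u (r i)) (e, t) - lift (u (r j)) (e, t)) < d" using d by simp
    qed
  qed
  define U where "U x = lim (\<lambda>n. u (r n) x)" for x
  have lim: "(\<lambda>n. lift (u (r n)) p) \<longlonglongrightarrow> lift U p" if "p \<in> space gmeas" for p
    using conv[of "snd p" "fst p"] that by (auto simp: lift_def U_def convergent_LIMSEQ_iff)
  have holdU: "(lift U (e, x) - lift U (e, y))\<^sup>2 \<le> \<bar>x - y\<bar> * K" if "x \<in> {0..\<epsilon>}" "y \<in> {0..\<epsilon>}" for e x y
  proof -
    have "(\<lambda>n. lift (u (r n)) (e, x)) \<longlonglongrightarrow> lift U (e, x)" "(\<lambda>n. lift (u (r n)) (e, y)) \<longlonglongrightarrow> lift U (e, y)"
      using that by (intro lim; simp)+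
    then have "(\<lambda>n. (lift (u (r n)) (e, x) - lift (u (r n)) (e, y))\<^sup>2) \<longlonglongrightarrow> (lift U (e, x) - lift U (e, y))\<^sup>2"
      by (intro tendsto_intros)
    then show ?thesis by (rule Lim_bounded) (use hold[OF that] in blast)
  qed
  have "continuous_on {0..\<epsilon>} (\<lambda>t. lift U (e, t))" for e
    unfolding continuous_on_iff dist_real_def
  proof (intro ballI allI impI)
    fix x d :: real assume x: "x \<in> {0..\<epsilon>}" and d: "d > 0"
    show "\<exists>c>0. \<forall>y\<in>{0..\<epsilon>}. \<bar>y - x\<bar> < c \<longrightarrow> \<bar>lift U (e, y) - lift U (e, x)\<bar> < d"
    proof (intro exI[of _ "d\<^sup>2 / (K + 1)"] conjI ballI impI)
      show "0 < d\<^sup>2 / (K + 1)" using d K0 by simp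
      fix y assume y: "y \<in> {0..\<epsilon>}" "\<bar>y - x\<bar> < d\<^sup>2 / (K + 1)"
      have "(lift U (e, y) - lift U (e, x))\<^sup>2 \<le> \<bar>y - x\<bar> * K" by (rule holdU[OF y(1) x])
      also have "\<dots> \<le> \<bar>y - x\<bar> * (K + 1)" using K0 by (intro mult_left_mono) auto
      also have "\<dots> < d\<^sup>2" using y K0 by (simp add: field_simps)
      finally show "\<bar>lift U (e, y) - lift U (e, x)\<bar> < d" 
        using power2_less_imp_less[of "\<bar>lift U (e, y) - lift U (e, x)\<bar>" d] d by simp
    qed
  qed
  then have cU: "continuous_on (grid_graph \<epsilon>) U" by (rule grid_continuousI)
  have iU: "integrable gmeas (\<lambda>p. (lift U p)\<^sup>2)"
  proof (rule fatou_real(1))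
    show "\<And>n. integrable gmeas (\<lambda>p. (lift (u (r n)) p)\<^sup>2)" by (rule H1_lift(3)[OF u])
    show "\<And>n. (\<integral>p. (lift (u (r n)) p)\<^sup>2 \<partial>gmeas) \<le> \<mu>" using m by (simp add: mass_def)
    show "AE p in gmeas. (\<lambda>n. (lift (u (r n)) p)\<^sup>2) \<longlonglongrightarrow> (lift U p)\<^sup>2"
      by (intro AE_I2 tendsto_intros lim)
  qed (use lift_measurable[OF cU] in auto)
  have "\<forall>n. \<exists>g. wd (u (r n)) g" using H1_wd[OF u] by blast
  then obtain G where G: "\<And>n. wd (u (r n)) (G n)" by metis
  have GK: "(\<integral>p. (G n p)\<^sup>2 \<partial>gmeas) \<le> K" for n using Dnorm2_eq[OF G] K by metis
  obtain g where g: "wd U g" by (rule weak_limit[OF G GK lim])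
  then have U: "U \<in> H1 \<epsilon>" using cU iU H1_iff by blast
  \<comment> \<open>The pairing of the n-th derivative with that of the limit.
    \<open>weak_limit\<close> evaluates only pairings known to converge, so a further subsequence is
    extracted.\<close>
  define c where "c n = (\<integral>p. g p * G n p \<partial>gmeas)" for n
  have "\<bar>c n\<bar> \<le> sqrt (\<integral>p. (g p)\<^sup>2 \<partial>gmeas) * sqrt K" for n
  proof -
    have "\<bar>c n\<bar> \<le> sqrt (\<integral>p. (g p)\<^sup>2 \<partial>gmeas) * sqrt (\<integral>p. (G n p)\<^sup>2 \<partial>gmeas)"
      unfolding c_def by (rule Cauchy_Schwarz_integral_sqrt(2)[OF wdD(1)[OF g] wdD(1)[OF G] wdD(2)[OF g] wdD(2)[OF G]])
    also have "\<dots> \<le> sqrt (\<integral>p. (g p)\<^sup>2 \<partial>gmeas) * sqrt K" using GK by (intro mult_left_mono) auto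
    finally show ?thesis .
  qed
  then have "bounded (range c)" by (auto simp: bounded_iff)
  then obtain L r2 where r2: "strict_mono (r2 :: nat \<Rightarrow> nat)" and L: "(c \<circ> r2) \<longlonglongrightarrow> L"
    using bounded_imp_convergent_subsequence by blast
  have lim2: "(\<lambda>n. lift (u (r (r2 n))) p) \<longlonglongrightarrow> lift U p" if "p \<in> space gmeas" for p
    using LIMSEQ_subseq_LIMSEQ[OF lim[OF that] r2] by (simp add: o_def)
  \<comment> \<open>A second weak limit along the subsequence. Its representative \<open>g'\<close>
    may differ from g, but both are derivatives of \<open>U\<close> and agree in L2; hence L is the
    squared norm of g.\<close>
  have "\<exists>g'. wd U g' \<and> (\<integral>p. g p * g' p \<partial>gmeas) = L"
  proof (rule weak_limit[of "\<lambda>n. u (r (r2 n))" "\<lambda>n. G (r2 n)", OF G GK lim2])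
    fix g' assume "wd U g'" and wk: "\<And>h L. h \<in> borel_measurable gmeas \<Longrightarrow> integrable gmeas (\<lambda>x. (h x)\<^sup>2) \<Longrightarrow>
       (\<lambda>n. \<integral>x. h x * G (r2 n) x \<partial>gmeas) \<longlonglongrightarrow> L \<Longrightarrow> (\<integral>x. h x * g' x \<partial>gmeas) = L"
    moreover have "(\<integral>p. g p * g' p \<partial>gmeas) = L"
      using L by (intro wk wdD(1,2)[OF g]) (simp add: c_def o_def)
    ultimately show ?thesis by blast
  qed
  then obtain g' where g': "wd U g'" and "(\<integral>p. g p * g' p \<partial>gmeas) = L" by blast
  moreover have "(\<integral>p. g p * g' p \<partial>gmeas) = (\<integral>p. (g p)\<^sup>2 \<partial>gmeas)"
  proof -
    have d: "(\<lambda>p. g p - g' p) \<in> borel_measurable gmeas" using wdD(1)[OF g] wdD(1)[OF g'] by simp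
    have "\<bar>\<integral>p. g p * (g p - g' p) \<partial>gmeas\<bar> \<le> sqrt (\<integral>p. (g p)\<^sup>2 \<partial>gmeas) * sqrt (\<integral>p. (g p - g' p)\<^sup>2 \<partial>gmeas)"
      by (rule Cauchy_Schwarz_integral_sqrt(2)[OF wdD(1)[OF g] d wdD(2)[OF g]
            integrable_add_square(2)[OF wdD(1)[OF g] wdD(1)[OF g'] wdD(2)[OF g] wdD(2)[OF g']]])
    then have "(\<integral>p. g p * (g p - g' p) \<partial>gmeas) = 0" using wd_unique[OF g g'] by simp
    moreover have "(\<integral>p. g p * (g p - g' p) \<partial>gmeas) = (\<integral>p. (g p)\<^sup>2 \<partial>gmeas) - (\<integral>p. g p * g' p \<partial>gmeas)"
      using wdD(2)[OF g] integrable_mult_L2[OF wdD(1)[OF g] wdD(1)[OF g'] wdD(2)[OF g] wdD(2)[OF g']]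
      by (simp add: right_diff_distrib power2_eq_square)
    ultimately show ?thesis by simp
  qed
  ultimately have LD: "L = Dnorm2 \<epsilon> U" using Dnorm2_eq[OF g] by simp
  \<comment> \<open>On expanding the square the norms of \<open>G\<close> cancel, and only the
    convergent pairing is left.\<close>
  have "Dnorm2 \<epsilon> (u (r (r2 n))) - Dnorm2 \<epsilon> (\<lambda>x. u (r (r2 n)) x - U x) = 2 * c (r2 n) - Dnorm2 \<epsilon> U" for n
  proof -
    let ?G = "G (r2 n)"
    note Gn = wdD(1,2)[OF G, of "r2 n"]
    have "Dnorm2 \<epsilon> (\<lambda>x. u (r (r2 n)) x - U x) = (\<integral>p. (?G p - g p)\<^sup>2 \<partial>gmeas)"
      by (rule Dnorm2_eq[OF wd_diff[OF G g]])
    also have "\<dots> = (\<integral>p. (?G p)\<^sup>2 + (g p)\<^sup>2 - 2 * (g p * ?G p) \<partial>gmeas)"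
      by (intro Bochner_Integration.integral_cong) (auto simp: power2_eq_square algebra_simps)
    also have "\<dots> = (\<integral>p. (?G p)\<^sup>2 \<partial>gmeas) + (\<integral>p. (g p)\<^sup>2 \<partial>gmeas) - 2 * c (r2 n)"
      using Gn(2) wdD(2)[OF g] integrable_mult_L2[OF wdD(1)[OF g] Gn(1) wdD(2)[OF g] Gn(2)] by (simp add: c_def)
    finally show ?thesis using Dnorm2_eq[OF G, of "r2 n"] Dnorm2_eq[OF g] by simp
  qed
  moreover have "(\<lambda>n. 2 * c (r2 n) - Dnorm2 \<epsilon> U) \<longlonglongrightarrow> 2 * L - Dnorm2 \<epsilon> U"
    using L by (intro tendsto_intros) (simp add: o_def)
  ultimately have D: "(\<lambda>n. Dnorm2 \<epsilon> (u (r (r2 n))) - Dnorm2 \<epsilon> (\<lambda>x. u (r (r2 n)) x - U x)) \<longlonglongrightarrow> Dnorm2 \<epsilon> U"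
    by (simp add: LD)
  show ?thesis
    using that[of "r \<circ> r2" U] strict_mono_o[OF r r2] U lim2 D by (simp add: o_def)
qed

end

section \<open>Splitting of mass and energy along pointwise convergent sequences\<close>

lemma
  fixes f g :: "'a \<Rightarrow> real"
  assumes "f summable_on A" "g summable_on A"
  shows summable_on_diff_real: "(\<lambda>x. f x - g x) summable_on A"
    and infsum_diff_real: "(\<Sum>\<^sub>\<infinity>x\<in>A. f x - g x) = infsum f A - infsum g A"
  using summable_on_add[of f A "\<lambda>x. - g x"] infsum_add[of f A "\<lambda>x. - g x"] assms
  by (auto simp: summable_on_uminus infsum_uminus)

context grid
begin

text \<open>Brezis-Lieb on \<open>gmeas\<close> and on counting measure over the whole lattice. The
  sets \<open>W n\<close> are arbitrary: the error over \<open>W n\<close> is at most the sum of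
  absolute errors over all vertices, which tends to 0.\<close>

lemma Lpow_vsum_splitting:
  assumes v: "\<And>n. v n \<in> H1 \<epsilon>" and U: "U \<in> H1 \<epsilon>" and m: "\<And>n. mass (v n) \<le> \<mu>" and K: "\<And>n. Dnorm2 \<epsilon> (v n) \<le> K"
    and lim: "\<And>p. p \<in> space gmeas \<Longrightarrow> (\<lambda>n. lift (v n) p) \<longlonglongrightarrow> lift U p" and r: "r \<ge> 2"
  shows "(\<lambda>n. Lpow \<epsilon> r (v n) - Lpow \<epsilon> r (\<lambda>x. v n x - U x) - Lpow \<epsilon> r U) \<longlonglongrightarrow> 0"
    "(\<lambda>n. vsum r (W n) (v n) - vsum r (W n) (\<lambda>x. v n x - U x) - vsum r (W n) U) \<longlonglongrightarrow> 0"
proof -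
  let ?w = "\<lambda>n x. v n x - U x"
  have w: "?w n \<in> H1 \<epsilon>" for n by (rule H1_diff[OF v U])
  have S: "(lift (v n) p)\<^sup>2 \<le> supb \<mu> K" if "p \<in> space gmeas" for n p
    using sup_bound[OF v that] supb_mono[OF m K mass_nonneg Dnorm2_nonneg[OF v]] by (rule order_trans)
  have \<mu>: "\<mu> \<ge> 0" using mass_nonneg m order_trans by blast
  show "(\<lambda>n. Lpow \<epsilon> r (v n) - Lpow \<epsilon> r (?w n) - Lpow \<epsilon> r U) \<longlonglongrightarrow> 0"
  proof (rule Lim_null_comparison)
    have "(\<integral>p. \<bar>lift (v n) p\<bar> powr r \<partial>gmeas) \<le> supb \<mu> K powr ((r - 2) / 2) * \<mu>" for n
    proof -
      have "Lpow \<epsilon> r (v n) \<le> supb \<mu> K powr ((r - 2) / 2) * mass (v n)" by (rule Lpow_bound(1)[OF v r S])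
      also have "\<dots> \<le> supb \<mu> K powr ((r - 2) / 2) * \<mu>" by (intro mult_left_mono m) auto
      finally show ?thesis using Lpow_eq(2)[OF v r] by simp
    qed
    then show "(\<lambda>n. \<integral>p. \<bar>\<bar>lift (v n) p\<bar> powr r - \<bar>lift (v n) p - lift U p\<bar> powr r - \<bar>lift U p\<bar> powr r\<bar> \<partial>gmeas) \<longlonglongrightarrow> 0"
      using r by (intro brezis_lieb(3) H1_lift(2) v U Lpow_eq(1) lim) auto
    show "\<forall>\<^sub>F n in sequentially. norm (Lpow \<epsilon> r (v n) - Lpow \<epsilon> r (?w n) - Lpow \<epsilon> r U)
      \<le> (\<integral>p. \<bar>\<bar>lift (v n) p\<bar> powr r - \<bar>lift (v n) p - lift U p\<bar> powr r - \<bar>lift U p\<bar> powr r\<bar> \<partial>gmeas)"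
    proof (intro always_eventually allI)
      fix n
      have lw: "lift (?w n) p = lift (v n) p - lift U p" for p by (simp add: lift_def)
      have "Lpow \<epsilon> r (v n) - Lpow \<epsilon> r (?w n) - Lpow \<epsilon> r U
        = (\<integral>p. \<bar>lift (v n) p\<bar> powr r - \<bar>lift (v n) p - lift U p\<bar> powr r - \<bar>lift U p\<bar> powr r \<partial>gmeas)"
        using Lpow_eq[OF v r] Lpow_eq[OF U r] Lpow_eq[OF w r, of n, unfolded lw] by simp
      then show "norm (Lpow \<epsilon> r (v n) - Lpow \<epsilon> r (?w n) - Lpow \<epsilon> r U)
        \<le> (\<integral>p. \<bar>\<bar>lift (v n) p\<bar> powr r - \<bar>lift (v n) p - lift U p\<bar> powr r - \<bar>lift U p\<bar> powr r\<bar> \<partial>gmeas)"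
        by (simp add: integral_abs_bound)
    qed
  qed
  let ?C = "count_space (UNIV :: (int \<times> int) set)"
  have ic: "integrable ?C (\<lambda>k. \<bar>z (vtx k)\<bar> powr r)" "(\<integral>k. \<bar>z (vtx k)\<bar> powr r \<partial>?C) = vsum r UNIV z" if "z \<in> H1 \<epsilon>" for z
    using count_space_nonneg[of UNIV "\<lambda>k. \<bar>z (vtx k)\<bar> powr r"] vsum_summable[OF that r, of UNIV]
    by (auto simp: vsum_def)
  let ?h = "\<lambda>n k. \<bar>v n (vtx k)\<bar> powr r - \<bar>v n (vtx k) - U (vtx k)\<bar> powr r - \<bar>U (vtx k)\<bar> powr r"
  show "(\<lambda>n. vsum r (W n) (v n) - vsum r (W n) (?w n) - vsum r (W n) U) \<longlonglongrightarrow> 0"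
  proof (rule Lim_null_comparison)
    have "(\<integral>k. \<bar>v n (vtx k)\<bar> powr r \<partial>?C) \<le> supb \<mu> K powr ((r - 2) / 2) * supb \<mu> K" for n
    proof -
      have "vsum r UNIV (v n) \<le> supb \<mu> K powr ((r - 2) / 2) * (\<Sum>\<^sub>\<infinity>k. (v n (vtx k))\<^sup>2)"
        by (rule vsum_bound(2)[OF v r vtx_sup[OF S]])
      also have "\<dots> \<le> supb \<mu> K powr ((r - 2) / 2) * supb (mass (v n)) (Dnorm2 \<epsilon> (v n))"
        by (intro mult_left_mono vertex_bound v) auto
      also have "\<dots> \<le> supb \<mu> K powr ((r - 2) / 2) * supb \<mu> K"
        by (intro mult_left_mono supb_mono m K mass_nonneg Dnorm2_nonneg v) auto
      finally show ?thesis using ic(2)[OF v] by simp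
    qed
    moreover have "(\<lambda>n. v n (vtx k)) \<longlonglongrightarrow> U (vtx k)" for k
      unfolding vtx_eq_lift using eps_pos by (intro lim) auto
    ultimately show "(\<lambda>n. \<integral>k. \<bar>?h n k\<bar> \<partial>?C) \<longlonglongrightarrow> 0"
      using r by (intro brezis_lieb(3) ic(1) v) auto
    show "\<forall>\<^sub>F n in sequentially. norm (vsum r (W n) (v n) - vsum r (W n) (?w n) - vsum r (W n) U) \<le> (\<integral>k. \<bar>?h n k\<bar> \<partial>?C)"
    proof (intro always_eventually allI)
      fix n
      have s: "(\<lambda>k. \<bar>z (vtx k)\<bar> powr r) summable_on A" if "z \<in> H1 \<epsilon>" for z A
        by (rule vsum_summable[OF that r])
      have "integrable ?C (\<lambda>k. \<bar>?h n k\<bar>)"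
        using ic(1)[OF v, of n] ic(1)[OF w, of n] ic(1)[OF U] by simp
      then have ab: "(\<lambda>k. \<bar>?h n k\<bar>) summable_on UNIV"
        using count_space_nonneg(1)[of UNIV "\<lambda>k. \<bar>?h n k\<bar>"] by simp
      then have abW: "(\<lambda>k. \<bar>?h n k\<bar>) summable_on W n" by (rule summable_on_subset_banach) auto
      have "vsum r (W n) (v n) - vsum r (W n) (?w n) - vsum r (W n) U = infsum (?h n) (W n)"
        unfolding vsum_def using s[OF v, of n "W n"] s[OF w, of n "W n"] s[OF U, of "W n"]
        by (simp add: infsum_diff_real summable_on_diff_real)
      then have "norm (vsum r (W n) (v n) - vsum r (W n) (?w n) - vsum r (W n) U) \<le> (\<Sum>\<^sub>\<infinity>k\<in>W n. \<bar>?h n k\<bar>)"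
        using norm_infsum_bound[of "?h n" "W n"] abW by simp
      also have "\<dots> \<le> (\<Sum>\<^sub>\<infinity>k. \<bar>?h n k\<bar>)" by (intro infsum_mono2 abW ab) auto
      also have "\<dots> = (\<integral>k. \<bar>?h n k\<bar> \<partial>?C)" using count_space_nonneg(2)[of UNIV "\<lambda>k. \<bar>?h n k\<bar>"] ab by simp
      finally show "norm (vsum r (W n) (v n) - vsum r (W n) (?w n) - vsum r (W n) U) \<le> (\<integral>k. \<bar>?h n k\<bar> \<partial>?C)" .
    qed
  qed
qed

text \<open>An edge has finite length, so a constant serves as majorant. Mass kept on a fixed edge
  thereby survives in the limit and makes it nonzero.\<close>

lemma edge_mass_limit:
  assumes v: "\<And>n. v n \<in> H1 \<epsilon>" and U: "U \<in> H1 \<epsilon>" and m: "\<And>n. mass (v n) \<le> \<mu>" and K: "\<And>n. Dnorm2 \<epsilon> (v n) \<le> K"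
    and lim: "\<And>p. p \<in> space gmeas \<Longrightarrow> (\<lambda>n. lift (v n) p) \<longlonglongrightarrow> lift U p"
  shows "(\<lambda>n. edge_mass (v n) e) \<longlonglongrightarrow> edge_mass U e"
  unfolding edge_mass_def
proof (rule integral_dominated_convergence)
  interpret finite_measure seg by (rule finite_seg)
  show "integrable seg (\<lambda>t. supb \<mu> K)" by simp
  show "AE t in seg. (\<lambda>n. (lift (v n) (e, t))\<^sup>2) \<longlonglongrightarrow> (lift U (e, t))\<^sup>2"
    by (intro AE_I2 tendsto_intros lim) simp
  show "AE t in seg. norm ((lift (v n) (e, t))\<^sup>2) \<le> supb \<mu> K" for n
  proof (rule AE_I2)
    fix t assume "t \<in> space seg"
    then have "(lift (v n) (e, t))\<^sup>2 \<le> supb (mass (v n)) (Dnorm2 \<epsilon> (v n))" by (intro sup_bound v) simp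
    also have "\<dots> \<le> supb \<mu> K" by (intro supb_mono m K mass_nonneg Dnorm2_nonneg v)
    finally show "norm ((lift (v n) (e, t))\<^sup>2) \<le> supb \<mu> K" by simp
  qed
qed (use H1_lift(4)[OF v] H1_lift(4)[OF U] in auto)

end

context nls
begin

lemma energy_split:
  assumes v: "\<And>n. v n \<in> H1 \<epsilon>" and U: "U \<in> H1 \<epsilon>" and m: "\<And>n. mass (v n) \<le> \<mu>" and K: "\<And>n. Dnorm2 \<epsilon> (v n) \<le> K"
    and lim: "\<And>p. p \<in> space gmeas \<Longrightarrow> (\<lambda>n. lift (v n) p) \<longlonglongrightarrow> lift U p"
    and D: "(\<lambda>n. Dnorm2 \<epsilon> (v n) - Dnorm2 \<epsilon> (\<lambda>x. v n x - U x)) \<longlonglongrightarrow> Dnorm2 \<epsilon> U"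
  shows "(\<lambda>n. mass (v n) - mass (\<lambda>x. v n x - U x)) \<longlonglongrightarrow> mass U"
    "(\<lambda>n. En (W n) (v n) - En (W n) (\<lambda>x. v n x - U x) - En (W n) U) \<longlonglongrightarrow> 0"
proof -
  let ?w = "\<lambda>n x. v n x - U x"
  have w: "?w n \<in> H1 \<epsilon>" for n by (rule H1_diff[OF v U])
  have "(\<lambda>n. (Lpow \<epsilon> 2 (v n) - Lpow \<epsilon> 2 (?w n) - Lpow \<epsilon> 2 U) + mass U) \<longlonglongrightarrow> 0 + mass U"
    by (intro tendsto_add tendsto_const Lpow_vsum_splitting(1)[OF v U m K lim]) auto
  then show "(\<lambda>n. mass (v n) - mass (?w n)) \<longlonglongrightarrow> mass U"
    using Lpow2[OF v] Lpow2[OF w] Lpow2[OF U] by simp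
  have "(\<lambda>n. (Dnorm2 \<epsilon> (v n) - Dnorm2 \<epsilon> (?w n)) / 2 - Dnorm2 \<epsilon> U / 2
      - \<alpha> / p * (Lpow \<epsilon> p (v n) - Lpow \<epsilon> p (?w n) - Lpow \<epsilon> p U)
      - \<beta> / q * (vsum q (W n) (v n) - vsum q (W n) (?w n) - vsum q (W n) U))
    \<longlonglongrightarrow> Dnorm2 \<epsilon> U / 2 - Dnorm2 \<epsilon> U / 2 - \<alpha> / p * 0 - \<beta> / q * 0"
    using p q by (intro tendsto_diff tendsto_mult tendsto_divide tendsto_const D Lpow_vsum_splitting[OF v U m K lim]) auto
  moreover have "(Dnorm2 \<epsilon> (v n) - Dnorm2 \<epsilon> (?w n)) / 2 - Dnorm2 \<epsilon> U / 2
      - \<alpha> / p * (Lpow \<epsilon> p (v n) - Lpow \<epsilon> p (?w n) - Lpow \<epsilon> p U)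
      - \<beta> / q * (vsum q (W n) (v n) - vsum q (W n) (?w n) - vsum q (W n) U)
     = En (W n) (v n) - En (W n) (?w n) - En (W n) U" for n
    by (simp add: energy_eq pot_def right_diff_distrib diff_divide_distrib)
  ultimately show "(\<lambda>n. En (W n) (v n) - En (W n) (?w n) - En (W n) U) \<longlonglongrightarrow> 0" by simp
qed

end

section \<open>Periodic vertex sets\<close>

text \<open>Subtracting a suitable multiple of v reduces the scalar product of w with v modulo |v|^2
  and leaves that with the perpendicular vector unchanged. The strip condition bounds the latter, so
  the reduced points lie in a rectangle, which contains finitely many lattice points.\<close>

lemma periodic_representatives:
  assumes "Z_periodic V"
  shows "\<exists>v R. v \<noteq> (0, 0) \<and> finite R \<and> (\<forall>w\<in>V. \<forall>j. (fst w + j * fst v, snd w + j * snd v) \<in> V) \<and>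
    (\<forall>w\<in>V. \<exists>r\<in>R. \<exists>j. w = (fst r + j * fst v, snd r + j * snd v))"
proof -
  obtain v :: "int \<times> int" and P0 :: "real \<times> real" and \<rho> :: real where v: "v \<noteq> (0, 0)"
    and per: "\<And>j::int. V = (\<lambda>w. (fst w + j * fst v, snd w + j * snd v)) ` V"
    and strip: "\<And>w. w \<in> V \<Longrightarrow> \<bar>(of_int (fst w) - fst P0) * (- of_int (snd v)) + (of_int (snd w) - snd P0) * of_int (fst v)\<bar> \<le> \<rho>"
    using assms unfolding Z_periodic_def by blast
  have per': "\<forall>w\<in>V. \<forall>j. (fst w + j * fst v, snd w + j * snd v) \<in> V"
  proof (intro ballI allI)
    fix w j assume "w \<in> V"
    then have "(fst w + j * fst v, snd w + j * snd v) \<in> (\<lambda>w. (fst w + j * fst v, snd w + j * snd v)) ` V" by blast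
    then show "(fst w + j * fst v, snd w + j * snd v) \<in> V" using per[of j] by simp
  qed
  obtain a b where vab: "v = (a, b)" by (cases v)
  define n where "n = a * a + b * b"
  have n: "n > 0" using v by (simp add: n_def vab sum_squares_gt_zero_iff)
  \<comment> \<open>The strip is centred at \<open>P0\<close>; the absolute value absorbs the
    component of \<open>P0\<close> perpendicular to v.\<close>
  define M where "M = \<lceil>\<rho> + \<bar>- fst P0 * of_int b + snd P0 * of_int a\<bar>\<rceil>"
  \<comment> \<open>Coordinates along v and perpendicular to it, without normalization, so that they
    stay integers; the determinant n = |v|^2 is positive, which gives injectivity.\<close>
  define f where "f w = (fst w * a + snd w * b, snd w * a - fst w * b)" for w :: "int \<times> int"
  have inj: "inj f"
  proof (rule injI)
    fix x y :: "int \<times> int" assume "f x = f y"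
    then have 1: "fst x * a + snd x * b = fst y * a + snd y * b" "snd x * a - fst x * b = snd y * a - fst y * b"
      by (auto simp: f_def)
    have "n * fst x = n * fst y" using 1 unfolding n_def by algebra
    moreover have "n * snd x = n * snd y" using 1 unfolding n_def by algebra
    ultimately show "x = y" using n by (simp add: prod_eq_iff)
  qed
  define R where "R = f -` ({0..n} \<times> {-M..M})"
  have "finite R" unfolding R_def by (intro finite_vimageI inj) simp
  moreover have "\<exists>r\<in>R. \<exists>j. w = (fst r + j * fst v, snd r + j * snd v)" if w: "w \<in> V" for w
  proof -
    define j where "j = (fst w * a + snd w * b) div n"
    define r where "r = (fst w - j * a, snd w - j * b)"
    have "fst r * a + snd r * b = (fst w * a + snd w * b) - j * n"
      by (simp add: r_def n_def algebra_simps)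
    also have "\<dots> = (fst w * a + snd w * b) mod n" by (simp add: j_def minus_div_mult_eq_mod)
    finally have "fst r * a + snd r * b \<in> {0..n}" using n by (simp add: less_imp_le)
    moreover have "snd r * a - fst r * b = snd w * a - fst w * b"
      by (simp add: r_def algebra_simps)
    moreover have "snd w * a - fst w * b \<in> {-M..M}"
    proof -
      have "\<bar>real_of_int (snd w * a - fst w * b)\<bar> \<le> \<rho> + \<bar>- fst P0 * of_int b + snd P0 * of_int a\<bar>"
      proof -
        have "real_of_int (snd w * a - fst w * b) =
          ((of_int (fst w) - fst P0) * (- of_int (snd v)) + (of_int (snd w) - snd P0) * of_int (fst v))
          + (- fst P0 * of_int b + snd P0 * of_int a)"
          by (simp add: vab algebra_simps)
        then show ?thesis using strip[OF w] by linarith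
      qed
      then have "\<bar>real_of_int (snd w * a - fst w * b)\<bar> \<le> of_int M" unfolding M_def by linarith
      then have "\<bar>snd w * a - fst w * b\<bar> \<le> M" by linarith
      then show ?thesis by auto
    qed
    ultimately have "r \<in> R" by (simp add: R_def f_def)
    moreover have "w = (fst r + j * fst v, snd r + j * snd v)" by (simp add: r_def vab)
    ultimately show ?thesis by blast
  qed
  ultimately show ?thesis
    using v per' by blast
qed

text \<open>If w0 = w + k with w in V, the representative of w fixes k up to a multiple of v, and
  adding such a multiple does not change the translate.\<close>

lemma translates_through_point:
  assumes "Z_periodic V"
  shows "finite {W. \<exists>k. W = (\<lambda>w. w + k) ` V \<and> w0 \<in> W}"
proof -
  obtain v R where R: "finite R" and per: "\<And>w j. w \<in> V \<Longrightarrow> (fst w + j * fst v, snd w + j * snd v) \<in> V"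
    and rep: "\<And>w. w \<in> V \<Longrightarrow> \<exists>r\<in>R. \<exists>j. w = (fst r + j * fst v, snd r + j * snd v)"
    using periodic_representatives[OF assms] by blast
  have "{W. \<exists>k. W = (\<lambda>w. w + k) ` V \<and> w0 \<in> W} \<subseteq> (\<lambda>r. (\<lambda>w. w + (w0 - r)) ` V) ` R"
  proof
    fix W assume "W \<in> {W. \<exists>k. W = (\<lambda>w. w + k) ` V \<and> w0 \<in> W}"
    then obtain k where W: "W = (\<lambda>w. w + k) ` V" and "w0 \<in> (\<lambda>w. w + k) ` V" by blast
    then obtain w where w: "w \<in> V" "w0 = w + k" by auto
    obtain r j where r: "r \<in> R" "w = (fst r + j * fst v, snd r + j * snd v)" using rep[OF w(1)] by blast
    have "x \<in> (\<lambda>w. w + l) ` V \<longleftrightarrow> x - l \<in> V" for x l by force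
    moreover have "x - k \<in> V \<longleftrightarrow> x - (w0 - r) \<in> V" for x
    proof -
      have "(fst (x - k) + - j * fst v, snd (x - k) + - j * snd v) = x - (w0 - r)"
        "(fst (x - (w0 - r)) + j * fst v, snd (x - (w0 - r)) + j * snd v) = x - k"
        by (simp_all add: prod_eq_iff w(2) r(2) algebra_simps)
      then show ?thesis using per[of "x - k" "- j"] per[of "x - (w0 - r)" j] by metis
    qed
    ultimately have "(\<lambda>w. w + k) ` V = (\<lambda>w. w + (w0 - r)) ` V" by blast
    then show "W \<in> (\<lambda>r. (\<lambda>w. w + (w0 - r)) ` V) ` R" using r(1) W by blast
  qed
  then show ?thesis by (rule finite_subset) (simp add: R)
qed

lemma power_split_less_one:
  fixes x s :: real
  assumes "0 < x" "x < 1" "s > 1"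
  shows "x powr s + (1 - x) powr s < 1"
proof -
  have "y powr s < y" if "0 < y" "y < 1" for y :: real
    using powr_less_mono'[of y 1 s] that assms by simp
  from this[of x] this[of "1 - x"] show ?thesis using assms by simp
qed

section \<open>Minimizing sequences at a negative level\<close>

context nls
begin

abbreviation level :: "(int \<times> int) set \<Rightarrow> real \<Rightarrow> real" where
  "level \<equiv> ground_level \<epsilon> p q \<alpha> \<beta>"

lemma level_bdd: "bdd_below (En V ` H1_mass \<epsilon> \<mu>)"
proof -
  obtain K where K: "\<And>u W. u \<in> H1 \<epsilon> \<Longrightarrow> mass u \<le> \<mu> \<Longrightarrow> pot W u \<le> Dnorm2 \<epsilon> u / 4 + K"
    using coercive[of \<mu>] by blast
  show ?thesis
  proof (rule bdd_belowI2)
    fix u assume "u \<in> H1_mass \<epsilon> \<mu>"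
    then show "- K \<le> En V u" using K[of u V] Dnorm2_nonneg[of u] by (auto simp: H1_mass_iff energy_eq)
  qed
qed

lemma level_le: "u \<in> H1 \<epsilon> \<Longrightarrow> mass u = \<mu> \<Longrightarrow> level V \<mu> \<le> En V u"
  unfolding ground_level_def by (rule cINF_lower[OF level_bdd]) (simp add: H1_mass_iff)

lemma level_less:
  assumes "level V \<mu> < x" "H1_mass \<epsilon> \<mu> \<noteq> {}"
  shows "\<exists>u. u \<in> H1 \<epsilon> \<and> mass u = \<mu> \<and> En V u < x"
proof -
  have "\<exists>y\<in>En V ` H1_mass \<epsilon> \<mu>. y < x"
    using assms by (intro cInf_lessD) (auto simp: ground_level_def)
  then show ?thesis using H1_mass_iff by blast
qed

text \<open>The translate is undone by moving u, which changes neither mass nor kinetic energy; then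
  u is scaled up to mass \<mu>. The level of V alone thus bounds the energies of all its
  translates.\<close>

lemma energy_ge_level:
  assumes u: "u \<in> H1 \<epsilon>" and m: "mass u \<le> \<mu>" and \<mu>: "\<mu> > 0"
  shows "En ((\<lambda>w. w + k) ` V) u \<ge> (mass u / \<mu>) powr \<sigma> * level V \<mu>"
proof (cases "mass u = 0")
  \<comment> \<open>Here the bound is 0, because \<open>0 powr \<sigma>\<close> is 0.\<close>
  case True
  then show ?thesis using pot_zero_mass[OF u True] Dnorm2_nonneg[OF u] by (simp add: energy_eq)
next
  case False
  then have m0: "mass u > 0" using mass_nonneg[of u] by simp
  define \<theta> where "\<theta> = \<mu> / mass u"
  have \<theta>: "\<theta> \<ge> 1" using m m0 by (simp add: \<theta>_def)
  let ?u = "tr k u"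
  have t: "?u \<in> H1 \<epsilon>" "mass ?u = mass u" using H1_tr[OF u] by auto
  have "level V \<mu> \<le> En V (\<lambda>x. sqrt \<theta> * ?u x)"
    using \<theta> m0 t by (intro level_le H1_scale) (auto simp: mass_scale \<theta>_def)
  also have "\<dots> \<le> \<theta> powr \<sigma> * En V ?u - (\<theta> powr \<sigma> - \<theta>) * Dnorm2 \<epsilon> ?u / 2"
    by (rule energy_scale_le[OF t(1) \<theta>])
  also have "\<dots> \<le> \<theta> powr \<sigma> * En V ?u"
  proof -
    have "\<theta> powr 1 \<le> \<theta> powr \<sigma>" using \<theta> \<sigma> by (intro powr_mono) auto
    then show ?thesis using \<theta> Dnorm2_nonneg[OF t(1)] by simp
  qed
  also have "En V ?u = En ((\<lambda>w. w + k) ` V) u" by (rule energy_tr[OF u])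
  finally have "level V \<mu> \<le> \<theta> powr \<sigma> * En ((\<lambda>w. w + k) ` V) u" .
  then have "(mass u / \<mu>) powr \<sigma> * level V \<mu> \<le> (mass u / \<mu>) powr \<sigma> * (\<theta> powr \<sigma> * En ((\<lambda>w. w + k) ` V) u)"
    by (intro mult_left_mono) auto
  also have "\<dots> = ((mass u / \<mu>) * \<theta>) powr \<sigma> * En ((\<lambda>w. w + k) ` V) u"
  proof -
    have "((mass u / \<mu>) * \<theta>) powr \<sigma> = (mass u / \<mu>) powr \<sigma> * \<theta> powr \<sigma>"
      by (rule powr_mult)
    then show ?thesis by (simp only: mult.assoc)
  qed
  also have "(mass u / \<mu>) * \<theta> = 1" using m0 \<mu> by (simp add: \<theta>_def)
  finally show ?thesis by simp
qed

text \<open>Along a sequence of translates of \<open>V\<close> that leaves every finite set the vertex term disappears, which only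
  increases the energy; otherwise one translate occurs infinitely often because \<open>V\<close> is periodic.\<close>

lemma ground_state_of_translates:
  assumes V: "Z_periodic V" and U: "U \<in> H1 \<epsilon>" "mass U = \<mu>"
    and lim: "(\<lambda>n. En ((\<lambda>w. w + k n) ` V) U) \<longlonglongrightarrow> level V \<mu>"
  shows "\<exists>u. is_ground_state \<epsilon> p q \<alpha> \<beta> V \<mu> u"
proof (cases "\<exists>w0. infinite {n. w0 \<in> (\<lambda>w. w + k n) ` V}")
  case True
  then obtain w0 where inf: "infinite {n. w0 \<in> (\<lambda>w. w + k n) ` V}" (is "infinite ?A") by blast
  have "(\<lambda>n. (\<lambda>w. w + k n) ` V) ` ?A \<subseteq> {W. \<exists>k. W = (\<lambda>w. w + k) ` V \<and> w0 \<in> W}" by blast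
  then have "finite ((\<lambda>n. (\<lambda>w. w + k n) ` V) ` ?A)"
    using translates_through_point[OF V, of w0] finite_subset by blast
  then obtain m where m: "m \<in> ?A" "infinite {n\<in>?A. (\<lambda>w. w + k n) ` V = (\<lambda>w. w + k m) ` V}"
    using pigeonhole_infinite[OF inf] by blast
  obtain r where r: "strict_mono (r :: nat \<Rightarrow> nat)" "\<And>n. r n \<in> {n\<in>?A. (\<lambda>w. w + k n) ` V = (\<lambda>w. w + k m) ` V}"
    using infinite_enumerate[OF m(2)] by blast
  have "(\<lambda>n. En ((\<lambda>w. w + k (r n)) ` V) U) \<longlonglongrightarrow> level V \<mu>"
    using LIMSEQ_subseq_LIMSEQ[OF lim r(1)] by (simp add: o_def)
  moreover have "(\<lambda>w. w + k (r n)) ` V = (\<lambda>w. w + k m) ` V" for n using r(2)[of n] by blast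
  ultimately have "En ((\<lambda>w. w + k m) ` V) U = level V \<mu>" by (simp add: LIMSEQ_const_iff)
  then have "En V (tr (k m) U) = level V \<mu>" by (simp add: energy_tr[OF U(1)])
  then have "is_ground_state \<epsilon> p q \<alpha> \<beta> V \<mu> (tr (k m) U)"
    unfolding is_ground_state_def H1_mass_iff using H1_tr(1,2)[OF U(1)] U(2) by simp
  then show ?thesis by blast
next
  case False
  let ?C = "count_space (UNIV :: (int \<times> int) set)"
  let ?a = "\<lambda>w. \<bar>U (vtx w)\<bar> powr q"
  let ?W = "\<lambda>n. (\<lambda>w. w + k n) ` V"
  have s: "?a summable_on A" for A by (rule vsum_summable[OF U(1)]) (use q in simp)
  \<comment> \<open>The values on the whole lattice form a summable majorant, and every single
    vertex lies in only finitely many of the translates.\<close>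
  have "(\<lambda>n. \<integral>w. indicator (?W n) w * ?a w \<partial>?C) \<longlonglongrightarrow> (\<integral>w. 0 \<partial>?C)"
  proof (rule integral_dominated_convergence)
    show "integrable ?C ?a" using s count_space_nonneg(1)[of UNIV ?a] by simp
    show "AE w in ?C. (\<lambda>n. indicator (?W n) w * ?a w) \<longlonglongrightarrow> 0"
    proof (rule AE_I2)
      fix w
      have "finite {n. w \<in> ?W n}" using False by blast
      then obtain N where N: "\<And>n. w \<in> ?W n \<Longrightarrow> n \<le> N" unfolding finite_nat_set_iff_bounded_le by blast
      have "\<forall>\<^sub>F n in sequentially. indicator (?W n) w * ?a w = 0"
        unfolding eventually_sequentially
      proof (intro exI[of _ "Suc N"] allI impI)
        fix n assume "Suc N \<le> n"
        then have "w \<notin> ?W n" using N[of n] by linarith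
        then show "indicator (?W n) w * ?a w = 0" by (metis indicator_simps(2) mult_zero_left)
      qed
      then show "(\<lambda>n. indicator (?W n) w * ?a w) \<longlonglongrightarrow> 0" by (rule tendsto_eventually)
    qed
    show "AE w in ?C. norm (indicator (?W n) w * ?a w) \<le> ?a w" for n
      by (intro AE_I2) (simp add: indicator_def)
  qed auto
  moreover have "(\<integral>w. indicator (?W n) w * ?a w \<partial>?C) = vsum q (?W n) U" for n
  proof -
    have "(\<integral>w. indicator (?W n) w * ?a w \<partial>?C) = (\<Sum>\<^sub>\<infinity>w. indicator (?W n) w * ?a w)"
    proof (rule count_space_nonneg(2))
      show "(\<lambda>w. indicator (?W n) w * ?a w) summable_on UNIV"
        by (rule summable_on_comparison_test[OF s]) (auto simp: indicator_def)
    qed (simp add: indicator_def)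
    also have "\<dots> = vsum q (?W n) U"
      unfolding vsum_def by (rule infsum_cong_neutral) (auto simp: indicator_def)
    finally show ?thesis .
  qed
  ultimately have v0: "(\<lambda>n. vsum q (?W n) U) \<longlonglongrightarrow> 0" by simp
  have "(\<lambda>n. Dnorm2 \<epsilon> U / 2 - (\<alpha> / p * Lpow \<epsilon> p U + \<beta> / q * vsum q (?W n) U)) \<longlonglongrightarrow> Dnorm2 \<epsilon> U / 2 - (\<alpha> / p * Lpow \<epsilon> p U + \<beta> / q * 0)"
    by (intro tendsto_intros v0)
  then have "(\<lambda>n. En (?W n) U) \<longlonglongrightarrow> Dnorm2 \<epsilon> U / 2 - \<alpha> / p * Lpow \<epsilon> p U"
    by (simp add: energy_eq pot_def)
  then have "level V \<mu> = Dnorm2 \<epsilon> U / 2 - \<alpha> / p * Lpow \<epsilon> p U" using lim LIMSEQ_unique by blast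
  moreover have "En V U \<le> Dnorm2 \<epsilon> U / 2 - \<alpha> / p * Lpow \<epsilon> p U"
    using q \<beta> vsum_nonneg[of q V U] by (simp add: energy_eq pot_def)
  \<comment> \<open>The limit without vertex term is the level. It is at least the energy of
    \<open>U\<close> on V, which in turn cannot fall below the level.\<close>
  ultimately have "En V U = level V \<mu>" using level_le[OF U, of V] by linarith
  then show ?thesis unfolding is_ground_state_def H1_mass_iff using U by blast
qed

text \<open>The contrapositive of the vanishing lemma, along a subsequence. Lattice translations
  preserve the orientation of edges, so one of the two orientations is fixed by pigeonhole.\<close>

lemma nonvanishing:
  assumes u: "\<And>n. u n \<in> H1 \<epsilon>" and m: "\<And>n. mass (u n) \<le> \<mu>" and K: "\<And>n. Dnorm2 \<epsilon> (u n) \<le> K"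
    and d: "d > 0" "\<And>n. pot (W n) (u n) \<ge> d"
  obtains \<eta> r k b where "\<eta> > 0" "strict_mono (r :: nat \<Rightarrow> nat)" "\<And>n. edge_mass (u (r n)) (fst (k n), snd (k n), b) > \<eta>"
proof -
  define s where "s n = (SUP e. edge_mass (u n) e)" for n
  have bdd: "bdd_above (range (edge_mass (u n)))" for n
    using mass_sum(3)[OF u] by (intro bdd_aboveI2) auto
  have le: "edge_mass (u n) e \<le> s n" for n e
    unfolding s_def by (rule cSUP_upper[OF _ bdd]) simp
  have s0: "s n \<ge> 0" for n using edge_mass_nonneg le order_trans by blast
  have "\<not> s \<longlonglongrightarrow> 0"
  proof
    assume "s \<longlonglongrightarrow> 0"
    then have "(\<lambda>n. pot (W n) (u n)) \<longlonglongrightarrow> 0" by (rule pot_vanishing[OF u m K le])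
    then have "d \<le> 0" by (rule Lim_bounded2) (use d(2) in blast)
    then show False using d(1) by simp
  qed
  then obtain \<eta> where \<eta>: "\<eta> > 0" "\<And>N. \<exists>n\<ge>N. \<bar>s n\<bar> \<ge> \<eta>"
    unfolding LIMSEQ_iff real_norm_def by (auto simp: not_less)
  have "infinite {n. s n \<ge> \<eta>}"
    unfolding infinite_nat_iff_unbounded_le using \<eta>(2) s0 by auto
  \<comment> \<open>Only \<eta>/2 is claimed: an edge carrying more than that exists whether or not
    the supremum is attained.\<close>
  moreover have "{n. s n \<ge> \<eta>} \<subseteq> (\<Union>b. {n. \<exists>k. edge_mass (u n) (fst k, snd k, b) > \<eta> / 2})"
  proof
    fix n assume "n \<in> {n. s n \<ge> \<eta>}"
    then have "\<eta> / 2 < s n" using \<eta>(1) by simp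
    then obtain e where e: "\<eta> / 2 < edge_mass (u n) e"
      unfolding s_def using less_cSUP_iff[OF _ bdd] by blast
    obtain i j b where "e = (fst (i, j), snd (i, j), b)" by (cases e) simp
    then show "n \<in> (\<Union>b. {n. \<exists>k. edge_mass (u n) (fst k, snd k, b) > \<eta> / 2})" using e by blast
  qed
  ultimately have "infinite (\<Union>b. {n. \<exists>k. edge_mass (u n) (fst k, snd k, b) > \<eta> / 2})"
    using finite_subset by blast
  then obtain b where b: "infinite {n. \<exists>k. edge_mass (u n) (fst k, snd k, b) > \<eta> / 2}"
    by (meson finite_UN finite)
  obtain r where r: "strict_mono (r :: nat \<Rightarrow> nat)" "\<forall>n. r n \<in> {n. \<exists>k. edge_mass (u n) (fst k, snd k, b) > \<eta> / 2}"
    using infinite_enumerate[OF b] by blast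
  have "\<forall>n. \<exists>k. edge_mass (u (r n)) (fst k, snd k, b) > \<eta> / 2" using r(2) unfolding mem_Collect_eq .
  then obtain k where k: "\<And>n. edge_mass (u (r n)) (fst (k n), snd (k n), b) > \<eta> / 2" by metis
  show ?thesis by (rule that[OF _ r(1) k]) (use \<eta>(1) in simp)
qed

theorem ground_state_exists:
  assumes V: "Z_periodic V" and \<mu>: "\<mu> > 0" and ne: "H1_mass \<epsilon> \<mu> \<noteq> {}" and neg: "level V \<mu> < 0"
  shows "\<exists>u. is_ground_state \<epsilon> p q \<alpha> \<beta> V \<mu> u"
proof -
  define c where "c = level V \<mu>"
  have c: "c < 0" using neg by (simp add: c_def)
  \<comment> \<open>The second bound makes the sequence minimizing, the first keeps its potential
    energy above - c / 2 > 0 and so excludes vanishing.\<close>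
  have "\<exists>u. u \<in> H1 \<epsilon> \<and> mass u = \<mu> \<and> En V u < min (c / 2) (c + 1 / real (Suc n))" for n
    by (rule level_less[OF _ ne]) (use c in \<open>simp add: c_def\<close>)
  then obtain a where a: "\<And>n. a n \<in> H1 \<epsilon>" "\<And>n. mass (a n) = \<mu>"
    and aE: "\<And>n. En V (a n) < min (c / 2) (c + 1 / real (Suc n))" by metis
  obtain K0 where K0: "\<And>u W. u \<in> H1 \<epsilon> \<Longrightarrow> mass u \<le> \<mu> \<Longrightarrow> pot W u \<le> Dnorm2 \<epsilon> u / 4 + K0"
    using coercive[of \<mu>] by blast
  \<comment> \<open>Negative energy gives D / 2 < pot, coercivity gives pot \<le> D / 4 + K0;
    together D < 4 K0.\<close>
  define K where "K = 4 * K0"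
  have aD: "Dnorm2 \<epsilon> (a n) \<le> K" for n
  proof -
    have "Dnorm2 \<epsilon> (a n) / 2 - pot V (a n) < 0" using aE[of n] c unfolding energy_eq by linarith
    then show ?thesis using K0[OF a(1)[of n], of V] a(2)[of n] unfolding K_def by linarith
  qed
  have ap: "pot V (a n) \<ge> - c / 2" for n
    using aE[of n] Dnorm2_nonneg[OF a(1), of n] unfolding energy_eq by linarith
  obtain \<eta> s k b where \<eta>: "\<eta> > 0" and s: "strict_mono (s :: nat \<Rightarrow> nat)"
    and em: "\<And>n. edge_mass (a (s n)) (fst (k n), snd (k n), b) > \<eta>"
    by (rule nonvanishing[where u=a and W="\<lambda>_. V" and d="- c / 2" and \<mu>=\<mu> and K=K]) (use a aD ap c in auto)
  define y where "y n = tr (k n) (a (s n))" for n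
  have y: "y n \<in> H1 \<epsilon>" "mass (y n) = \<mu>" "Dnorm2 \<epsilon> (y n) \<le> K" for n
    unfolding y_def using H1_tr(1-3)[OF a(1)] a(2) aD by auto
  \<comment> \<open>Recentring at the edge that keeps mass is paid for by moving V the opposite way;
    the energies remain those of the minimizing sequence.\<close>
  have yE: "En ((\<lambda>w. w + - k n) ` V) (y n) = En V (a (s n))" for n
    unfolding y_def energy_tr[OF a(1)] image_image by simp
  have ye: "edge_mass (y n) (0, 0, b) > \<eta>" for n
    using em[of n] H1_tr(4)[OF a(1), of "k n" "s n" "(0, 0, b)"] by (simp add: y_def eshift_def)
  obtain r U where r: "strict_mono (r :: nat \<Rightarrow> nat)" and U: "U \<in> H1 \<epsilon>"
    and lim: "\<And>p. p \<in> space gmeas \<Longrightarrow> (\<lambda>n. lift (y (r n)) p) \<longlonglongrightarrow> lift U p"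
    and D: "(\<lambda>n. Dnorm2 \<epsilon> (y (r n)) - Dnorm2 \<epsilon> (\<lambda>x. y (r n) x - U x)) \<longlonglongrightarrow> Dnorm2 \<epsilon> U"
    by (rule H1_compact[of y \<mu> K]) (use y in auto)
  define v where "v n = y (r n)" for n
  define w where "w n = (\<lambda>x. v n x - U x)" for n
  define W where "W n = (\<lambda>w. w + - k (r n)) ` V" for n
  have v: "v n \<in> H1 \<epsilon>" "mass (v n) = \<mu>" "Dnorm2 \<epsilon> (v n) \<le> K" for n
    using y by (auto simp: v_def)
  have w: "w n \<in> H1 \<epsilon>" for n unfolding w_def by (rule H1_diff[OF v(1) U])
  note lim' = lim[folded v_def] and D' = D[folded v_def, folded w_def]
  have m1: "(\<lambda>n. mass (v n) - mass (w n)) \<longlonglongrightarrow> mass U"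
    unfolding w_def by (rule energy_split(1)[OF v(1) U _ v(3) lim' D'[unfolded w_def]]) (use v(2) in auto)
  have sp: "(\<lambda>n. En (W n) (v n) - En (W n) (w n) - En (W n) U) \<longlonglongrightarrow> 0"
    unfolding w_def by (rule energy_split(2)[OF v(1) U _ v(3) lim' D'[unfolded w_def]]) (use v(2) in auto)
  have mw: "(\<lambda>n. mass (w n)) \<longlonglongrightarrow> \<mu> - mass U"
    using tendsto_diff[OF tendsto_const[of \<mu>] m1] v(2) by simp
  have mU: "mass U \<le> \<mu>"
  proof -
    have "0 \<le> \<mu> - mass U" by (rule Lim_bounded2[OF mw]) (use mass_nonneg in blast)
    then show ?thesis by simp
  qed
  have "(\<lambda>n. edge_mass (v n) (0, 0, b)) \<longlonglongrightarrow> edge_mass U (0, 0, b)"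
    by (rule edge_mass_limit[OF v(1) U _ v(3) lim']) (use v(2) in auto)
  then have "\<eta> \<le> edge_mass U (0, 0, b)"
    by (rule Lim_bounded2) (use ye in \<open>auto simp: v_def intro: less_imp_le\<close>)
  then have mU0: "mass U > 0" using mass_sum(3)[OF U, of "(0, 0, b)"] \<eta> by linarith
  have Ev: "(\<lambda>n. En (W n) (v n)) \<longlonglongrightarrow> c"
  proof -
    have "En (W n) (v n) = En V (a (s (r n)))" for n unfolding W_def v_def by (rule yE)
    moreover have "(\<lambda>n. En V (a n)) \<longlonglongrightarrow> c"
    proof (rule tendsto_sandwich[OF always_eventually always_eventually tendsto_const])
      show "\<forall>n. c \<le> En V (a n)" using level_le[OF a(1,2)] by (simp add: c_def)
      show "\<forall>n. En V (a n) \<le> c + 1 / real (Suc n)" using aE by (simp add: less_imp_le)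
      show "(\<lambda>n. c + 1 / real (Suc n)) \<longlonglongrightarrow> c"
        using tendsto_add[OF tendsto_const[of c] LIMSEQ_inverse_real_of_nat] by (simp add: inverse_eq_divide)
    qed
    ultimately show ?thesis
      using LIMSEQ_subseq_LIMSEQ[OF _ strict_mono_o[OF s r]] by (simp add: o_def)
  qed
  have EU: "En (W n) U \<ge> (mass U / \<mu>) powr \<sigma> * c" for n
    unfolding W_def c_def by (rule energy_ge_level[OF U mU \<mu>])
  have "mass U = \<mu>"
  proof (rule ccontr)
    assume "mass U \<noteq> \<mu>"
    then have lt: "mass U < \<mu>" using mU by simp
    define x where "x = mass U / \<mu>"
    have x: "0 < x" "x < 1" using mU0 lt \<mu> by (auto simp: x_def)
    \<comment> \<open>Since \<open>U\<close> carries mass, the remainder eventually has less than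
      \<mu>, and the scaled lower bound applies to it as well as to \<open>U\<close>.\<close>
    have "\<forall>\<^sub>F n in sequentially. mass (w n) < \<mu>"
      using mw mU0 by (intro order_tendstoD(2)) auto
    then have ev: "\<forall>\<^sub>F n in sequentially. x powr \<sigma> * c + (mass (w n) / \<mu>) powr \<sigma> * c
        \<le> En (W n) (v n) - (En (W n) (v n) - En (W n) (w n) - En (W n) U)"
    proof eventually_elim
      case (elim n)
      have "En (W n) (w n) \<ge> (mass (w n) / \<mu>) powr \<sigma> * c"
        unfolding W_def c_def by (rule energy_ge_level[OF w _ \<mu>]) (use elim in simp)
      then show ?case using EU[of n] unfolding x_def by linarith
    qed
    have l1: "(\<lambda>n. x powr \<sigma> * c + (mass (w n) / \<mu>) powr \<sigma> * c) \<longlonglongrightarrow> x powr \<sigma> * c + ((\<mu> - mass U) / \<mu>) powr \<sigma> * c"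
      using \<mu> lt \<sigma> by (intro tendsto_intros mw) auto
    have l2: "(\<lambda>n. En (W n) (v n) - (En (W n) (v n) - En (W n) (w n) - En (W n) U)) \<longlonglongrightarrow> c - 0"
      by (intro tendsto_diff[of _ c] Ev sp)
    have "x powr \<sigma> * c + ((\<mu> - mass U) / \<mu>) powr \<sigma> * c \<le> c - 0"
      by (rule tendsto_le[OF _ l2 l1 ev]) simp
    also have "(\<mu> - mass U) / \<mu> = 1 - x" using \<mu> by (simp add: x_def diff_divide_distrib)
    \<comment> \<open>Dividing by the negative c reverses the inequality and contradicts strict
      subadditivity.\<close>
    finally have "(x powr \<sigma> + (1 - x) powr \<sigma>) * c \<le> 1 * c" by (simp add: algebra_simps)
    then show False using power_split_less_one[OF x \<sigma>] c by (simp add: mult_le_cancel_right)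
  qed
  note UM = this
  have Kw: "\<exists>K'. \<forall>n. Dnorm2 \<epsilon> (w n) \<le> K'"
  proof -
    have "Bseq (\<lambda>n. Dnorm2 \<epsilon> (v n) - Dnorm2 \<epsilon> (w n))"
      using D' by (intro convergent_imp_Bseq convergentI)
    then obtain B where B: "\<And>n. \<bar>Dnorm2 \<epsilon> (v n) - Dnorm2 \<epsilon> (w n)\<bar> \<le> B" unfolding Bseq_def real_norm_def by blast
    have "Dnorm2 \<epsilon> (w n) \<le> K + B" for n using B[of n] v(3)[of n] by linarith
    then show ?thesis by blast
  qed
  then obtain K' where K': "\<And>n. Dnorm2 \<epsilon> (w n) \<le> K'" by blast
  have mw0: "(\<lambda>n. mass (w n)) \<longlonglongrightarrow> 0" using mw UM by simp
  then have "Bseq (\<lambda>n. mass (w n))" by (intro convergent_imp_Bseq convergentI)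
  then obtain M where M: "\<And>n. mass (w n) \<le> M" unfolding Bseq_def real_norm_def by (metis abs_le_D1)
  have pw: "(\<lambda>n. pot (W n) (w n)) \<longlonglongrightarrow> 0"
    by (rule pot_vanishing[OF w M K' mass_sum(3)[OF w] mw0])
  have "(\<lambda>n. En (W n) U) \<longlonglongrightarrow> c"
  proof (rule tendsto_sandwich[OF always_eventually always_eventually tendsto_const])
    show "\<forall>n. c \<le> En (W n) U" using EU UM \<mu> by simp
    \<comment> \<open>The right-hand side exceeds the left by exactly the nonnegative kinetic energy
      of the remainder divided by 2. All its terms other than \<open>En (W n) (v n)\<close> vanish
      in the limit.\<close>
    show "\<forall>n. En (W n) U \<le> En (W n) (v n) + pot (W n) (w n) - (En (W n) (v n) - En (W n) (w n) - En (W n) U)"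
      using Dnorm2_nonneg[OF w] by (simp add: energy_eq[of _ "w _"])
    have "(\<lambda>n. En (W n) (v n) + pot (W n) (w n) - (En (W n) (v n) - En (W n) (w n) - En (W n) U)) \<longlonglongrightarrow> c + 0 - 0"
      by (intro tendsto_diff[of _ "c + 0"] tendsto_add Ev pw sp)
    then show "(\<lambda>n. En (W n) (v n) + pot (W n) (w n) - (En (W n) (v n) - En (W n) (w n) - En (W n) U)) \<longlonglongrightarrow> c" by simp
  qed
  then show ?thesis
    unfolding W_def c_def by (rule ground_state_of_translates[OF V U UM])
qed

end

section \<open>Exponential test functions\<close>

lemma has_sum_geometric_int:
  fixes \<rho> :: real
  assumes "0 \<le> \<rho>" "\<rho> < 1"
  shows "((\<lambda>i::int. \<rho> ^ nat \<bar>i\<bar>) has_sum ((1 + \<rho>) / (1 - \<rho>))) UNIV"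
proof -
  have g: "((\<lambda>n. \<rho> ^ n) has_sum (1 / (1 - \<rho>))) UNIV"
    using assms by (intro sums_nonneg_imp_has_sum) (auto intro: geometric_sums)
  have "((\<lambda>i::int. \<rho> ^ nat \<bar>i\<bar>) has_sum (1 / (1 - \<rho>))) (range int)"
    by (subst has_sum_reindex) (use g in \<open>auto simp: o_def\<close>)
  moreover have "((\<lambda>i::int. \<rho> ^ nat \<bar>i\<bar>) has_sum (\<rho> * (1 / (1 - \<rho>)))) (range (\<lambda>n. - int (Suc n)))"
    by (subst has_sum_reindex)
      (use has_sum_cmult_right[OF g, of \<rho>] in \<open>auto simp: o_def inj_def nat_add_distrib\<close>)
  moreover have "range int \<inter> range (\<lambda>n. - int (Suc n)) = {}" by auto
  moreover have "range int \<union> range (\<lambda>n. - int (Suc n)) = UNIV"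
  proof -
    have "x \<in> range int \<union> range (\<lambda>n. - int (Suc n))" for x
      by (cases x rule: int_cases) auto
    then show ?thesis by blast
  qed
  ultimately have "((\<lambda>i::int. \<rho> ^ nat \<bar>i\<bar>) has_sum (1 / (1 - \<rho>) + \<rho> * (1 / (1 - \<rho>)))) UNIV"
    using has_sum_Un_disjoint by metis
  then show ?thesis by (simp add: add_divide_distrib)
qed

text \<open>Edges are indexed by two integers and an orientation; the summand ignores the
  orientation, which accounts for the factor 2.\<close>

lemma has_sum_edges:
  fixes h :: "int \<Rightarrow> real"
  assumes h: "(h has_sum S) UNIV" and nn: "\<And>i. h i \<ge> 0"
  shows "((\<lambda>e::edge. h (fst e) * h (fst (snd e))) has_sum (2 * S * S)) UNIV"
proof -
  have 1: "((\<lambda>x::int \<times> bool. h (fst x)) has_sum (2 * S)) (UNIV \<times> UNIV)"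
  proof (rule has_sum_SigmaI)
    show i: "((\<lambda>b::bool. h (fst (j, b))) has_sum (2 * h j)) UNIV" for j
      by (rule has_sum_finiteI) (auto simp: UNIV_bool)
    show o: "((\<lambda>j. 2 * h j) has_sum (2 * S)) UNIV" by (rule has_sum_cmult_right[OF h])
    show "(\<lambda>x::int \<times> bool. h (fst x)) summable_on (UNIV \<times> UNIV)"
      by (rule summable_on_SigmaI[OF i has_sum_imp_summable[OF o]]) (simp add: nn)
  qed
  have "((\<lambda>e::edge. h (fst e) * h (fst (snd e))) has_sum (2 * S * S)) (UNIV \<times> UNIV)"
  proof (rule has_sum_SigmaI)
    show 2: "((\<lambda>x::int \<times> bool. h (fst (i, x)) * h (fst (snd (i, x)))) has_sum (h i * (2 * S))) UNIV" for i
      using has_sum_cmult_right[OF 1, of "h i"] by simp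
    show 3: "((\<lambda>i. h i * (2 * S)) has_sum (2 * S * S)) UNIV"
      using has_sum_cmult_left[OF h, of "2 * S"] by (simp add: mult_ac)
    show "(\<lambda>e::edge. h (fst e) * h (fst (snd e))) summable_on (UNIV \<times> UNIV)"
      by (rule summable_on_SigmaI[OF 2 has_sum_imp_summable[OF 3]]) (simp add: nn)
  qed
  then show ?thesis by simp
qed

section \<open>Norms of the test functions\<close>

context grid
begin

definition expf :: "nat \<Rightarrow> real \<times> real \<Rightarrow> real" where
  "expf N x = exp (- ((\<bar>fst x\<bar> + \<bar>snd x\<bar>) / (\<epsilon> * N)))"

lemma expf_vtx: "N \<ge> 1 \<Longrightarrow> expf N (vtx k) = exp (- ((\<bar>of_int (fst k)\<bar> + \<bar>of_int (snd k)\<bar>) / N))"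
proof -
  have "(\<epsilon> * a + \<epsilon> * b) / (\<epsilon> * N) = (a + b) / N" for a b :: real
    using eps_pos by (simp flip: distrib_left)
  then show ?thesis using eps_pos by (simp add: expf_def vtx_def abs_mult)
qed

text \<open>On each edge the function is a single exponential of rate 1 / (\<epsilon> N), so its
  squared derivative is a constant times its square. In the mass bound exp 2 accounts for replacing
  a point by the base vertex of its edge, and 18 = 2 * 3 * 3 comes from two orientations and two
  geometric series, each at most 3 N.\<close>

lemma expf_H1:
  assumes N: "N \<ge> 1"
  shows "expf N \<in> H1 \<epsilon>" "Dnorm2 \<epsilon> (expf N) = mass (expf N) / (\<epsilon> * N)\<^sup>2"
    "mass (expf N) \<le> 18 * \<epsilon> * exp 2 * (real N)\<^sup>2"
proof -
  let ?l = "1 / (\<epsilon> * N)"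
  have l: "?l > 0" using eps_pos N by simp
  have cont: "continuous_on (grid_graph \<epsilon>) (expf N)"
    unfolding expf_def[abs_def] using eps_pos N by (intro continuous_intros) auto
  \<comment> \<open>The sign of the running coordinate. It is constant along an edge because
    coordinates change sign only at vertices; an edge with base index -1 ends at 0 and counts as
    negative.\<close>
  define sg :: "edge \<Rightarrow> real" where "sg e = (if (if snd (snd e) then fst (snd e) else fst e) \<ge> 0 then 1 else -1)" for e
  define F where "F e t = exp (- ((sg e * (\<epsilon> * of_int (if snd (snd e) then fst (snd e) else fst e) + t)
      + \<epsilon> * \<bar>of_int (if snd (snd e) then fst e else fst (snd e))\<bar>) * ?l))" for e t
  have ab: "\<bar>\<epsilon> * of_int i + t\<bar> = (if i \<ge> 0 then 1 else -1) * (\<epsilon> * of_int i + t)" if t: "t \<in> {0..\<epsilon>}" for i :: int and t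
  proof (cases "i \<ge> 0")
    case True
    then show ?thesis using t eps_pos by simp
  next
    case False
    then have "\<epsilon> * of_int i \<le> \<epsilon> * (-1)" using eps_pos by (intro mult_left_mono) auto
    then show ?thesis using t False by simp
  qed
  have F: "lift (expf N) (e, t) = F e t" if t: "t \<in> {0..\<epsilon>}" for e t
  proof -
    obtain i j b where e: "e = (i, j, b)" by (cases e)
    show ?thesis using ab[OF t, of i] ab[OF t, of j] eps_pos
      by (cases b) (simp_all add: e lift_def expf_def F_def edge_pt_def sg_def abs_mult add.commute)
  qed
  define g where "g = (\<lambda>p. (- sg (fst p) * ?l) * F (fst p) (snd p))"
  have dF: "(F e has_real_derivative g (e, t)) (at t)" for e t
    unfolding F_def[abs_def] g_def fst_conv snd_conv using eps_pos N by (auto intro!: derivative_eq_intros)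
  have cF: "continuous_on A (F e)" for A e
    unfolding F_def[abs_def] using eps_pos N by (intro continuous_intros) auto
  have g2: "(g p)\<^sup>2 = ?l\<^sup>2 * (lift (expf N) p)\<^sup>2" if "p \<in> space gmeas" for p
  proof -
    have "(sg e)\<^sup>2 = 1" for e by (simp add: sg_def)
    moreover have "lift (expf N) p = F (fst p) (snd p)" using F[of "snd p" "fst p"] that by auto
    ultimately show ?thesis by (simp add: g_def power_mult_distrib power_divide)
  qed
  define \<rho> where "\<rho> = exp (- (2 / real N))"
  have \<rho>: "0 \<le> \<rho>" "\<rho> < 1" using N by (auto simp: \<rho>_def)
  have pt: "(lift (expf N) (e, t))\<^sup>2 \<le> exp 2 * (\<rho> ^ nat \<bar>fst e\<bar> * \<rho> ^ nat \<bar>fst (snd e)\<bar>)" if t: "t \<in> {0..\<epsilon>}" for e t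
  proof -
    obtain i j b where e: "e = (i, j, b)" by (cases e)
    have pw: "\<rho> ^ nat \<bar>k\<bar> = exp (- (2 * \<bar>of_int k\<bar> / N))" for k :: int
    proof -
      have "\<rho> ^ nat \<bar>k\<bar> = exp (real (nat \<bar>k\<bar>) * (- (2 / real N)))" unfolding \<rho>_def by (rule exp_of_nat_mult[symmetric])
      then show ?thesis by (simp add: mult.commute)
    qed
    have "\<bar>\<epsilon> * of_int i\<bar> + \<bar>\<epsilon> * of_int j\<bar> - \<epsilon> \<le> \<bar>fst (edge_pt \<epsilon> e t)\<bar> + \<bar>snd (edge_pt \<epsilon> e t)\<bar>"
      using t by (cases b) (auto simp: e edge_pt_def)
    then have "(\<bar>\<epsilon> * of_int i\<bar> + \<bar>\<epsilon> * of_int j\<bar> - \<epsilon>) / (\<epsilon> * N) \<le> (\<bar>fst (edge_pt \<epsilon> e t)\<bar> + \<bar>snd (edge_pt \<epsilon> e t)\<bar>) / (\<epsilon> * N)"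
      using eps_pos by (intro divide_right_mono) auto
    also have "(\<bar>\<epsilon> * of_int i\<bar> + \<bar>\<epsilon> * of_int j\<bar> - \<epsilon>) / (\<epsilon> * N) = (\<bar>of_int i\<bar> + \<bar>of_int j\<bar> - 1) / N"
    proof -
      have "\<bar>\<epsilon> * of_int i\<bar> + \<bar>\<epsilon> * of_int j\<bar> - \<epsilon> = \<epsilon> * (\<bar>of_int i\<bar> + \<bar>of_int j\<bar> - 1)"
        using eps_pos by (simp add: abs_mult algebra_simps)
      then show ?thesis using eps_pos by simp
    qed
    finally have le: "(\<bar>of_int i\<bar> + \<bar>of_int j\<bar> - 1) / N \<le> (\<bar>fst (edge_pt \<epsilon> e t)\<bar> + \<bar>snd (edge_pt \<epsilon> e t)\<bar>) / (\<epsilon> * N)" .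
    have "(lift (expf N) (e, t))\<^sup>2 = exp (2 * (- ((\<bar>fst (edge_pt \<epsilon> e t)\<bar> + \<bar>snd (edge_pt \<epsilon> e t)\<bar>) / (\<epsilon> * N))))"
      unfolding lift_def expf_def fst_conv snd_conv by (rule exp_double[symmetric])
    also have "\<dots> \<le> exp (2 / N + - (2 * \<bar>of_int i\<bar> / N) + - (2 * \<bar>of_int j\<bar> / N))"
      using le by (simp add: add_divide_distrib diff_divide_distrib)
    also have "\<dots> = exp (2 / N) * (\<rho> ^ nat \<bar>i\<bar> * \<rho> ^ nat \<bar>j\<bar>)" unfolding pw by (simp add: exp_add[symmetric])
    also have "\<dots> \<le> exp 2 * (\<rho> ^ nat \<bar>i\<bar> * \<rho> ^ nat \<bar>j\<bar>)"
    proof (intro mult_right_mono)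
      have "2 / real N \<le> 2" using N by (simp add: divide_le_eq)
      then show "exp (2 / real N) \<le> exp 2" by simp
    qed (use \<rho> in auto)
    finally show ?thesis by (simp add: e)
  qed
  define S where "S = (1 + \<rho>) / (1 - \<rho>)"
  have hs: "((\<lambda>e::edge. \<epsilon> * exp 2 * (\<rho> ^ nat \<bar>fst e\<bar> * \<rho> ^ nat \<bar>fst (snd e)\<bar>)) has_sum (\<epsilon> * exp 2 * (2 * S * S))) UNIV"
    unfolding S_def using \<rho> by (intro has_sum_cmult_right has_sum_edges has_sum_geometric_int) auto
  have ish: "integrable seg (\<lambda>t. (lift (expf N) (e, t))\<^sup>2)" for e
    unfolding integrable_seg by (intro borel_integrable_atLeastAtMost' continuous_intros lift_continuous cont)
  have em: "edge_mass (expf N) e \<le> \<epsilon> * exp 2 * (\<rho> ^ nat \<bar>fst e\<bar> * \<rho> ^ nat \<bar>fst (snd e)\<bar>)" for e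
  proof -
    interpret finite_measure seg by (rule finite_seg)
    have "edge_mass (expf N) e \<le> (\<integral>t. exp 2 * (\<rho> ^ nat \<bar>fst e\<bar> * \<rho> ^ nat \<bar>fst (snd e)\<bar>) \<partial>seg)"
      unfolding edge_mass_def using ish pt by (intro integral_mono) auto
    also have "\<dots> = \<epsilon> * exp 2 * (\<rho> ^ nat \<bar>fst e\<bar> * \<rho> ^ nat \<bar>fst (snd e)\<bar>)"
      by (simp add: measure_seg_space)
    finally show ?thesis .
  qed
  have sm: "edge_mass (expf N) summable_on UNIV"
    by (rule summable_on_comparison_test[OF has_sum_imp_summable[OF hs]]) (use em edge_mass_nonneg in auto)
  have i2: "integrable gmeas (\<lambda>p. (lift (expf N) p)\<^sup>2)"
    using gmeas_nonneg(1)[of "\<lambda>p. (lift (expf N) p)\<^sup>2"] lift_measurable[OF cont] ish sm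
    by (simp add: edge_mass_def[abs_def])
  have gm: "g \<in> borel_measurable gmeas"
  proof (intro gmeas_measurableI seg_measurable_continuous)
    show "continuous_on {0..\<epsilon>} (\<lambda>t. g (e, t))" for e
      unfolding g_def fst_conv snd_conv by (intro continuous_intros cF)
  qed
  have "integrable gmeas (\<lambda>p. (g p)\<^sup>2)"
    using i2 by (subst Bochner_Integration.integrable_cong[OF refl g2]) auto
  moreover have "lift (expf N) (e, x) = lift (expf N) (e, 0) + (LINT t:{0..x}|lborel. g (e, t))" if x: "x \<in> {0..\<epsilon>}" for e x
  proof -
    have "(\<integral>t. g (e, t) * indicator {0..x} t \<partial>lborel) = F e x - F e 0"
    proof (rule integral_FTC_Icc_real)
      show "isCont (\<lambda>t. g (e, t)) t" for t
        unfolding g_def F_def fst_conv snd_conv using eps_pos N by (intro continuous_intros) auto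
    qed (use x dF in auto)
    then show ?thesis using F[OF x, of e] F[of 0 e] eps_pos
      by (simp add: set_lebesgue_integral_def mult.commute)
  qed
  ultimately have w: "wd (expf N) g" using gm unfolding wd_def by blast
  show H: "expf N \<in> H1 \<epsilon>" using cont i2 w H1_iff by blast
  have "Dnorm2 \<epsilon> (expf N) = (\<integral>p. ?l\<^sup>2 * (lift (expf N) p)\<^sup>2 \<partial>gmeas)"
    unfolding Dnorm2_eq[OF w] by (rule Bochner_Integration.integral_cong[OF refl g2])
  then show "Dnorm2 \<epsilon> (expf N) = mass (expf N) / (\<epsilon> * N)\<^sup>2"
    by (simp add: mass_def power_divide)
  have "mass (expf N) \<le> \<epsilon> * exp 2 * (2 * S * S)"
    unfolding mass_sum(2)[OF H, symmetric] infsumI[OF hs, symmetric]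
    by (intro infsum_mono sm has_sum_imp_summable[OF hs] em)
  also have "\<dots> = \<epsilon> * exp 2 * 2 * (S * S)" by simp
  also have "\<dots> \<le> \<epsilon> * exp 2 * 2 * ((3 * real N) * (3 * real N))"
  proof -
    \<comment> \<open>From exp x \<ge> 1 + x follows \<rho> \<le> N / (N + 2), hence S \<le> N +
      2.\<close>
    have "S \<le> 3 * N"
    proof -
      have "exp (2 / N) \<ge> 1 + 2 / N" by (rule exp_ge_add_one_self)
      then have "\<rho> \<le> 1 / (1 + 2 / N)"
        unfolding \<rho>_def exp_minus inverse_eq_divide by (intro divide_left_mono) (auto intro!: mult_pos_pos add_pos_nonneg)
      also have "1 / (1 + 2 / N) = N / (N + 2)" using N by (simp add: field_simps)
      finally have "\<rho> * (N + 2) \<le> N" by (simp add: pos_le_divide_eq)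
      then have "(1 + \<rho>) \<le> (N + 2) * (1 - \<rho>)" using \<rho> by (simp add: algebra_simps)
      then have "S \<le> N + 2" unfolding S_def using \<rho> by (simp add: pos_divide_le_eq)
      then show ?thesis using N by linarith
    qed
    moreover have "S \<ge> 0" unfolding S_def using \<rho> by simp
    ultimately show ?thesis using eps_pos by (intro mult_left_mono mult_mono) auto
  qed
  finally show "mass (expf N) \<le> 18 * \<epsilon> * exp 2 * (real N)\<^sup>2" by (simp add: power2_eq_square)
qed

text \<open>The N^2 horizontal edges based in the square of side N at the origin lie within
  l1-distance 2 \<epsilon> N of it, where the function is at least exp (-2).\<close>

lemma expf_lower:
  assumes N: "N \<ge> 1" and r: "r \<ge> 2"
  shows "Lpow \<epsilon> r (expf N) \<ge> (real N)\<^sup>2 * (\<epsilon> * exp (- 2 * r))"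
proof -
  note H = expf_H1(1)[OF N]
  interpret finite_measure seg by (rule finite_seg)
  let ?f = "\<lambda>e. \<integral>t. \<bar>lift (expf N) (e, t)\<bar> powr r \<partial>seg"
  have m: "(\<lambda>p. \<bar>lift (expf N) p\<bar> powr r) \<in> borel_measurable gmeas" using Lpow_eq(1)[OF H r] by auto
  note gn = gmeas_nonneg[OF m]
  have s: "?f summable_on UNIV" and i: "\<And>e. integrable seg (\<lambda>t. \<bar>lift (expf N) (e, t)\<bar> powr r)"
    using gn(1) Lpow_eq(1)[OF H r] by (metis powr_ge_zero)+
  have L: "Lpow \<epsilon> r (expf N) = infsum ?f UNIV"
    using gn(2) Lpow_eq[OF H r] by simp
  define A where "A = (\<lambda>(i, j). (int i, int j, False)) ` ({..<N} \<times> {..<N})"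
  have "real (card A) * (\<epsilon> * exp (- 2 * r)) \<le> sum ?f A"
  proof (rule sum_bounded_below)
    fix e assume "e \<in> A"
    then obtain i j where ij: "i < N" "j < N" "e = (int i, int j, False)" by (auto simp: A_def)
    have "(\<integral>t. exp (- 2 * r) \<partial>seg) \<le> ?f e"
    proof (rule integral_mono[OF _ i])
      fix t assume t: "t \<in> space seg"
      have "\<bar>\<epsilon> * real i + t\<bar> + \<bar>\<epsilon> * real j\<bar> \<le> \<epsilon> * N + \<epsilon> * N"
      proof -
        have "\<epsilon> * real i + \<epsilon> * 1 \<le> \<epsilon> * N" using ij(1) eps_pos unfolding distrib_left[symmetric] by (intro mult_left_mono) auto
        moreover have "\<epsilon> * real j \<le> \<epsilon> * N" using ij(2) eps_pos by (intro mult_left_mono) auto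
        moreover have "0 \<le> \<epsilon> * real i" "0 \<le> \<epsilon> * real j" using eps_pos by auto
        ultimately show ?thesis using t by simp
      qed
      then have "(\<bar>\<epsilon> * real i + t\<bar> + \<bar>\<epsilon> * real j\<bar>) / (\<epsilon> * N) \<le> 2"
        using eps_pos N by (simp add: pos_divide_le_eq)
      then have "exp (-2) \<le> lift (expf N) (e, t)"
        by (simp add: lift_def expf_def ij(3) edge_pt_def)
      then have "exp (-2) powr r \<le> \<bar>lift (expf N) (e, t)\<bar> powr r"
        using r by (intro powr_mono2) auto
      then show "exp (- 2 * r) \<le> \<bar>lift (expf N) (e, t)\<bar> powr r"
        by (simp add: exp_powr_real)
    qed simp
    then show "\<epsilon> * exp (- 2 * r) \<le> ?f e" by (simp add: measure_seg_space)
  qed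
  also have "card A = N * N"
    unfolding A_def by (subst card_image) (auto simp: inj_on_def card_cartesian_product)
  also have "sum ?f A \<le> infsum ?f UNIV"
    by (rule finite_sum_le_infsum[OF s]) (auto simp: A_def)
  finally show ?thesis by (simp add: L power2_eq_square)
qed

end

section \<open>Negativity of the level by test functions\<close>

context nls
begin

text \<open>Normalizing a profile whose mass is at most of order N^2 forces an amplitude c at least
  of order 1/N.\<close>

lemma test_function:
  assumes \<mu>: "\<mu> > 0" and N: "N \<ge> 1"
  obtains u c where "u \<in> H1 \<epsilon>" "mass u = \<mu>" "Dnorm2 \<epsilon> u = \<mu> / (\<epsilon> * N)\<^sup>2" "u = (\<lambda>x. c * expf N x)"
    "c > 0" "c\<^sup>2 \<ge> \<mu> / (18 * \<epsilon> * exp 2) / (real N)\<^sup>2"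
proof -
  let ?m = "mass (expf N)"
  have m: "?m > 0"
  proof -
    have "?m = Lpow \<epsilon> 2 (expf N)" using Lpow2[OF expf_H1(1)[OF N]] by simp
    also have "\<dots> \<ge> (real N)\<^sup>2 * (\<epsilon> * exp (- 2 * 2))" by (rule expf_lower[OF N]) simp
    finally show ?thesis using N eps_pos by (smt (verit) exp_gt_zero mult_pos_pos of_nat_1 of_nat_mono zero_less_power)
  qed
  define c where "c = sqrt (\<mu> / ?m)"
  have c: "c > 0" "c\<^sup>2 = \<mu> / ?m" using m \<mu> by (auto simp: c_def)
  show ?thesis
  proof (rule that[of "\<lambda>x. c * expf N x" c])
    show "(\<lambda>x. c * expf N x) \<in> H1 \<epsilon>" by (rule H1_scale[OF expf_H1(1)[OF N]])
    show "mass (\<lambda>x. c * expf N x) = \<mu>" using c m by (simp add: mass_scale)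
    show "Dnorm2 \<epsilon> (\<lambda>x. c * expf N x) = \<mu> / (\<epsilon> * N)\<^sup>2"
      using c m by (simp add: Dnorm2_scale[OF expf_H1(1)[OF N]] expf_H1(2)[OF N])
    have "\<mu> / (18 * \<epsilon> * exp 2 * (real N)\<^sup>2) \<le> \<mu> / ?m"
      using \<mu> m expf_H1(3)[OF N] by (intro divide_left_mono) (auto intro!: mult_pos_pos simp: less_le_trans[OF m])
    then show "\<mu> / (18 * \<epsilon> * exp 2) / (real N)\<^sup>2 \<le> c\<^sup>2" by (simp add: c(2) divide_divide_eq_left)
  qed (use c in auto)
qed

lemma H1_mass_nonempty: "\<mu> > 0 \<Longrightarrow> H1_mass \<epsilon> \<mu> \<noteq> {}"
  using test_function[of \<mu> 1] H1_mass_iff by (metis empty_iff le_refl)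

lemma powr_of_square_ge:
  fixes c a n r :: real
  assumes "c > 0" "a > 0" "n > 0" "c\<^sup>2 \<ge> a / n\<^sup>2" "r > 0"
  shows "c powr r \<ge> a powr (r/2) * n powr (- r)"
proof -
  have "(a / n\<^sup>2) powr (r/2) \<le> (c\<^sup>2) powr (r/2)" using assms by (intro powr_mono2) auto
  also have "(c\<^sup>2) powr (r/2) = c powr r" using assms powr_powr[of c 2 "r/2"] by simp
  also have "(a / n\<^sup>2) powr (r/2) = a powr (r/2) / n powr r"
    using assms powr_powr[of n 2 "r/2"] by (simp add: powr_divide)
  finally show ?thesis by (simp only: powr_minus divide_inverse)
qed

lemma level_nonpos:
  assumes "\<mu> > 0"
  shows "level V \<mu> \<le> 0"
proof -
  have "level V \<mu> \<le> \<mu> / (2 * \<epsilon>\<^sup>2) * (1 / real (Suc n))" for n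
  proof -
    obtain u c where u: "u \<in> H1 \<epsilon>" "mass u = \<mu>" "Dnorm2 \<epsilon> u = \<mu> / (\<epsilon> * real (Suc n))\<^sup>2"
      by (rule test_function[OF assms, of "Suc n"]) auto
    have "level V \<mu> \<le> En V u" by (rule level_le[OF u(1,2)])
    also have "\<dots> \<le> \<mu> / (2 * \<epsilon>\<^sup>2) * (1 / (real (Suc n))\<^sup>2)"
      using pot_nonneg[OF u(1), of V] by (simp add: energy_eq u(3) power_mult_distrib)
    also have "\<dots> \<le> \<mu> / (2 * \<epsilon>\<^sup>2) * (1 / real (Suc n))"
      using assms by (intro mult_left_mono divide_left_mono) (auto simp: power2_eq_square)
    finally show ?thesis .
  qed
  moreover have "(\<lambda>n. \<mu> / (2 * \<epsilon>\<^sup>2) * (1 / real (Suc n))) \<longlonglongrightarrow> \<mu> / (2 * \<epsilon>\<^sup>2) * 0"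
    using LIMSEQ_inverse_real_of_nat by (intro tendsto_intros) (simp add: inverse_eq_divide)
  ultimately have "level V \<mu> \<le> \<mu> / (2 * \<epsilon>\<^sup>2) * 0" using Lim_bounded2 by blast
  then show ?thesis by simp
qed

text \<open>The kinetic energy decays like N^-2, so a potential energy of at least B N^(-s) with s <
  2 wins for large N.\<close>

lemma level_neg_criterion:
  assumes \<mu>: "\<mu> > 0" and B: "B > 0" and s: "s < 2"
    and pot: "\<And>N u c. N \<ge> 1 \<Longrightarrow> u \<in> H1 \<epsilon> \<Longrightarrow> u = (\<lambda>x. c * expf N x) \<Longrightarrow> c > 0 \<Longrightarrow>
      c\<^sup>2 \<ge> \<mu> / (18 * \<epsilon> * exp 2) / (real N)\<^sup>2 \<Longrightarrow> pot V u \<ge> B * real N powr (- s)"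
  shows "level V \<mu> < 0"
proof -
  have "filterlim (\<lambda>n. real n powr (2 - s)) at_top sequentially"
    using s by (intro filterlim_compose[OF _ filterlim_real_sequentially]) real_asymp
  then have "eventually (\<lambda>n. real n powr (2 - s) > \<mu> / (2 * \<epsilon>\<^sup>2) / B) sequentially"
    by (simp add: filterlim_at_top_dense)
  then obtain N where N: "N \<ge> 1" "real N powr (2 - s) > \<mu> / (2 * \<epsilon>\<^sup>2) / B"
    unfolding eventually_sequentially by (metis le_add1 le_add2)
  obtain u c where u: "u \<in> H1 \<epsilon>" "mass u = \<mu>" "Dnorm2 \<epsilon> u = \<mu> / (\<epsilon> * N)\<^sup>2" "u = (\<lambda>x. c * expf N x)"
    "c > 0" "c\<^sup>2 \<ge> \<mu> / (18 * \<epsilon> * exp 2) / (real N)\<^sup>2"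
    by (rule test_function[OF \<mu> N(1)])
  have "level V \<mu> \<le> En V u" by (rule level_le[OF u(1,2)])
  also have "\<dots> \<le> \<mu> / (2 * \<epsilon>\<^sup>2) / (real N)\<^sup>2 - B * real N powr (- s)"
    using pot[OF N(1) u(1,4,5,6)] by (simp add: energy_eq u(3) power_mult_distrib)
  also have "\<dots> < 0"
  proof -
    have "\<mu> / (2 * \<epsilon>\<^sup>2) < B * real N powr (2 - s)" using N(2) unfolding pos_divide_less_eq[OF B] by (simp only: mult.commute)
    also have "\<dots> = B * real N powr (- s) * (real N)\<^sup>2" using N(1) powr_add[of "real N" "- s" 2] by simp
    finally have "\<mu> / (2 * \<epsilon>\<^sup>2) < B * real N powr (- s) * (real N)\<^sup>2" .
    moreover have "(real N)\<^sup>2 > 0" using N(1) by simp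
    ultimately have "\<mu> / (2 * \<epsilon>\<^sup>2) / (real N)\<^sup>2 < B * real N powr (- s)"
      using pos_divide_less_eq by blast
    then show ?thesis by simp
  qed
  finally show ?thesis .
qed

text \<open>Amplitude 1/N on N^2 edges gives order N^(2-p), that is s = p - 2, which is below 2 for
  p < 4.\<close>

lemma level_neg_p:
  assumes \<mu>: "\<mu> > 0" and p4: "p < 4"
  shows "level V \<mu> < 0"
proof -
  let ?a = "\<mu> / (18 * \<epsilon> * exp 2)"
  have a: "?a > 0" using \<mu> eps_pos by simp
  show ?thesis
  proof (rule level_neg_criterion[OF \<mu>, of "\<alpha> / p * (?a powr (p/2) * (\<epsilon> * exp (- 2 * p)))" "p - 2"])
    fix N :: nat and u c assume N: "N \<ge> 1" and u: "u \<in> H1 \<epsilon>" "u = (\<lambda>x. c * expf N x)" and c: "c > 0" "c\<^sup>2 \<ge> ?a / (real N)\<^sup>2"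
    have "?a powr (p/2) * real N powr (- p) * ((real N)\<^sup>2 * (\<epsilon> * exp (- 2 * p))) \<le> c powr p * Lpow \<epsilon> p (expf N)"
      using p eps_pos c a N by (intro mult_mono powr_of_square_ge expf_lower) auto
    also have "\<dots> = Lpow \<epsilon> p u"
      using p c by (simp add: u(2) Lpow_scale[OF expf_H1(1)[OF N]])
    finally have 1: "?a powr (p/2) * real N powr (- p) * ((real N)\<^sup>2 * (\<epsilon> * exp (- 2 * p))) \<le> Lpow \<epsilon> p u" .
    have e: "real N powr (- p) * (real N)\<^sup>2 = real N powr (- (p - 2))"
      using N powr_add[of "real N" "- p" 2] by simp
    have 2: "?a powr (p/2) * real N powr (- p) * ((real N)\<^sup>2 * (\<epsilon> * exp (- 2 * p)))
       = ?a powr (p/2) * (\<epsilon> * exp (- 2 * p)) * real N powr (- (p - 2))"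
      unfolding e[symmetric] by (simp only: mult_ac)
    have "?a powr (p/2) * (\<epsilon> * exp (- 2 * p)) * real N powr (- (p - 2)) \<le> Lpow \<epsilon> p u"
      using 1 unfolding 2 .
    then have "\<alpha> / p * (?a powr (p/2) * (\<epsilon> * exp (- 2 * p)) * real N powr (- (p - 2))) \<le> \<alpha> / p * Lpow \<epsilon> p u"
      using \<alpha> p by (intro mult_left_mono) auto
    then show "\<alpha> / p * (?a powr (p/2) * (\<epsilon> * exp (- 2 * p))) * real N powr (- (p - 2)) \<le> pot V u"
      using \<beta> q vsum_nonneg[of q V u] unfolding pot_def mult.assoc by (smt (verit) divide_nonneg_nonneg mult_nonneg_nonneg)
  qed (use p4 p \<alpha> \<mu> eps_pos in \<open>auto intro!: divide_pos_pos mult_pos_pos\<close>)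
qed

text \<open>A single orbit w + j v inside V meets the bulk of the profile in at least N vertices, of
  order N^(1-q) in total. Hence s = q - 1, below 2 for q < 3.\<close>

lemma level_neg_q:
  assumes \<mu>: "\<mu> > 0" and q3: "q < 3" and V: "Z_periodic V" "V \<noteq> {}"
  shows "level V \<mu> < 0"
proof -
  let ?a = "\<mu> / (18 * \<epsilon> * exp 2)"
  have a: "?a > 0" using \<mu> eps_pos by simp
  obtain v where v: "v \<noteq> (0, 0)" and per: "\<And>w j. w \<in> V \<Longrightarrow> (fst w + j * fst v, snd w + j * snd v) \<in> V"
    using periodic_representatives[OF V(1)] by blast
  obtain w where w: "w \<in> V" using V(2) by blast
  \<comment> \<open>For j < N the point w + j v has l1-norm at most N M, so the profile is at least
    exp (-M) there, independently of N.\<close>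
  define M :: real where "M = of_int (\<bar>fst w\<bar> + \<bar>snd w\<bar> + \<bar>fst v\<bar> + \<bar>snd v\<bar>)"
  show ?thesis
  proof (rule level_neg_criterion[OF \<mu>, of "\<beta> / q * (?a powr (q/2) * exp (- M * q))" "q - 1"])
    fix N :: nat and u c assume N: "N \<ge> 1" and u: "u \<in> H1 \<epsilon>" "u = (\<lambda>x. c * expf N x)" and c: "c > 0" "c\<^sup>2 \<ge> ?a / (real N)\<^sup>2"
    define f where "f j = (fst w + int j * fst v, snd w + int j * snd v)" for j :: nat
    have inj: "inj f" using v by (cases v) (auto simp: inj_def f_def)
    have fV: "f ` {..<N} \<subseteq> V" using per[OF w] by (auto simp: f_def)
    have sV: "(\<lambda>k. \<bar>expf N (vtx k)\<bar> powr q) summable_on V" by (rule vsum_summable[OF expf_H1(1)[OF N]]) (use q in simp)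
    have "real (card (f ` {..<N})) * exp (- M * q) \<le> (\<Sum>k\<in>f ` {..<N}. \<bar>expf N (vtx k)\<bar> powr q)"
    proof (rule sum_bounded_below)
      fix k assume "k \<in> f ` {..<N}"
      then obtain j where j: "j < N" "k = f j" by auto
      have t: "\<bar>real_of_int (x + int j * y)\<bar> \<le> real N * (\<bar>of_int x\<bar> + \<bar>of_int y\<bar>)" for x y :: int
      proof -
        have "\<bar>real_of_int (x + int j * y)\<bar> \<le> 1 * \<bar>of_int x\<bar> + real j * \<bar>of_int y\<bar>"
          using abs_triangle_ineq[of "real_of_int x" "real j * of_int y"] by (simp add: abs_mult)
        also have "\<dots> \<le> real N * \<bar>of_int x\<bar> + real N * \<bar>of_int y\<bar>" using j N by (intro add_mono mult_right_mono) auto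
        finally show ?thesis by (simp add: distrib_left)
      qed
      have "\<bar>real_of_int (fst k)\<bar> + \<bar>real_of_int (snd k)\<bar> \<le> N * M"
        using t[of "fst w" "fst v"] t[of "snd w" "snd v"] by (simp add: j(2) f_def M_def distrib_left)
      then have "(\<bar>real_of_int (fst k)\<bar> + \<bar>real_of_int (snd k)\<bar>) / N \<le> M"
        using N by (simp add: pos_divide_le_eq mult.commute)
      then have "exp (- M) \<le> expf N (vtx k)" by (simp add: expf_vtx[OF N])
      then have "exp (- M) powr q \<le> \<bar>expf N (vtx k)\<bar> powr q" using q by (intro powr_mono2) auto
      then show "exp (- M * q) \<le> \<bar>expf N (vtx k)\<bar> powr q" by (simp add: exp_powr_real)
    qed
    also have "card (f ` {..<N}) = N" using inj by (simp add: card_image inj_on_subset)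
    also have "(\<Sum>k\<in>f ` {..<N}. \<bar>expf N (vtx k)\<bar> powr q) \<le> vsum q V (expf N)"
      unfolding vsum_def by (rule finite_sum_le_infsum[OF sV _ fV]) auto
    finally have vs: "N * exp (- M * q) \<le> vsum q V (expf N)" .
    have "?a powr (q/2) * real N powr (- q) * (N * exp (- M * q)) \<le> c powr q * vsum q V (expf N)"
      using q c a N vs by (intro mult_mono powr_of_square_ge) auto
    also have "\<dots> = vsum q V u" using c by (simp add: u(2) vsum_scale)
    finally have 1: "?a powr (q/2) * real N powr (- q) * (N * exp (- M * q)) \<le> vsum q V u" .
    have e: "real N powr (- q) * real N = real N powr (- (q - 1))"
      using N powr_add[of "real N" "- q" 1] by simp
    then have 2: "?a powr (q/2) * real N powr (- q) * (N * exp (- M * q))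
       = ?a powr (q/2) * exp (- M * q) * real N powr (- (q - 1))"
      unfolding e[symmetric] by (simp only: mult_ac)
    have "\<beta> / q * (?a powr (q/2) * exp (- M * q) * real N powr (- (q - 1))) \<le> \<beta> / q * vsum q V u"
      using \<beta> q 1 unfolding 2 by (intro mult_left_mono) auto
    then show "\<beta> / q * (?a powr (q/2) * exp (- M * q)) * real N powr (- (q - 1)) \<le> pot V u"
      using \<alpha> p Lpow_nonneg[OF u(1), of p] unfolding pot_def mult.assoc by (smt (verit) divide_nonneg_nonneg mult_nonneg_nonneg)
  qed (use q3 q \<beta> \<mu> eps_pos in \<open>auto intro!: divide_pos_pos mult_pos_pos\<close>)
qed

end

section \<open>Lattice inequalities\<close>

lemma Cauchy_Schwarz_infsum:
  fixes x y :: "'a \<Rightarrow> real"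
  assumes "(\<lambda>k. (x k)\<^sup>2) summable_on UNIV" "(\<lambda>k. (y k)\<^sup>2) summable_on UNIV"
  shows "(\<lambda>k. \<bar>x k * y k\<bar>) summable_on UNIV"
    "(\<Sum>\<^sub>\<infinity>k. \<bar>x k * y k\<bar>) \<le> sqrt (\<Sum>\<^sub>\<infinity>k. (x k)\<^sup>2) * sqrt (\<Sum>\<^sub>\<infinity>k. (y k)\<^sup>2)"
proof -
  let ?C = "count_space (UNIV :: 'a set)"
  have i: "integrable ?C (\<lambda>k. (x k)\<^sup>2)" "integrable ?C (\<lambda>k. (y k)\<^sup>2)"
    using assms count_space_nonneg(1)[of UNIV "\<lambda>k. (x k)\<^sup>2"] count_space_nonneg(1)[of UNIV "\<lambda>k. (y k)\<^sup>2"] by auto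
  have "integrable ?C (\<lambda>k. \<bar>x k * y k\<bar>)" using integrable_mult_L2[OF _ _ i] by auto
  then show s: "(\<lambda>k. \<bar>x k * y k\<bar>) summable_on UNIV"
    using count_space_nonneg(1)[of UNIV "\<lambda>k. \<bar>x k * y k\<bar>"] by simp
  show "(\<Sum>\<^sub>\<infinity>k. \<bar>x k * y k\<bar>) \<le> sqrt (\<Sum>\<^sub>\<infinity>k. (x k)\<^sup>2) * sqrt (\<Sum>\<^sub>\<infinity>k. (y k)\<^sup>2)"
    using Cauchy_Schwarz_integral_sqrt(1)[OF _ _ i] count_space_nonneg(2)[of UNIV "\<lambda>k. \<bar>x k * y k\<bar>"] s
      count_space_nonneg(2)[of UNIV "\<lambda>k. (x k)\<^sup>2"] count_space_nonneg(2)[of UNIV "\<lambda>k. (y k)\<^sup>2"] assms by simp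
qed

text \<open>Only the vertical step is defined. Horizontal differences are vertical ones of the
  swapped array, so every column lemma also serves rows.\<close>

definition up :: "int \<times> int \<Rightarrow> int \<times> int" where
  "up k = (fst k, snd k + 1)"

lemma bij_up: "bij up"
  by (rule bij_betw_byWitness[where f'="\<lambda>k. (fst k, snd k - 1)"]) (auto simp: up_def)

lemma summable_up:
  fixes f :: "int \<times> int \<Rightarrow> real"
  assumes "f summable_on UNIV"
  shows "(\<lambda>k. f (up k)) summable_on UNIV" "(\<Sum>\<^sub>\<infinity>k. f (up k)) = infsum f UNIV"
  using summable_on_reindex_bij_betw[OF bij_up, of f] infsum_reindex_bij_betw[OF bij_up, of f] assms by auto

text \<open>A summable function tends to 0 going up its column, so each value is at most the total
  variation along that column. \<open>Q\<close> is this variation as a function of the column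
  alone.\<close>

lemma column_bound:
  fixes f :: "int \<times> int \<Rightarrow> real"
  assumes nn: "\<And>k. f k \<ge> 0" and f: "f summable_on UNIV"
  shows "\<exists>Q. (\<forall>i. Q i \<ge> 0) \<and> Q summable_on UNIV \<and> infsum Q UNIV = (\<Sum>\<^sub>\<infinity>k. \<bar>f (up k) - f k\<bar>) \<and> (\<forall>k. f k \<le> Q (fst k))"
proof -
  define h where "h k = \<bar>f (up k) - f k\<bar>" for k
  have h: "h summable_on UNIV"
  proof (rule summable_on_comparison_test)
    show "(\<lambda>k. f (up k) + f k) summable_on UNIV" by (intro summable_on_add summable_up(1) f)
    show "h k \<le> f (up k) + f k" for k using nn[of k] nn[of "up k"] by (simp add: h_def)
  qed (simp add: h_def)
  define Q where "Q i = (\<Sum>\<^sub>\<infinity>j. h (i, j))" for i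
  have h': "(\<lambda>(i, j). h (i, j)) summable_on UNIV \<times> UNIV" using h by simp
  have Q: "Q summable_on UNIV" "infsum Q UNIV = infsum h UNIV"
    unfolding Q_def[abs_def] using summable_on_Sigma_banach[OF h'] infsum_Sigma'_banach[OF h'] by auto
  have hi: "(\<lambda>j. h (i, j)) summable_on UNIV" for i
    using summable_on_SigmaD1[OF h', of i] by simp
  have "f (i, j) \<le> Q i" for i j
  proof -
    \<comment> \<open>Telescoping over n steps upwards; as n grows the end value disappears by
      summability.\<close>
    have step: "f (i, j) \<le> f (i, j + int n) + (\<Sum>l<n. h (i, j + int l))" for n
    proof (induction n)
      case (Suc n)
      have "f (i, j + int n) \<le> f (i, j + int (Suc n)) + h (i, j + int n)"
        by (simp add: h_def up_def algebra_simps)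
      then show ?case using Suc by simp
    qed simp
    have inj: "inj (\<lambda>l::nat. j + int l)" by (simp add: inj_def)
    have "(\<Sum>l<n. h (i, j + int l)) \<le> Q i" for n
    proof -
      have "(\<Sum>l<n. h (i, j + int l)) = (\<Sum>z\<in>(\<lambda>l. j + int l) ` {..<n}. h (i, z))"
        by (subst sum.reindex) (auto simp: inj_on_def)
      also have "\<dots> \<le> Q i" unfolding Q_def by (rule finite_sum_le_infsum[OF hi]) (auto simp: h_def)
      finally show ?thesis .
    qed
    then have le: "f (i, j) - Q i \<le> f (i, j + int n)" for n using step[of n] by (smt (verit))
    have "(\<lambda>l::nat. f (i, j + int l)) summable_on UNIV"
    proof -
      have "inj (\<lambda>l::nat. (i, j + int l))" by (simp add: inj_def)
      from summable_on_reindex[OF this, of f] show ?thesis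
        using summable_on_subset_banach[OF f, of "range (\<lambda>l::nat. (i, j + int l))"] by (simp add: o_def)
    qed
    then have "(\<lambda>l::nat. f (i, j + int l)) \<longlonglongrightarrow> 0"
      by (intro summable_LIMSEQ_zero summable_on_imp_summable)
    then have "f (i, j) - Q i \<le> 0" by (rule Lim_bounded2) (use le in blast)
    then show ?thesis by simp
  qed
  moreover have "Q i \<ge> 0" for i unfolding Q_def h_def by (rule infsum_nonneg) simp
  ultimately show ?thesis using Q by (intro exI[of _ Q]) (auto simp: h_def[abs_def])
qed

text \<open>The difference of two squares factors into sum and difference, and Cauchy-Schwarz
  separates the two.\<close>

lemma column_square:
  fixes a :: "int \<times> int \<Rightarrow> real"
  assumes a: "(\<lambda>k. (a k)\<^sup>2) summable_on UNIV" and d: "(\<lambda>k. (a (up k) - a k)\<^sup>2) summable_on UNIV"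
  shows "\<exists>Q. (\<forall>i. Q i \<ge> 0) \<and> Q summable_on UNIV \<and>
     infsum Q UNIV \<le> 2 * sqrt (\<Sum>\<^sub>\<infinity>k. (a k)\<^sup>2) * sqrt (\<Sum>\<^sub>\<infinity>k. (a (up k) - a k)\<^sup>2) \<and> (\<forall>k. (a k)\<^sup>2 \<le> Q (fst k))"
proof -
  let ?A = "\<Sum>\<^sub>\<infinity>k. (a k)\<^sup>2" and ?G = "\<Sum>\<^sub>\<infinity>k. (a (up k) - a k)\<^sup>2"
  obtain Q where Q: "\<forall>i. Q i \<ge> 0" "Q summable_on UNIV" "infsum Q UNIV = (\<Sum>\<^sub>\<infinity>k. \<bar>(a (up k))\<^sup>2 - (a k)\<^sup>2\<bar>)"
    "\<forall>k. (a k)\<^sup>2 \<le> Q (fst k)"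
    using column_bound[OF _ a] by auto
  note au = summable_up[OF a]
  have b: "(a (up k) + a k)\<^sup>2 \<le> 2 * (a (up k))\<^sup>2 + 2 * (a k)\<^sup>2" for k
    by (rule power2_sum_le)
  have s2: "(\<lambda>k. 2 * (a (up k))\<^sup>2 + 2 * (a k)\<^sup>2) summable_on UNIV"
    by (intro summable_on_add summable_on_cmult_right au(1) a)
  have s: "(\<lambda>k. (a (up k) + a k)\<^sup>2) summable_on UNIV"
    by (rule summable_on_comparison_test[OF s2]) (use b in auto)
  have "(\<Sum>\<^sub>\<infinity>k. (a (up k) + a k)\<^sup>2) \<le> (\<Sum>\<^sub>\<infinity>k. 2 * (a (up k))\<^sup>2 + 2 * (a k)\<^sup>2)"
    by (rule infsum_mono[OF s s2 b])
  also have "\<dots> = 2\<^sup>2 * ?A"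
    using au a by (simp add: infsum_add summable_on_cmult_right infsum_cmult_right')
  finally have S: "(\<Sum>\<^sub>\<infinity>k. (a (up k) + a k)\<^sup>2) \<le> 2\<^sup>2 * ?A" .
  have "infsum Q UNIV = (\<Sum>\<^sub>\<infinity>k. \<bar>(a (up k) + a k) * (a (up k) - a k)\<bar>)"
    unfolding Q(3) by (simp add: power2_eq_square algebra_simps)
  also have "\<dots> \<le> sqrt (\<Sum>\<^sub>\<infinity>k. (a (up k) + a k)\<^sup>2) * sqrt ?G"
    by (rule Cauchy_Schwarz_infsum(2)[OF s d])
  also have "\<dots> \<le> sqrt (2\<^sup>2 * ?A) * sqrt ?G"
    by (intro mult_right_mono real_sqrt_le_mono S) (simp add: infsum_nonneg)
  also have "sqrt (2\<^sup>2 * ?A) = 2 * sqrt ?A" by (simp only: real_sqrt_mult real_sqrt_abs abs_numeral)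
  finally show ?thesis using Q by blast
qed

text \<open>The same argument for cubes. Bounding a cube by a function of the column is a trace
  inequality: on a set meeting each column boundedly often it controls the sum of cubes.\<close>

lemma column_cube:
  fixes a :: "int \<times> int \<Rightarrow> real"
  assumes a: "(\<lambda>k. \<bar>a k\<bar> ^ 3) summable_on UNIV" "(\<lambda>k. (a k) ^ 4) summable_on UNIV"
    and d: "(\<lambda>k. (a (up k) - a k)\<^sup>2) summable_on UNIV"
  shows "\<exists>Q. (\<forall>i. Q i \<ge> 0) \<and> Q summable_on UNIV \<and>
     infsum Q UNIV \<le> 3 * sqrt (\<Sum>\<^sub>\<infinity>k. (a k) ^ 4) * sqrt (\<Sum>\<^sub>\<infinity>k. (a (up k) - a k)\<^sup>2) \<and> (\<forall>k. \<bar>a k\<bar> ^ 3 \<le> Q (fst k))"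
proof -
  let ?A = "\<Sum>\<^sub>\<infinity>k. (a k) ^ 4" and ?G = "\<Sum>\<^sub>\<infinity>k. (a (up k) - a k)\<^sup>2"
  obtain Q where Q: "\<forall>i. Q i \<ge> 0" "Q summable_on UNIV" "infsum Q UNIV = (\<Sum>\<^sub>\<infinity>k. \<bar>\<bar>a (up k)\<bar> ^ 3 - \<bar>a k\<bar> ^ 3\<bar>)"
    "\<forall>k. \<bar>a k\<bar> ^ 3 \<le> Q (fst k)"
    using column_bound[OF _ a(1)] by auto
  note au = summable_up[OF a(1)] and au4 = summable_up[OF a(2)]
  \<comment> \<open>A majorant of x^2 + x y + y^2, the cofactor of x - y in x^3 - y^3. Its squares
    sum to at most 9 times the sum of fourth powers, whence the factor 3.\<close>
  let ?s = "\<lambda>k. 3 / 2 * ((a (up k))\<^sup>2 + (a k)\<^sup>2)"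
  have b: "(?s k)\<^sup>2 \<le> 9 / 2 * (a (up k)) ^ 4 + 9 / 2 * (a k) ^ 4" for k
  proof -
    from power2_sum_le[of "(a (up k))\<^sup>2" "(a k)\<^sup>2"]
    have "((a (up k))\<^sup>2 + (a k)\<^sup>2)\<^sup>2 \<le> 2 * (a (up k)) ^ 4 + 2 * (a k) ^ 4" by (simp flip: power_mult)
    moreover have "(?s k)\<^sup>2 = 9 / 4 * ((a (up k))\<^sup>2 + (a k)\<^sup>2)\<^sup>2"
      unfolding power_mult_distrib by (simp add: power_divide)
    ultimately show ?thesis by linarith
  qed
  have s2: "(\<lambda>k. 9 / 2 * (a (up k)) ^ 4 + 9 / 2 * (a k) ^ 4) summable_on UNIV"
    by (intro summable_on_add summable_on_cmult_right au4(1) a(2))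
  have s: "(\<lambda>k. (?s k)\<^sup>2) summable_on UNIV"
    by (rule summable_on_comparison_test[OF s2]) (use b in auto)
  have "(\<Sum>\<^sub>\<infinity>k. (?s k)\<^sup>2) \<le> (\<Sum>\<^sub>\<infinity>k. 9 / 2 * (a (up k)) ^ 4 + 9 / 2 * (a k) ^ 4)"
    by (rule infsum_mono[OF s s2 b])
  also have "\<dots> = (\<Sum>\<^sub>\<infinity>k. 9 / 2 * (a (up k)) ^ 4) + (\<Sum>\<^sub>\<infinity>k. 9 / 2 * (a k) ^ 4)"
    by (intro infsum_add summable_on_cmult_right au4(1) a(2))
  also have "\<dots> = 9 / 2 * ?A + 9 / 2 * ?A"
    by (simp only: infsum_cmult_right' au4(2))
  also have "\<dots> = 3\<^sup>2 * ?A" by simp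
  finally have S: "(\<Sum>\<^sub>\<infinity>k. (?s k)\<^sup>2) \<le> 3\<^sup>2 * ?A" .
  note cs = Cauchy_Schwarz_infsum[OF s d]
  have le: "\<bar>\<bar>a (up k)\<bar> ^ 3 - \<bar>a k\<bar> ^ 3\<bar> \<le> \<bar>?s k * (a (up k) - a k)\<bar>" for k
  proof -
    let ?x = "\<bar>a (up k)\<bar>" and ?y = "\<bar>a k\<bar>"
    have "?x ^ 3 - ?y ^ 3 = (?x\<^sup>2 + ?x * ?y + ?y\<^sup>2) * (?x - ?y)" by (simp add: power2_eq_square power3_eq_cube algebra_simps)
    then have "\<bar>?x ^ 3 - ?y ^ 3\<bar> = (?x\<^sup>2 + ?x * ?y + ?y\<^sup>2) * \<bar>?x - ?y\<bar>" by (simp add: abs_mult add_nonneg_nonneg del: power2_abs)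
    also have "\<dots> \<le> ?s k * \<bar>a (up k) - a k\<bar>"
    proof (rule mult_mono)
      show "?x\<^sup>2 + ?x * ?y + ?y\<^sup>2 \<le> ?s k"
        using sum_squares_bound[of ?x ?y] by simp
      show "\<bar>?x - ?y\<bar> \<le> \<bar>a (up k) - a k\<bar>" by linarith
    qed auto
    finally show ?thesis by (simp add: abs_mult)
  qed
  have "infsum Q UNIV \<le> (\<Sum>\<^sub>\<infinity>k. \<bar>?s k * (a (up k) - a k)\<bar>)"
    unfolding Q(3) by (intro infsum_mono le cs(1) summable_on_comparison_test[OF cs(1)]) auto
  also have "\<dots> \<le> sqrt (\<Sum>\<^sub>\<infinity>k. (?s k)\<^sup>2) * sqrt ?G" by (rule cs(2))
  also have "\<dots> \<le> sqrt (3\<^sup>2 * ?A) * sqrt ?G"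
    by (intro mult_right_mono real_sqrt_le_mono S) (simp add: infsum_nonneg)
  also have "sqrt (3\<^sup>2 * ?A) = 3 * sqrt ?A" by (simp only: real_sqrt_mult real_sqrt_abs abs_numeral)
  finally show ?thesis using Q by blast
qed

lemma summable_swap:
  fixes f :: "int \<times> int \<Rightarrow> real"
  shows "(\<lambda>k. f (prod.swap k)) summable_on UNIV \<longleftrightarrow> f summable_on UNIV" "(\<Sum>\<^sub>\<infinity>k. f (prod.swap k)) = infsum f UNIV"
proof -
  have "bij (prod.swap :: int \<times> int \<Rightarrow> int \<times> int)" by simp
  then show "(\<lambda>k. f (prod.swap k)) summable_on UNIV \<longleftrightarrow> f summable_on UNIV" "(\<Sum>\<^sub>\<infinity>k. f (prod.swap k)) = infsum f UNIV"
    using summable_on_reindex_bij_betw[of prod.swap UNIV UNIV f] infsum_reindex_bij_betw[of prod.swap UNIV UNIV f] by auto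
qed

text \<open>The classical argument: one factor of the fourth power is bounded by a function of the
  column, the other by a function of the row, and the double sum of the product factorizes. The
  constant 4 is the product of the two factors 2 from \<open>column_square\<close>.\<close>

lemma lattice_ladyzhenskaya:
  fixes a :: "int \<times> int \<Rightarrow> real"
  assumes a: "(\<lambda>k. (a k)\<^sup>2) summable_on UNIV"
    and dy: "(\<lambda>k. (a (up k) - a k)\<^sup>2) summable_on UNIV" "(\<Sum>\<^sub>\<infinity>k. (a (up k) - a k)\<^sup>2) \<le> G"
    and dx: "(\<lambda>k. (a (prod.swap (up k)) - a (prod.swap k))\<^sup>2) summable_on UNIV"
      "(\<Sum>\<^sub>\<infinity>k. (a (prod.swap (up k)) - a (prod.swap k))\<^sup>2) \<le> G"
  shows "(\<lambda>k. (a k) ^ 4) summable_on UNIV" "(\<Sum>\<^sub>\<infinity>k. (a k) ^ 4) \<le> 4 * (\<Sum>\<^sub>\<infinity>k. (a k)\<^sup>2) * G"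
proof -
  let ?A = "\<Sum>\<^sub>\<infinity>k. (a k)\<^sup>2"
  have A0: "?A \<ge> 0" by (simp add: infsum_nonneg)
  have G0: "G \<ge> 0" using order_trans[OF infsum_nonneg dy(2)] by simp
  have as: "(\<lambda>k. (a (prod.swap k))\<^sup>2) summable_on UNIV" "(\<Sum>\<^sub>\<infinity>k. (a (prod.swap k))\<^sup>2) = ?A"
    using summable_swap[of "\<lambda>k. (a k)\<^sup>2"] a by auto
  obtain Q where Q: "\<forall>i. Q i \<ge> 0" "Q summable_on UNIV" "\<forall>k. (a k)\<^sup>2 \<le> Q (fst k)"
     "infsum Q UNIV \<le> 2 * sqrt ?A * sqrt (\<Sum>\<^sub>\<infinity>k. (a (up k) - a k)\<^sup>2)"
    using column_square[OF a dy(1)] by blast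
  obtain P where P: "\<forall>i. P i \<ge> 0" "P summable_on UNIV" "\<forall>k. (a (prod.swap k))\<^sup>2 \<le> P (fst k)"
     "infsum P UNIV \<le> 2 * sqrt ?A * sqrt (\<Sum>\<^sub>\<infinity>k. (a (prod.swap (up k)) - a (prod.swap k))\<^sup>2)"
    using column_square[OF as(1) dx(1)] as(2) by auto
  have Qle: "infsum Q UNIV \<le> 2 * sqrt ?A * sqrt G"
    by (rule order_trans[OF Q(4)]) (use A0 dy(2) in \<open>intro mult_left_mono, auto\<close>)
  have Ple: "infsum P UNIV \<le> 2 * sqrt ?A * sqrt G"
    by (rule order_trans[OF P(4)]) (use A0 dx(2) in \<open>intro mult_left_mono, auto\<close>)
  have hs: "((\<lambda>k. Q (fst k) * P (snd k)) has_sum (infsum Q UNIV * infsum P UNIV)) (UNIV \<times> UNIV)"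
  proof (rule has_sum_SigmaI)
    show 1: "((\<lambda>j. Q (fst (i, j)) * P (snd (i, j))) has_sum (Q i * infsum P UNIV)) UNIV" for i
      using has_sum_cmult_right[OF has_sum_infsum[OF P(2)], of "Q i"] by simp
    show 2: "((\<lambda>i. Q i * infsum P UNIV) has_sum (infsum Q UNIV * infsum P UNIV)) UNIV"
      by (rule has_sum_cmult_left[OF has_sum_infsum[OF Q(2)]])
    show "(\<lambda>k. Q (fst k) * P (snd k)) summable_on UNIV \<times> UNIV"
      by (rule summable_on_SigmaI[OF 1 has_sum_imp_summable[OF 2]]) (use P(1) Q(1) in simp)
  qed
  then have hs': "((\<lambda>k. Q (fst k) * P (snd k)) has_sum (infsum Q UNIV * infsum P UNIV)) UNIV" by simp
  have le: "(a k) ^ 4 \<le> Q (fst k) * P (snd k)" for k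
  proof -
    have "(a k)\<^sup>2 \<le> P (snd k)" using P(3)[rule_format, of "prod.swap k"] by simp
    then have "(a k)\<^sup>2 * (a k)\<^sup>2 \<le> Q (fst k) * P (snd k)" using Q(1,3) by (intro mult_mono) auto
    then show ?thesis by (simp add: power4_eq_xxxx power2_eq_square mult.assoc)
  qed
  show s: "(\<lambda>k. (a k) ^ 4) summable_on UNIV"
    by (rule summable_on_comparison_test[OF has_sum_imp_summable[OF hs']]) (use le in auto)
  have "(\<Sum>\<^sub>\<infinity>k. (a k) ^ 4) \<le> infsum Q UNIV * infsum P UNIV"
    unfolding infsumI[OF hs', symmetric] by (rule infsum_mono[OF s has_sum_imp_summable[OF hs'] le])
  also have "\<dots> \<le> (2 * sqrt ?A * sqrt G) * (2 * sqrt ?A * sqrt G)"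
    using Q(1) P(1) A0 G0 by (intro mult_mono Qle Ple infsum_nonneg) auto
  also have "\<dots> = 4 * (sqrt ?A * sqrt ?A) * (sqrt G * sqrt G)" by (simp only: mult_ac)
  also have "\<dots> = 4 * ?A * G" using A0 G0 by simp
  finally show "(\<Sum>\<^sub>\<infinity>k. (a k) ^ 4) \<le> 4 * ?A * G" .
qed

text \<open>V lies in finitely many orbits under v. Since \<pi> v is nonzero, \<pi> is injective on
  each orbit, so an orbit contributes at most the full sum of \<open>Q\<close>.\<close>

lemma coset_sum_bound:
  fixes f :: "int \<times> int \<Rightarrow> real" and \<pi> :: "int \<times> int \<Rightarrow> int"
  assumes R: "finite R" and rep: "\<And>w. w \<in> V \<Longrightarrow> \<exists>r\<in>R. \<exists>j. w = (fst r + j * fst v, snd r + j * snd v)"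
    and \<pi>: "\<And>r j. \<pi> (fst r + j * fst v, snd r + j * snd v) = \<pi> r + j * \<pi> v" "\<pi> v \<noteq> 0"
    and f: "f summable_on V" "\<And>k. f k \<ge> 0" and Q: "\<And>i. Q i \<ge> 0" "Q summable_on UNIV" "\<And>k. f k \<le> Q (\<pi> k)"
  shows "infsum f V \<le> real (card R) * infsum Q UNIV"
proof (rule infsum_le_finite_sums[OF f(1)])
  fix F assume F: "finite F" "F \<subseteq> V"
  \<comment> \<open>Different r may describe the same orbit; points counted several times do no
    harm, because f is nonnegative.\<close>
  define C where "C r = {w\<in>F. \<exists>j. w = (fst r + j * fst v, snd r + j * snd v)}" for r
  have C: "sum f (C r) \<le> infsum Q UNIV" for r
  proof -
    have inj: "inj_on \<pi> (C r)"
    proof (rule inj_onI)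
      fix x y assume "x \<in> C r" "y \<in> C r" "\<pi> x = \<pi> y"
      then obtain i j where "x = (fst r + i * fst v, snd r + i * snd v)" "y = (fst r + j * fst v, snd r + j * snd v)"
        "\<pi> r + i * \<pi> v = \<pi> r + j * \<pi> v"
        unfolding C_def using \<pi>(1) by force
      then show "x = y" using \<pi>(2) by simp
    qed
    have "sum f (C r) \<le> (\<Sum>w\<in>C r. Q (\<pi> w))" using Q(3) by (rule sum_mono)
    also have "\<dots> = sum Q (\<pi> ` C r)" using inj by (simp add: sum.reindex o_def)
    also have "\<dots> \<le> infsum Q UNIV"
      using F Q by (intro finite_sum_le_infsum) (auto simp: C_def)
    finally show ?thesis .
  qed
  have "sum f F \<le> (\<Sum>w\<in>F. \<Sum>r\<in>R. if w \<in> C r then f w else 0)"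
  proof (rule sum_mono)
    fix w assume w: "w \<in> F"
    then obtain r where r: "r \<in> R" "w \<in> C r" using rep F(2) unfolding C_def by blast
    have "f w = (if w \<in> C r then f w else 0)" using r by simp
    also have "\<dots> \<le> (\<Sum>r\<in>R. if w \<in> C r then f w else 0)"
      using R r f(2) by (intro member_le_sum[of r R "\<lambda>r. if w \<in> C r then f w else 0"]) auto
    finally show "f w \<le> (\<Sum>r\<in>R. if w \<in> C r then f w else 0)" .
  qed
  also have "\<dots> = (\<Sum>r\<in>R. sum f (C r))"
  proof -
    have "(\<Sum>w\<in>F. if w \<in> C r then f w else 0) = sum f (C r)" for r
    proof -
      have "F \<inter> C r = C r" unfolding C_def by blast
      then show ?thesis using sum.inter_restrict[OF F(1), of f "C r"] by simp
    qed
    then show ?thesis by (subst sum.swap) simp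
  qed
  also have "\<dots> \<le> (\<Sum>r\<in>R. infsum Q UNIV)" using C by (rule sum_mono)
  finally show "sum f F \<le> real (card R) * infsum Q UNIV" by simp
qed

section \<open>Lattice inequalities transferred to the graph\<close>

context grid
begin

lemma edge_sq_sum_inj:
  assumes g: "wd u g" and \<iota>: "inj \<iota>"
  shows "(\<lambda>k. edge_sq g (\<iota> k)) summable_on UNIV" "(\<Sum>\<^sub>\<infinity>k. edge_sq g (\<iota> k)) \<le> Dnorm2 \<epsilon> u"
proof -
  note s = Dnorm2_sum[OF g]
  have r: "edge_sq g summable_on range \<iota>" by (rule summable_on_subset_banach[OF s(1)]) simp
  then show "(\<lambda>k. edge_sq g (\<iota> k)) summable_on UNIV"
    using summable_on_reindex[OF \<iota>, of "edge_sq g"] by (simp add: o_def)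
  have "(\<Sum>\<^sub>\<infinity>k. edge_sq g (\<iota> k)) = infsum (edge_sq g) (range \<iota>)"
    using infsum_reindex[OF \<iota>, of "edge_sq g"] by (simp add: o_def)
  also have "\<dots> \<le> infsum (edge_sq g) UNIV" by (rule infsum_mono2[OF r s(1)]) (auto simp: edge_sq_nonneg)
  finally show "(\<Sum>\<^sub>\<infinity>k. edge_sq g (\<iota> k)) \<le> Dnorm2 \<epsilon> u" using s(2) by simp
qed

text \<open>The Hoelder bound between the two ends of an edge, at distance \<epsilon>, makes the
  discrete gradient of the vertex values a consequence of the kinetic energy.\<close>

lemma vertex_gradient:
  assumes u: "u \<in> H1 \<epsilon>"
  defines "a \<equiv> \<lambda>k. u (vtx k)"
  shows "(\<lambda>k. (a (up k) - a k)\<^sup>2) summable_on UNIV" "(\<Sum>\<^sub>\<infinity>k. (a (up k) - a k)\<^sup>2) \<le> \<epsilon> * Dnorm2 \<epsilon> u"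
    "(\<lambda>k. (a (prod.swap (up k)) - a (prod.swap k))\<^sup>2) summable_on UNIV"
    "(\<Sum>\<^sub>\<infinity>k. (a (prod.swap (up k)) - a (prod.swap k))\<^sup>2) \<le> \<epsilon> * Dnorm2 \<epsilon> u"
proof -
  obtain g where g: "wd u g" using H1_wd u by blast
  have *: "(\<lambda>k. (f k)\<^sup>2) summable_on UNIV \<and> (\<Sum>\<^sub>\<infinity>k. (f k)\<^sup>2) \<le> \<epsilon> * Dnorm2 \<epsilon> u"
    if \<iota>: "inj \<iota>" and f: "\<And>k. f k = lift u (\<iota> k, \<epsilon>) - lift u (\<iota> k, 0)" for \<iota> :: "int \<times> int \<Rightarrow> edge" and f
  proof -
    note s = edge_sq_sum_inj[OF g \<iota>]
    have le: "(f k)\<^sup>2 \<le> \<epsilon> * edge_sq g (\<iota> k)" for k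
      unfolding f using edge_holder[OF g, of \<epsilon> 0 "\<iota> k"] eps_pos by simp
    have s2: "(\<lambda>k. \<epsilon> * edge_sq g (\<iota> k)) summable_on UNIV" by (intro summable_on_cmult_right s(1))
    have s1: "(\<lambda>k. (f k)\<^sup>2) summable_on UNIV" by (rule summable_on_comparison_test[OF s2]) (use le in auto)
    have "(\<Sum>\<^sub>\<infinity>k. (f k)\<^sup>2) \<le> (\<Sum>\<^sub>\<infinity>k. \<epsilon> * edge_sq g (\<iota> k))" by (rule infsum_mono[OF s1 s2 le])
    also have "\<dots> \<le> \<epsilon> * Dnorm2 \<epsilon> u" unfolding infsum_cmult_right' using s(2) eps_pos by (intro mult_left_mono) auto
    finally show ?thesis using s1 by blast
  qed
  have "inj (\<lambda>k :: int \<times> int. (fst k, snd k, True))" by (auto simp: inj_def prod_eq_iff)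
  from *[OF this, of "\<lambda>k. a (up k) - a k"]
  show "(\<lambda>k. (a (up k) - a k)\<^sup>2) summable_on UNIV" "(\<Sum>\<^sub>\<infinity>k. (a (up k) - a k)\<^sup>2) \<le> \<epsilon> * Dnorm2 \<epsilon> u"
    by (auto simp: a_def lift_def edge_pt_def vtx_def up_def algebra_simps)
  have "inj (\<lambda>k :: int \<times> int. (snd k, fst k, False))" by (auto simp: inj_def prod_eq_iff)
  from *[OF this, of "\<lambda>k. a (prod.swap (up k)) - a (prod.swap k)"]
  show "(\<lambda>k. (a (prod.swap (up k)) - a (prod.swap k))\<^sup>2) summable_on UNIV"
    "(\<Sum>\<^sub>\<infinity>k. (a (prod.swap (up k)) - a (prod.swap k))\<^sup>2) \<le> \<epsilon> * Dnorm2 \<epsilon> u"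
    by (auto simp: a_def lift_def edge_pt_def vtx_def up_def algebra_simps)
qed

lemma vertex_ladyzhenskaya:
  assumes u: "u \<in> H1 \<epsilon>"
  shows "(\<lambda>k. (u (vtx k)) ^ 4) summable_on UNIV"
    "(\<Sum>\<^sub>\<infinity>k. (u (vtx k)) ^ 4) \<le> 4 * supb (mass u) (Dnorm2 \<epsilon> u) * (\<epsilon> * Dnorm2 \<epsilon> u)"
proof -
  note l = lattice_ladyzhenskaya[OF vertex_bound(1)[OF u] vertex_gradient[OF u]]
  show "(\<lambda>k. (u (vtx k)) ^ 4) summable_on UNIV" by (rule l(1))
  have "4 * (\<Sum>\<^sub>\<infinity>k. (u (vtx k))\<^sup>2) * (\<epsilon> * Dnorm2 \<epsilon> u) \<le> 4 * supb (mass u) (Dnorm2 \<epsilon> u) * (\<epsilon> * Dnorm2 \<epsilon> u)"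
    using vertex_bound(2)[OF u] eps_pos Dnorm2_nonneg[OF u] by (intro mult_right_mono mult_left_mono) auto
  then show "(\<Sum>\<^sub>\<infinity>k. (u (vtx k)) ^ 4) \<le> 4 * supb (mass u) (Dnorm2 \<epsilon> u) * (\<epsilon> * Dnorm2 \<epsilon> u)"
    using l(2) by linarith
qed

text \<open>A function bounded by 1 has |u|^r \<le> u^4. On each edge u is its value at the base
  vertex plus an oscillation whose fourth power is at most \<epsilon>^2 D times the kinetic energy
  of that edge; the factor 8 comes from (x + y)^4 \<le> 8 x^4 + 8 y^4.\<close>

lemma Lpow_small:
  assumes u: "u \<in> H1 \<epsilon>" and r: "r \<ge> 4" and S: "\<And>p. p \<in> space gmeas \<Longrightarrow> (lift u p)\<^sup>2 \<le> 1"
  shows "Lpow \<epsilon> r u \<le> 16 * \<epsilon> * (\<Sum>\<^sub>\<infinity>k. (u (vtx k)) ^ 4) + 8 * \<epsilon> ^ 3 * (Dnorm2 \<epsilon> u)\<^sup>2"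
proof -
  obtain g where g: "wd u g" using H1_wd u by blast
  interpret finite_measure seg by (rule finite_seg)
  let ?D = "Dnorm2 \<epsilon> u"
  let ?f = "\<lambda>e. \<integral>t. \<bar>lift u (e, t)\<bar> powr r \<partial>seg"
  have r2: "r \<ge> 2" using r by simp
  have m: "(\<lambda>p. \<bar>lift u p\<bar> powr r) \<in> borel_measurable gmeas" using Lpow_eq(1)[OF u r2] by auto
  note gn = gmeas_nonneg[OF m]
  have s: "?f summable_on UNIV" and i: "\<And>e. integrable seg (\<lambda>t. \<bar>lift u (e, t)\<bar> powr r)"
    using gn(1) Lpow_eq(1)[OF u r2] by (metis powr_ge_zero)+
  have L: "Lpow \<epsilon> r u = infsum ?f UNIV" using gn(2) Lpow_eq[OF u r2] by simp
  define A where "A e = (u (vtx (fst e, fst (snd e)))) ^ 4" for e :: edge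
  have le: "?f e \<le> 8 * \<epsilon> * A e + 8 * \<epsilon> ^ 3 * ?D * edge_sq g e" for e
  proof -
    let ?c = "8 * A e + 8 * (\<epsilon>\<^sup>2 * (?D * edge_sq g e))"
    have "?f e \<le> (\<integral>t. ?c \<partial>seg)"
    proof (rule integral_mono[OF i])
      fix t assume t: "t \<in> space seg"
      let ?U = "lift u (e, t)" and ?a = "lift u (e, 0)"
      have a: "A e = ?a ^ 4"
        by (cases e) (simp add: A_def lift_def edge_pt_def vtx_def)
      have "\<bar>?U\<bar> \<le> 1" using S[of "(e, t)"] t by (simp add: abs_square_le_1)
      then have "\<bar>?U\<bar> powr r \<le> \<bar>?U\<bar> powr 4" using r by (intro powr_mono') auto
      also have "\<dots> = ?U ^ 4" by simp
      also have "?U ^ 4 \<le> 8 * ?a ^ 4 + 8 * (?U - ?a) ^ 4"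
      proof -
        have "(?U\<^sup>2)\<^sup>2 \<le> (2 * ?a\<^sup>2 + 2 * (?U - ?a)\<^sup>2)\<^sup>2"
          using power2_sum_le[of ?a "?U - ?a"] by (intro power_mono) auto
        also have "\<dots> \<le> 2 * (2 * ?a\<^sup>2)\<^sup>2 + 2 * (2 * (?U - ?a)\<^sup>2)\<^sup>2" by (rule power2_sum_le)
        finally show ?thesis by (simp add: power_mult_distrib flip: power_mult)
      qed
      also have "(?U - ?a) ^ 4 \<le> \<epsilon>\<^sup>2 * (?D * edge_sq g e)"
      proof -
        have "(?U - ?a)\<^sup>2 \<le> \<bar>t - 0\<bar> * edge_sq g e" using t eps_pos by (intro edge_holder[OF g]) auto
        also have "\<dots> \<le> \<epsilon> * edge_sq g e" using t edge_sq_nonneg by (intro mult_right_mono) auto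
        finally have "((?U - ?a)\<^sup>2)\<^sup>2 \<le> (\<epsilon> * edge_sq g e)\<^sup>2" by (intro power_mono) auto
        also have "\<dots> = \<epsilon>\<^sup>2 * (edge_sq g e * edge_sq g e)" by (simp add: power2_eq_square)
        also have "\<dots> \<le> \<epsilon>\<^sup>2 * (?D * edge_sq g e)"
          using Dnorm2_sum(3)[OF g] edge_sq_nonneg by (intro mult_left_mono mult_right_mono) auto
        finally show ?thesis by (simp flip: power_mult)
      qed
      finally show "\<bar>?U\<bar> powr r \<le> ?c" unfolding a by simp
    qed simp
    also have "\<dots> = 8 * \<epsilon> * A e + 8 * \<epsilon> ^ 3 * ?D * edge_sq g e"
      by (simp add: measure_seg_space power2_eq_square power3_eq_cube algebra_simps)
    finally show ?thesis .
  qed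
  let ?S = "\<Sum>\<^sub>\<infinity>k. (u (vtx k)) ^ 4"
  \<comment> \<open>Each vertex is the base of exactly two edges, which turns 8 into 16.\<close>
  have hA: "(A has_sum (?S + ?S)) UNIV"
  proof -
    have 1: "(A has_sum ?S) (range (\<lambda>k :: int \<times> int. (fst k, snd k, b)))" for b
    proof -
      have inj: "inj (\<lambda>k :: int \<times> int. (fst k, snd k, b))" by (auto simp: inj_def prod_eq_iff)
      show ?thesis
        using has_sum_infsum[OF vertex_ladyzhenskaya(1)[OF u]]
        by (subst has_sum_reindex[OF inj]) (simp add: o_def A_def)
    qed
    have "(A has_sum (?S + ?S)) (range (\<lambda>k :: int \<times> int. (fst k, snd k, False)) \<union> range (\<lambda>k :: int \<times> int. (fst k, snd k, True)))"
      by (rule has_sum_Un_disjoint[OF 1 1]) auto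
    also have "range (\<lambda>k :: int \<times> int. (fst k, snd k, False)) \<union> range (\<lambda>k :: int \<times> int. (fst k, snd k, True)) = UNIV"
    proof -
      have "e = (\<lambda>k :: int \<times> int. (fst k, snd k, snd (snd e))) (fst e, fst (snd e))" for e :: edge by simp
      then have "e \<in> range (\<lambda>k :: int \<times> int. (fst k, snd k, False)) \<union> range (\<lambda>k :: int \<times> int. (fst k, snd k, True))" for e :: edge
        by (cases "snd (snd e)") (metis (mono_tags, lifting) UnI1 UnI2 rangeI)+
      then show ?thesis by blast
    qed
    finally show ?thesis .
  qed
  have hs: "((\<lambda>e. 8 * \<epsilon> * A e + 8 * \<epsilon> ^ 3 * ?D * edge_sq g e) has_sum (8 * \<epsilon> * (?S + ?S) + 8 * \<epsilon> ^ 3 * ?D * ?D)) UNIV"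
    by (intro has_sum_add has_sum_cmult_right hA) (use has_sum_infsum[OF Dnorm2_sum(1)[OF g]] Dnorm2_sum(2)[OF g] in simp)
  have "Lpow \<epsilon> r u \<le> 8 * \<epsilon> * (?S + ?S) + 8 * \<epsilon> ^ 3 * ?D * ?D"
    unfolding L infsumI[OF hs, symmetric] by (rule infsum_mono[OF s has_sum_imp_summable[OF hs] le])
  then show ?thesis by (simp add: power2_eq_square)
qed

text \<open>The trace inequality on V for functions bounded by 1 at the vertices. The constant, a
  number of orbit representatives, is chosen before u and r and depends on V alone.\<close>

lemma vsum_small:
  assumes V: "Z_periodic V"
  shows "\<exists>n::real. n \<ge> 0 \<and> (\<forall>u r. u \<in> H1 \<epsilon> \<and> r \<ge> 3 \<and> (\<forall>k. (u (vtx k))\<^sup>2 \<le> 1) \<longrightarrow>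
     vsum r V u \<le> n * (3 * sqrt (\<Sum>\<^sub>\<infinity>k. (u (vtx k)) ^ 4) * sqrt (\<epsilon> * Dnorm2 \<epsilon> u)))"
proof -
  obtain v R where v: "v \<noteq> (0, 0)" and R: "finite R"
    and rep: "\<And>w. w \<in> V \<Longrightarrow> \<exists>r\<in>R. \<exists>j. w = (fst r + j * fst v, snd r + j * snd v)"
    using periodic_representatives[OF V] by blast
  have "vsum r V u \<le> real (card R) * (3 * sqrt (\<Sum>\<^sub>\<infinity>k. (u (vtx k)) ^ 4) * sqrt (\<epsilon> * Dnorm2 \<epsilon> u))"
    if u: "u \<in> H1 \<epsilon>" and r: "r \<ge> 3" and S: "\<And>k. (u (vtx k))\<^sup>2 \<le> 1" for u r
  proof -
    let ?a = "\<lambda>k. u (vtx k)"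
    let ?A = "\<Sum>\<^sub>\<infinity>k. ?a k ^ 4"
    have c: "(\<lambda>k. \<bar>?a k\<bar> ^ 3) summable_on W" for W using vsum_summable[OF u, of 3 W] by simp
    have sr: "(\<lambda>k. \<bar>?a k\<bar> powr r) summable_on V" by (rule vsum_summable[OF u]) (use r in simp)
    have "vsum r V u \<le> (\<Sum>\<^sub>\<infinity>k\<in>V. \<bar>?a k\<bar> ^ 3)"
      unfolding vsum_def
    proof (rule infsum_mono[OF sr c])
      fix k
      have "\<bar>?a k\<bar> \<le> 1" using S[of k] by (simp add: abs_square_le_1)
      then have "\<bar>?a k\<bar> powr r \<le> \<bar>?a k\<bar> powr 3" using r by (intro powr_mono') auto
      then show "\<bar>?a k\<bar> powr r \<le> \<bar>?a k\<bar> ^ 3" by simp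
    qed
    also have "\<dots> \<le> real (card R) * (3 * sqrt ?A * sqrt (\<epsilon> * Dnorm2 \<epsilon> u))"
    proof -
      have fin: ?thesis if Q: "\<forall>i. Q i \<ge> 0" "Q summable_on UNIV" "\<forall>k. \<bar>?a k\<bar> ^ 3 \<le> Q (\<pi> k)"
        "infsum Q UNIV \<le> 3 * sqrt ?A * sqrt G" "G \<le> \<epsilon> * Dnorm2 \<epsilon> u"
        and \<pi>: "\<And>r j. \<pi> (fst r + j * fst v, snd r + j * snd v) = \<pi> r + j * \<pi> v" "\<pi> v \<noteq> 0" for Q G \<pi>
      proof -
        have "(\<Sum>\<^sub>\<infinity>k\<in>V. \<bar>?a k\<bar> ^ 3) \<le> real (card R) * infsum Q UNIV"
          by (rule coset_sum_bound[OF R rep \<pi> c]) (use Q in auto)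
        also have "\<dots> \<le> real (card R) * (3 * sqrt ?A * sqrt G)" by (intro mult_left_mono Q(4)) auto
        also have "\<dots> \<le> real (card R) * (3 * sqrt ?A * sqrt (\<epsilon> * Dnorm2 \<epsilon> u))"
          by (intro mult_left_mono real_sqrt_le_mono Q(5)) (auto simp: infsum_nonneg)
        finally show ?thesis .
      qed
      show ?thesis
      \<comment> \<open>Columns serve unless v is vertical, in which case an orbit stays in one
        column and rows are used instead.\<close>
      proof (cases "fst v = 0")
        case False
        obtain Q where "\<forall>i. Q i \<ge> 0" "Q summable_on UNIV" "\<forall>k. \<bar>?a k\<bar> ^ 3 \<le> Q (fst k)"
          "infsum Q UNIV \<le> 3 * sqrt ?A * sqrt (\<Sum>\<^sub>\<infinity>k. (?a (up k) - ?a k)\<^sup>2)"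
          using column_cube[OF c vertex_ladyzhenskaya(1)[OF u] vertex_gradient(1)[OF u]] by blast
        then show ?thesis by (rule fin[OF _ _ _ _ vertex_gradient(2)[OF u]]) (use False in auto)
      next
        case True
        then have sv: "snd v \<noteq> 0" using v by (simp add: prod_eq_iff)
        have c': "(\<lambda>k. \<bar>?a (prod.swap k)\<bar> ^ 3) summable_on UNIV"
          using summable_swap(1)[of "\<lambda>k. \<bar>?a k\<bar> ^ 3"] c by simp
        have a4: "(\<lambda>k. ?a (prod.swap k) ^ 4) summable_on UNIV" "(\<Sum>\<^sub>\<infinity>k. ?a (prod.swap k) ^ 4) = ?A"
          using summable_swap[of "\<lambda>k. ?a k ^ 4"] vertex_ladyzhenskaya(1)[OF u] by auto
        obtain Q where Q: "\<forall>i. Q i \<ge> 0" "Q summable_on UNIV" "\<forall>k. \<bar>?a (prod.swap k)\<bar> ^ 3 \<le> Q (fst k)"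
          "infsum Q UNIV \<le> 3 * sqrt ?A * sqrt (\<Sum>\<^sub>\<infinity>k. (?a (prod.swap (up k)) - ?a (prod.swap k))\<^sup>2)"
          using column_cube[OF c' a4(1) vertex_gradient(3)[OF u]] a4(2) by auto
        have "\<forall>k. \<bar>?a k\<bar> ^ 3 \<le> Q (snd k)"
        proof
          fix k show "\<bar>?a k\<bar> ^ 3 \<le> Q (snd k)" using Q(3)[rule_format, of "prod.swap k"] by simp
        qed
        then show ?thesis by (rule fin[OF Q(1,2) _ Q(4) vertex_gradient(4)[OF u]]) (use sv in auto)
      qed
    qed
    finally show ?thesis .
  qed
  then show ?thesis by (intro exI[of _ "real (card R)"]) auto
qed

end

section \<open>Small masses and the critical mass\<close>

context nls
begin

text \<open>If the kinetic energy D is at least the mass m, then m \<le> sqrt (m D) and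
  \<open>supb\<close> is at most C sqrt (m D), so the one-dimensional bounds suffice for any vertex
  set. For p in [4, 6) the power (p-2)/2 lies between 1 and 2, for q in [3, 4) the power (q-2)/2
  lies between 1/2 and 1; each end leaves a factor sqrt m to spare.\<close>

lemma pot_small_steep:
  assumes p4: "p \<ge> 4" and q3: "q \<ge> 3"
  shows "\<exists>K. \<forall>u W. u \<in> H1 \<epsilon> \<and> 0 < mass u \<and> mass u \<le> 1 \<and> mass u \<le> Dnorm2 \<epsilon> u \<longrightarrow>
    pot W u \<le> K * sqrt (mass u) * Dnorm2 \<epsilon> u"
proof -
  define C where "C = 4 / \<epsilon> + 4"
  have C: "C \<ge> 0" using eps_pos by (simp add: C_def)
  have pw: "x powr a \<le> x powr b + x powr c" if "x \<ge> 0" "b \<le> a" "a \<le> c" for x a b c :: real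
  proof (cases "x \<le> 1")
    case True
    then have "x powr a \<le> x powr b" using that by (intro powr_mono') auto
    then show ?thesis by (smt (verit) powr_ge_zero)
  next
    case False
    then have "x powr a \<le> x powr c" using that by (intro powr_mono) auto
    then show ?thesis by (smt (verit) powr_ge_zero)
  qed
  have "pot W u \<le> (\<alpha> / p * (C + C\<^sup>2) + \<beta> / q * (C + 2 * C\<^sup>2)) * sqrt (mass u) * Dnorm2 \<epsilon> u"
    if u: "u \<in> H1 \<epsilon>" and m: "0 < mass u" "mass u \<le> 1" "mass u \<le> Dnorm2 \<epsilon> u" for u W
  proof -
    define m where "m = mass u"
    define D where "D = Dnorm2 \<epsilon> u"
    define B where "B = supb m D"
    define t where "t = sqrt m"
    define y where "y = sqrt (m * D)"
    have mD: "0 < m" "m \<le> 1" "m \<le> D" using m by (auto simp: m_def D_def)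
    have t: "0 < t" "t \<le> 1" "t * t = m" using mD by (auto simp: t_def)
    have tm: "m \<le> t" using t mult_left_le[of t t] by simp
    have y: "y \<ge> 0" "y * y = m * D" using mD by (auto simp: y_def)
    have yD: "y \<le> D" unfolding y_def using mD by (intro real_le_lsqrt) (auto simp: power2_eq_square)
    have my: "m \<le> y" unfolding y_def using mD by (intro real_le_rsqrt) (auto simp: power2_eq_square)
    have B0: "B \<ge> 0" unfolding B_def using mD by (intro supb_nonneg) auto
    have BC: "B \<le> C * y"
    proof -
      have "4 / \<epsilon> * m \<le> 4 / \<epsilon> * y" using my eps_pos by (intro mult_left_mono) auto
      then show ?thesis by (simp add: B_def supb_def C_def y_def[symmetric] distrib_right)
    qed
    have B1: "B \<le> C * D" using BC mult_left_mono[OF yD C] by linarith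
    have B2: "B * B \<le> C\<^sup>2 * (m * D)"
    proof -
      have "B * B \<le> (C * y) * (C * y)" using B0 BC by (intro mult_mono) auto
      also have "\<dots> = C\<^sup>2 * (y * y)" by (simp add: power2_eq_square)
      finally show ?thesis using y by simp
    qed
    have tD: "m * D \<le> t * D" using tm mD by (intro mult_right_mono) auto
    have S: "(lift u z)\<^sup>2 \<le> B" if "z \<in> space gmeas" for z
      unfolding B_def m_def D_def by (rule sup_bound[OF u that])
    have P: "B powr ((p-2)/2) * m \<le> (C + C\<^sup>2) * t * D"
    proof -
      have "B powr ((p-2)/2) \<le> B powr 1 + B powr 2" using p p4 B0 by (intro pw) auto
      then have "B powr ((p-2)/2) \<le> B + B * B" using B0 by (simp add: power2_eq_square)
      then have "B powr ((p-2)/2) * m \<le> (B + B * B) * m" using mD by (intro mult_right_mono) auto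
      also have "\<dots> = B * m + (B * B) * m" by (simp add: distrib_right)
      also have "\<dots> \<le> (C * D) * m + (C\<^sup>2 * (m * D)) * 1"
      proof (rule add_mono)
        show "B * m \<le> (C * D) * m" using B1 mD by (intro mult_right_mono) auto
        show "(B * B) * m \<le> (C\<^sup>2 * (m * D)) * 1" using mD B2 by (intro mult_mono[OF B2]) auto
      qed
      also have "\<dots> = (C + C\<^sup>2) * (m * D)" by (simp add: algebra_simps)
      also have "\<dots> \<le> (C + C\<^sup>2) * (t * D)" using C tD by (intro mult_left_mono) auto
      finally show ?thesis by (simp add: mult.assoc)
    qed
    have Qb: "B powr ((q-2)/2) * B \<le> (C + 2 * C\<^sup>2) * t * D"
    proof -
      have "B powr ((q-2)/2) \<le> B powr (1/2) + B powr 1" using q q3 B0 by (intro pw) auto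
      then have "B powr ((q-2)/2) \<le> sqrt B + B" using B0 by (simp add: powr_half_sqrt)
      then have "B powr ((q-2)/2) * B \<le> (sqrt B + B) * B" using B0 by (intro mult_right_mono) auto
      also have "\<dots> = sqrt B * B + B * B" by (simp add: distrib_right)
      \<comment> \<open>Young's inequality with weight t = sqrt m: both t B and B^2 / t are of order
        t D.\<close>
      also have "sqrt B * B \<le> t * B + B * B / t"
      proof -
        have "sqrt B \<le> t + B / t"
        proof (cases "sqrt B \<le> t")
          case True then show ?thesis using B0 t by (simp add: add_increasing2)
        next
          case False
          then have "sqrt B * t \<le> sqrt B * sqrt B" using B0 by (intro mult_left_mono) auto
          then have "sqrt B * t \<le> B" using B0 by simp
          then have "sqrt B \<le> B / t" using t by (simp add: pos_le_divide_eq)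
          then show ?thesis using t by simp
        qed
        then have "sqrt B * B \<le> (t + B / t) * B" using B0 by (intro mult_right_mono) auto
        then show ?thesis by (simp add: distrib_right)
      qed
      also have "t * B \<le> C * (t * D)" using mult_left_mono[OF B1, of t] t by (simp add: mult_ac)
      also have "B * B / t \<le> C\<^sup>2 * (t * D)"
      proof -
        have "B * B / t \<le> C\<^sup>2 * (m * D) / t" using B2 t by (intro divide_right_mono) auto
        also have "\<dots> = C\<^sup>2 * (t * D)" using t(1) by (simp flip: t(3))
        finally show ?thesis .
      qed
      also have "B * B \<le> C\<^sup>2 * (t * D)" using B2 mult_left_mono[OF tD, of "C\<^sup>2"] by simp
      finally show ?thesis by (simp add: algebra_simps)
    qed
    have "pot W u \<le> \<alpha> / p * (B powr ((p-2)/2) * m) + \<beta> / q * (B powr ((q-2)/2) * B)"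
      using pot_bound[OF u S, of W] by (simp add: m_def D_def B_def)
    also have "\<dots> \<le> \<alpha> / p * ((C + C\<^sup>2) * t * D) + \<beta> / q * ((C + 2 * C\<^sup>2) * t * D)"
      using P Qb p q \<alpha> \<beta> by (intro add_mono mult_left_mono) auto
    also have "\<dots> = (\<alpha> / p * (C + C\<^sup>2) + \<beta> / q * (C + 2 * C\<^sup>2)) * sqrt (mass u) * Dnorm2 \<epsilon> u"
      by (simp only: t_def m_def D_def distrib_right mult.assoc)
    finally show ?thesis .
  qed
  then show ?thesis by blast
qed

text \<open>If D is at most the mass m, then u is bounded by 1 and the two-dimensional inequalities
  apply: fourth powers are of order m D, and the vertex sum is of order sqrt (m D) sqrt D = sqrt m
  D. The term D^2 from oscillations on edges is at most m D.\<close>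

lemma pot_small_flat:
  assumes p4: "p \<ge> 4" and q3: "q \<ge> 3" and V: "Z_periodic V"
  shows "\<exists>K. \<forall>u. u \<in> H1 \<epsilon> \<and> (4 / \<epsilon> + 4) * mass u \<le> 1 \<and> mass u \<le> 1 \<and> Dnorm2 \<epsilon> u \<le> mass u \<longrightarrow>
    pot V u \<le> K * sqrt (mass u) * Dnorm2 \<epsilon> u"
proof -
  define C where "C = 4 / \<epsilon> + 4"
  have C: "C \<ge> 0" using eps_pos by (simp add: C_def)
  obtain n :: real where n: "n \<ge> 0" and nV: "\<And>u r. u \<in> H1 \<epsilon> \<Longrightarrow> r \<ge> 3 \<Longrightarrow> (\<And>k. (u (vtx k))\<^sup>2 \<le> 1) \<Longrightarrow>
     vsum r V u \<le> n * (3 * sqrt (\<Sum>\<^sub>\<infinity>k. (u (vtx k)) ^ 4) * sqrt (\<epsilon> * Dnorm2 \<epsilon> u))"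
    using vsum_small[OF V] by blast
  define K1 where "K1 = 64 * \<epsilon>\<^sup>2 * C + 8 * \<epsilon> ^ 3"
  define K2 where "K2 = n * (6 * \<epsilon> * sqrt C)"
  have "pot V u \<le> (\<alpha> / p * K1 + \<beta> / q * K2) * sqrt (mass u) * Dnorm2 \<epsilon> u"
    if u: "u \<in> H1 \<epsilon>" and m: "C * mass u \<le> 1" "mass u \<le> 1" "Dnorm2 \<epsilon> u \<le> mass u" for u
  proof -
    define m where "m = mass u"
    define D where "D = Dnorm2 \<epsilon> u"
    define t where "t = sqrt m"
    have mD: "0 \<le> m" "m \<le> 1" "0 \<le> D" "D \<le> m"
      using that mass_nonneg Dnorm2_nonneg[OF u] by (auto simp: m_def D_def)
    have t: "0 \<le> t" "t \<le> 1" "t * t = m" using mD by (auto simp: t_def)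
    have tm: "m \<le> t" using t mult_left_le[of t t] by simp
    have tD: "m * D \<le> t * D" using tm mD by (intro mult_right_mono) auto
    have B: "supb m D \<le> C * m"
    proof -
      have "sqrt (m * D) \<le> m" using mD by (intro real_le_lsqrt) (auto simp: power2_eq_square intro: mult_left_mono)
      then show ?thesis by (simp add: supb_def C_def distrib_right)
    qed
    have S: "(lift u z)\<^sup>2 \<le> 1" if "z \<in> space gmeas" for z
      using sup_bound[OF u that] B \<open>C * mass u \<le> 1\<close> by (simp add: m_def D_def)
    let ?A = "\<Sum>\<^sub>\<infinity>k. (u (vtx k)) ^ 4"
    have A: "?A \<le> 4 * \<epsilon> * C * m * D"
    proof -
      have "?A \<le> 4 * supb m D * (\<epsilon> * D)" unfolding m_def D_def by (rule vertex_ladyzhenskaya(2)[OF u])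
      also have "\<dots> \<le> 4 * (C * m) * (\<epsilon> * D)" using B mD eps_pos by (intro mult_right_mono mult_left_mono) auto
      finally show ?thesis by (simp add: mult_ac)
    qed
    have P: "Lpow \<epsilon> p u \<le> K1 * t * D"
    proof -
      have "Lpow \<epsilon> p u \<le> 16 * \<epsilon> * ?A + 8 * \<epsilon> ^ 3 * D\<^sup>2" unfolding D_def by (rule Lpow_small[OF u p4 S])
      also have "\<dots> \<le> 16 * \<epsilon> * (4 * \<epsilon> * C * m * D) + 8 * \<epsilon> ^ 3 * (m * D)"
        using A eps_pos mD by (intro add_mono mult_left_mono) (auto simp: power2_eq_square intro: mult_right_mono)
      also have "\<dots> = K1 * (m * D)" by (simp add: K1_def power2_eq_square algebra_simps)
      also have "\<dots> \<le> K1 * (t * D)" using tD C eps_pos by (intro mult_left_mono) (auto simp: K1_def)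
      finally show ?thesis by (simp add: mult.assoc)
    qed
    have Q: "vsum q V u \<le> K2 * t * D"
    proof -
      have "vsum q V u \<le> n * (3 * sqrt ?A * sqrt (\<epsilon> * D))"
        unfolding D_def by (rule nV[OF u q3 vtx_sup[OF S]])
      also have "\<dots> \<le> n * (3 * sqrt (4 * \<epsilon> * C * m * D) * sqrt (\<epsilon> * D))"
        using A n mD eps_pos by (intro mult_left_mono mult_right_mono real_sqrt_le_mono) auto
      also have "sqrt (4 * \<epsilon> * C * m * D) = 2 * sqrt C * t * sqrt (\<epsilon> * D)"
        by (simp add: real_sqrt_mult t_def)
      also have "3 * (2 * sqrt C * t * sqrt (\<epsilon> * D)) * sqrt (\<epsilon> * D) = 6 * sqrt C * t * (sqrt (\<epsilon> * D) * sqrt (\<epsilon> * D))"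
        by simp
      also have "sqrt (\<epsilon> * D) * sqrt (\<epsilon> * D) = \<epsilon> * D" using eps_pos mD by simp
      finally show ?thesis by (simp add: K2_def mult_ac)
    qed
    have "pot V u \<le> \<alpha> / p * (K1 * t * D) + \<beta> / q * (K2 * t * D)"
      unfolding pot_def using P Q p q \<alpha> \<beta> by (intro add_mono mult_left_mono) auto
    also have "\<dots> = (\<alpha> / p * K1 + \<beta> / q * K2) * sqrt (mass u) * Dnorm2 \<epsilon> u"
      by (simp only: t_def m_def D_def distrib_right mult.assoc)
    finally show ?thesis .
  qed
  then show ?thesis unfolding C_def by blast
qed

lemma small_mass:
  assumes p4: "p \<ge> 4" and q3: "q \<ge> 3" and V: "Z_periodic V"
  shows "\<exists>\<mu>0>0. \<forall>u. u \<in> H1 \<epsilon> \<and> mass u \<le> \<mu>0 \<longrightarrow> En V u \<ge> 0"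
proof -
  obtain K1 where K1: "\<And>u. u \<in> H1 \<epsilon> \<Longrightarrow> 0 < mass u \<Longrightarrow> mass u \<le> 1 \<Longrightarrow> mass u \<le> Dnorm2 \<epsilon> u \<Longrightarrow>
    pot V u \<le> K1 * sqrt (mass u) * Dnorm2 \<epsilon> u"
    using pot_small_steep[OF p4 q3] by blast
  obtain K2 where K2: "\<And>u. u \<in> H1 \<epsilon> \<Longrightarrow> (4 / \<epsilon> + 4) * mass u \<le> 1 \<Longrightarrow> mass u \<le> 1 \<Longrightarrow> Dnorm2 \<epsilon> u \<le> mass u \<Longrightarrow>
    pot V u \<le> K2 * sqrt (mass u) * Dnorm2 \<epsilon> u"
    using pot_small_flat[OF p4 q3 V] by blast
  define K where "K = \<bar>K1\<bar> + \<bar>K2\<bar> + 1"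
  have K: "K > 0" "K1 \<le> K" "K2 \<le> K" by (auto simp: K_def)
  \<comment> \<open>The first two bounds admit both regimes, the third gives K sqrt (mass) \<le>
    1/2, so that the potential energy does not exceed the kinetic term D / 2.\<close>
  define \<mu>0 where "\<mu>0 = min (min 1 (1 / (4 / \<epsilon> + 4))) ((1 / (2 * K))\<^sup>2)"
  have \<mu>0: "\<mu>0 > 0" "\<mu>0 \<le> 1" "\<mu>0 \<le> 1 / (4 / \<epsilon> + 4)" "\<mu>0 \<le> (1 / (2 * K))\<^sup>2"
    using eps_pos K by (auto simp: \<mu>0_def add_pos_pos intro: min.coboundedI1)
  have "En V u \<ge> 0" if u: "u \<in> H1 \<epsilon>" and m: "mass u \<le> \<mu>0" for u
  proof (cases "mass u = 0")
    case True
    then show ?thesis using pot_zero_mass[OF u, of V] Dnorm2_nonneg[OF u] by (simp add: energy_eq)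
  next
    case False
    then have m0: "mass u > 0" using mass_nonneg[of u] by simp
    have D0: "Dnorm2 \<epsilon> u \<ge> 0" by (rule Dnorm2_nonneg[OF u])
    have c4: "4 / \<epsilon> + 4 > 0" using eps_pos by (simp add: add_pos_pos)
    have mb: "mass u \<le> 1" "(4 / \<epsilon> + 4) * mass u \<le> 1"
    proof -
      show "mass u \<le> 1" using m \<mu>0 by linarith
      have "mass u \<le> 1 / (4 / \<epsilon> + 4)" using m \<mu>0 by linarith
      then show "(4 / \<epsilon> + 4) * mass u \<le> 1" using c4 by (simp add: pos_le_divide_eq mult.commute)
    qed
    have "\<exists>k. k \<le> K \<and> pot V u \<le> k * sqrt (mass u) * Dnorm2 \<epsilon> u"
      using K1[OF u m0 mb(1)] K2[OF u mb(2,1)] K by (cases "mass u \<le> Dnorm2 \<epsilon> u") auto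
    then obtain k where k: "k \<le> K" "pot V u \<le> k * sqrt (mass u) * Dnorm2 \<epsilon> u" by blast
    have "k * sqrt (mass u) * Dnorm2 \<epsilon> u \<le> K * sqrt (mass u) * Dnorm2 \<epsilon> u"
      using k D0 m0 by (intro mult_right_mono) auto
    also have "K * sqrt (mass u) \<le> 1 / 2"
    proof -
      have "sqrt (mass u) \<le> 1 / (2 * K)" using m \<mu>0(4) K m0 by (intro real_le_lsqrt) auto
      then have "K * sqrt (mass u) \<le> K * (1 / (2 * K))" using K by (intro mult_left_mono) auto
      then show ?thesis using K by simp
    qed
    then have "K * sqrt (mass u) * Dnorm2 \<epsilon> u \<le> 1 / 2 * Dnorm2 \<epsilon> u" using D0 by (rule mult_right_mono)
    finally show ?thesis using k(2) by (simp add: energy_eq)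
  qed
  then show ?thesis using \<mu>0(1) by blast
qed

text \<open>Scaling up keeps a negative energy negative, so the masses with negative level form an
  up-set.\<close>

lemma level_neg_mono:
  assumes "level V m < 0" "0 < m" "m \<le> \<mu>"
  shows "level V \<mu> < 0"
proof -
  obtain u where u: "u \<in> H1 \<epsilon>" "mass u = m" "En V u < 0"
    using level_less[OF assms(1) H1_mass_nonempty[OF assms(2)]] by blast
  define \<theta> where "\<theta> = \<mu> / m"
  have \<theta>: "\<theta> \<ge> 1" "\<theta> * m = \<mu>" using assms by (auto simp: \<theta>_def)
  have "level V \<mu> \<le> En V (\<lambda>x. sqrt \<theta> * u x)"
    using \<theta> u by (intro level_le H1_scale) (auto simp: mass_scale)
  also have "\<dots> \<le> \<theta> powr \<sigma> * En V u - (\<theta> powr \<sigma> - \<theta>) * Dnorm2 \<epsilon> u / 2"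
    by (rule energy_scale_le[OF u(1) \<theta>(1)])
  also have "\<dots> < 0"
  proof -
    have "\<theta> powr 1 \<le> \<theta> powr \<sigma>" using \<theta> \<sigma> by (intro powr_mono) auto
    then have "(\<theta> powr \<sigma> - \<theta>) * Dnorm2 \<epsilon> u / 2 \<ge> 0" using \<theta> Dnorm2_nonneg[OF u(1)] by simp
    moreover have "\<theta> powr \<sigma> * En V u < 0" using \<theta> u(3) by (simp add: mult_pos_neg)
    ultimately show ?thesis by linarith
  qed
  finally show ?thesis .
qed

text \<open>The energy is continuous under scaling, so a negative value persists for factors
  slightly below 1. Consequently the infimum of the masses with negative level itself has level
  0.\<close>

lemma level_neg_left:
  assumes "level V \<mu> < 0" "\<mu> > 0"
  shows "\<exists>m. 0 < m \<and> m < \<mu> \<and> level V m < 0"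
proof -
  obtain u where u: "u \<in> H1 \<epsilon>" "mass u = \<mu>" "En V u < 0"
    using level_less[OF assms(1) H1_mass_nonempty[OF assms(2)]] by blast
  define \<theta> where "\<theta> n = 1 - inverse (real (Suc (Suc n)))" for n
  have \<theta>: "0 < \<theta> n" "\<theta> n < 1" for n by (auto simp: \<theta>_def inverse_eq_divide divide_less_eq)
  have lim: "\<theta> \<longlonglongrightarrow> 1"
    unfolding \<theta>_def[abs_def] using tendsto_diff[OF tendsto_const[of 1] LIMSEQ_Suc[OF LIMSEQ_inverse_real_of_nat]] by simp
  have "(\<lambda>n. En V (\<lambda>x. sqrt (\<theta> n) * u x)) \<longlonglongrightarrow>
    1 * Dnorm2 \<epsilon> u / 2 - \<alpha> / p * (1 powr (p/2) * Lpow \<epsilon> p u) - \<beta> / q * (1 powr (q/2) * vsum q V u)"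
    using energy_scale[OF u(1) less_imp_le[OF \<theta>(1)]] by (simp only:) (intro tendsto_intros lim; simp)
  moreover have "1 * Dnorm2 \<epsilon> u / 2 - \<alpha> / p * (1 powr (p/2) * Lpow \<epsilon> p u) - \<beta> / q * (1 powr (q/2) * vsum q V u) = En V u"
    by (simp add: energy_eq pot_def)
  ultimately have "(\<lambda>n. En V (\<lambda>x. sqrt (\<theta> n) * u x)) \<longlonglongrightarrow> En V u" by metis
  then have "\<forall>\<^sub>F n in sequentially. En V (\<lambda>x. sqrt (\<theta> n) * u x) < 0" using u(3) by (rule order_tendstoD(2))
  then obtain n where n: "En V (\<lambda>x. sqrt (\<theta> n) * u x) < 0" unfolding eventually_sequentially by blast
  have "level V (\<theta> n * \<mu>) \<le> En V (\<lambda>x. sqrt (\<theta> n) * u x)"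
    using \<theta>(1)[of n] u by (intro level_le H1_scale) (auto simp: mass_scale)
  then show ?thesis using n \<theta>[of n] assms(2) by (intro exI[of _ "\<theta> n * \<mu>"]) auto
qed

lemma Lpow_pos:
  assumes u: "u \<in> H1 \<epsilon>" and m: "mass u > 0"
  shows "Lpow \<epsilon> p u > 0"
proof (rule ccontr)
  note L = Lpow_eq[OF u, of p]
  assume "\<not> Lpow \<epsilon> p u > 0"
  then have "Lpow \<epsilon> p u = 0" using Lpow_nonneg[OF u, of p] p by simp
  then have "(\<integral>z. \<bar>lift u z\<bar> powr p \<partial>gmeas) = 0" using L(2) p by simp
  then have "AE z in gmeas. \<bar>lift u z\<bar> powr p = 0"
    using L(1) p by (subst (asm) integral_nonneg_eq_0_iff_AE) auto
  then have "AE z in gmeas. (lift u z)\<^sup>2 = 0" by eventually_elim simp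
  then have "mass u = (\<integral>z. 0 \<partial>gmeas)"
    unfolding mass_def using H1_lift(2)[OF u] by (intro integral_cong_AE) auto
  then show False using m by simp
qed

text \<open>For fixed u the p-term grows like \<theta>^(p/2) with p/2 > 1 and overtakes the kinetic
  term, which is linear in \<theta>.\<close>

lemma level_neg_large: "\<exists>\<mu>>0. level V \<mu> < 0"
proof -
  obtain u c where u: "u \<in> H1 \<epsilon>" "mass u = 1" by (rule test_function[of 1 1]) auto
  define P where "P = \<alpha> / p * Lpow \<epsilon> p u"
  have P: "P > 0" using Lpow_pos[OF u(1)] u(2) p \<alpha> by (simp add: P_def)
  have "filterlim (\<lambda>\<theta>::real. \<theta> powr (p/2 - 1)) at_top at_top" using p by real_asymp
  then have "eventually (\<lambda>\<theta>::real. \<theta> powr (p/2 - 1) > Dnorm2 \<epsilon> u / 2 / P) at_top"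
    by (simp add: filterlim_at_top_dense)
  moreover have "eventually (\<lambda>\<theta>::real. \<theta> > 0) at_top" by (rule eventually_gt_at_top)
  ultimately have "eventually (\<lambda>\<theta>::real. \<theta> powr (p/2 - 1) > Dnorm2 \<epsilon> u / 2 / P \<and> \<theta> > 0) at_top"
    by (rule eventually_conj)
  then obtain \<theta> where \<theta>: "\<theta> > 0" "\<theta> powr (p/2 - 1) > Dnorm2 \<epsilon> u / 2 / P"
    unfolding eventually_at_top_linorder by blast
  have "\<theta> powr (p/2) = \<theta> * \<theta> powr (p/2 - 1)" using \<theta>(1) powr_add[of \<theta> 1 "p/2 - 1"] by simp
  moreover have "\<theta> * (Dnorm2 \<epsilon> u / 2) < \<theta> * (\<theta> powr (p/2 - 1) * P)"
    using \<theta> P by (intro mult_strict_left_mono) (auto simp: pos_divide_less_eq)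
  ultimately have lt: "\<theta> * Dnorm2 \<epsilon> u / 2 < \<theta> powr (p/2) * P" by simp
  have "level V \<theta> \<le> En V (\<lambda>x. sqrt \<theta> * u x)"
    using \<theta>(1) u by (intro level_le H1_scale) (auto simp: mass_scale)
  also have "\<dots> = \<theta> * Dnorm2 \<epsilon> u / 2 - \<theta> powr (p/2) * P - \<beta> / q * (\<theta> powr (q/2) * vsum q V u)"
    using energy_scale[OF u(1), of \<theta> V] \<theta>(1) by (simp add: P_def)
  also have "\<dots> < 0"
  proof -
    have "\<beta> / q * (\<theta> powr (q/2) * vsum q V u) \<ge> 0" using q \<beta> vsum_nonneg by simp
    then show ?thesis using lt by linarith
  qed
  finally show ?thesis using \<theta>(1) by blast
qed

text \<open>A ground state at level 0 has positive potential energy, hence positive kinetic energy.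
  The surplus in \<open>energy_scale_le\<close> is then strict and would make the level at the
  larger mass \<mu>' negative. The argument uses a larger mass that still has level 0.\<close>

lemma no_ground_state:
  assumes \<mu>: "0 < \<mu>" "\<mu> < \<mu>'" and l: "level V \<mu> = 0" "level V \<mu>' = 0"
  shows "\<not> is_ground_state \<epsilon> p q \<alpha> \<beta> V \<mu> u"
proof
  assume "is_ground_state \<epsilon> p q \<alpha> \<beta> V \<mu> u"
  then have u: "u \<in> H1 \<epsilon>" "mass u = \<mu>" "En V u = 0" using l(1) by (auto simp: is_ground_state_def H1_mass_iff)
  define \<theta> where "\<theta> = \<mu>' / \<mu>"
  have \<theta>: "\<theta> > 1" "\<theta> * \<mu> = \<mu>'" using \<mu> by (auto simp: \<theta>_def)
  have "pot V u > 0"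
  proof -
    have "\<alpha> / p * Lpow \<epsilon> p u > 0" using Lpow_pos[OF u(1)] u(2) \<mu> p \<alpha> by simp
    moreover have "\<beta> / q * vsum q V u \<ge> 0" using q \<beta> vsum_nonneg by simp
    ultimately show ?thesis unfolding pot_def by linarith
  qed
  then have D: "Dnorm2 \<epsilon> u > 0" using u(3) by (simp add: energy_eq)
  have "\<theta> powr 1 < \<theta> powr \<sigma>" using \<theta> \<sigma> by (intro powr_less_mono) auto
  then have "(\<theta> powr \<sigma> - \<theta>) * Dnorm2 \<epsilon> u / 2 > 0" using \<theta> D by simp
  moreover have "level V \<mu>' \<le> En V (\<lambda>x. sqrt \<theta> * u x)"
    using \<theta> u by (intro level_le H1_scale) (auto simp: mass_scale)
  moreover have "\<dots> \<le> \<theta> powr \<sigma> * En V u - (\<theta> powr \<sigma> - \<theta>) * Dnorm2 \<epsilon> u / 2"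
    using \<theta> by (intro energy_scale_le u) simp
  ultimately show False using l(2) u(3) by simp
qed

text \<open>The critical mass is the infimum of the masses with negative level: positive by
  \<open>small_mass\<close>, finite by \<open>level_neg_large\<close>.\<close>

lemma critical_mass:
  assumes p4: "p \<ge> 4" and q3: "q \<ge> 3" and V: "Z_periodic V"
  shows "\<exists>\<mu>b>0. (\<forall>\<mu>. 0 < \<mu> \<and> \<mu> \<le> \<mu>b \<longrightarrow> level V \<mu> = 0) \<and> (\<forall>\<mu>>\<mu>b. level V \<mu> < 0)"
proof -
  obtain \<mu>0 where \<mu>0: "\<mu>0 > 0" "\<And>u. u \<in> H1 \<epsilon> \<Longrightarrow> mass u \<le> \<mu>0 \<Longrightarrow> En V u \<ge> 0"
    using small_mass[OF p4 q3 V] by blast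
  define A where "A = {\<mu>. 0 < \<mu> \<and> level V \<mu> < 0}"
  have ne: "A \<noteq> {}" using level_neg_large[of V] by (auto simp: A_def)
  have lb: "\<mu>0 \<le> \<mu>" if "\<mu> \<in> A" for \<mu>
  proof (rule ccontr)
    assume "\<not> \<mu>0 \<le> \<mu>"
    then show False
      using level_less[of V \<mu> 0] H1_mass_nonempty[of \<mu>] that \<mu>0(2) by (fastforce simp: A_def)
  qed
  have bdd: "bdd_below A" using lb by (rule bdd_belowI)
  have "\<mu>0 \<le> Inf A" using lb ne by (intro cInf_greatest) auto
  then have pos: "Inf A > 0" using \<mu>0(1) by simp
  have zero: "level V \<mu> = 0" if m0: "0 < \<mu>" "\<mu> \<le> Inf A" for \<mu>
  proof (rule ccontr)
    assume "level V \<mu> \<noteq> 0"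
    then have "level V \<mu> < 0" using level_nonpos[OF m0(1), of V] by simp
    then obtain m where "0 < m" "m < \<mu>" "level V m < 0" using level_neg_left m0(1) by blast
    then have "Inf A \<le> m" by (intro cInf_lower bdd) (simp add: A_def)
    then show False using \<open>m < \<mu>\<close> m0(2) by simp
  qed
  have neg: "level V \<mu> < 0" if gt: "\<mu> > Inf A" for \<mu>
  proof -
    obtain m where m: "m \<in> A" "m < \<mu>" using cInf_lessD[OF ne gt] by blast
    show ?thesis by (rule level_neg_mono[of V m]) (use m in \<open>simp_all add: A_def\<close>)
  qed
  show ?thesis using pos zero neg by (intro exI[of _ "Inf A"]) simp
qed

end

text \<open>The empty set satisfies \<open>Z_periodic\<close>. For it the vertex sum vanishes and q
  < 3 would not make the level negative, which is the reason for assuming V' nonempty.\<close>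

theorem theorem1p2:
  fixes p q \<alpha> \<beta> \<epsilon> :: real and V' :: "(int \<times> int) set"
  assumes "2 < p" "p < 6" "2 < q" "q < 4" "\<alpha> > 0" "\<beta> > 0" "\<epsilon> > 0"
    and "Z_periodic V'" and "V' \<noteq> {}"
  shows "((p < 4 \<or> q < 3) \<longrightarrow>
           (\<forall>\<mu>>0. ground_level \<epsilon> p q \<alpha> \<beta> V' \<mu> < 0
                  \<and> (\<exists>u. is_ground_state \<epsilon> p q \<alpha> \<beta> V' \<mu> u)))
       \<and> ((4 \<le> p \<and> 3 \<le> q) \<longrightarrow>
           (\<exists>\<mu>b>0. (\<forall>\<mu>. 0 < \<mu> \<and> \<mu> \<le> \<mu>b \<longrightarrow> ground_level \<epsilon> p q \<alpha> \<beta> V' \<mu> = 0)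
                 \<and> (\<forall>\<mu>>\<mu>b. ground_level \<epsilon> p q \<alpha> \<beta> V' \<mu> < 0)
                 \<and> (\<forall>\<mu>>\<mu>b. \<exists>u. is_ground_state \<epsilon> p q \<alpha> \<beta> V' \<mu> u)
                 \<and> (\<forall>\<mu>. 0 < \<mu> \<and> \<mu> < \<mu>b \<longrightarrow> \<not> (\<exists>u. is_ground_state \<epsilon> p q \<alpha> \<beta> V' \<mu> u))))"
proof -
  interpret nls \<epsilon> p q \<alpha> \<beta> using assms(1-7) by unfold_locales
  note V = \<open>Z_periodic V'\<close>
  have ex: "\<exists>u. is_ground_state \<epsilon> p q \<alpha> \<beta> V' \<mu> u" if "\<mu> > 0" "level V' \<mu> < 0" for \<mu>
    by (rule ground_state_exists[OF V that(1) H1_mass_nonempty[OF that(1)] that(2)])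
  have 1: "level V' \<mu> < 0" if "p < 4 \<or> q < 3" "\<mu> > 0" for \<mu>
    using that(1) level_neg_p[OF that(2)] level_neg_q[OF that(2) _ V \<open>V' \<noteq> {}\<close>] by metis
  have 2: "\<exists>\<mu>b>0. (\<forall>\<mu>. 0 < \<mu> \<and> \<mu> \<le> \<mu>b \<longrightarrow> level V' \<mu> = 0) \<and> (\<forall>\<mu>>\<mu>b. level V' \<mu> < 0) \<and>
      (\<forall>\<mu>>\<mu>b. \<exists>u. is_ground_state \<epsilon> p q \<alpha> \<beta> V' \<mu> u) \<and>
      (\<forall>\<mu>. 0 < \<mu> \<and> \<mu> < \<mu>b \<longrightarrow> \<not> (\<exists>u. is_ground_state \<epsilon> p q \<alpha> \<beta> V' \<mu> u))"
    if pq: "4 \<le> p" "3 \<le> q"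
  proof -
    obtain \<mu>b where b: "\<mu>b > 0" "\<And>\<mu>. 0 < \<mu> \<Longrightarrow> \<mu> \<le> \<mu>b \<Longrightarrow> level V' \<mu> = 0" "\<And>\<mu>. \<mu> > \<mu>b \<Longrightarrow> level V' \<mu> < 0"
      using critical_mass[OF pq V] by blast
    \<comment> \<open>The larger mass of level 0 is the critical mass itself, which is why the
      interval without ground states is open at that end.\<close>
    have "\<not> is_ground_state \<epsilon> p q \<alpha> \<beta> V' \<mu> u" if "0 < \<mu>" "\<mu> < \<mu>b" for \<mu> u
      by (rule no_ground_state[OF that]) (use b that in auto)
    moreover have "\<exists>u. is_ground_state \<epsilon> p q \<alpha> \<beta> V' \<mu> u" if "\<mu> > \<mu>b" for \<mu>
      using ex[OF _ b(3)[OF that]] b(1) that by simp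
    ultimately show ?thesis using b by (intro exI[of _ \<mu>b]) simp
  qed
  show ?thesis
  proof (intro conjI impI allI)
    fix \<mu> :: real assume "p < 4 \<or> q < 3" "\<mu> > 0"
    then show "level V' \<mu> < 0" by (rule 1)
    then show "\<exists>u. is_ground_state \<epsilon> p q \<alpha> \<beta> V' \<mu> u" by (rule ex[OF \<open>\<mu> > 0\<close>])
  next
    assume "4 \<le> p \<and> 3 \<le> q"
    then show "\<exists>\<mu>b>0. (\<forall>\<mu>. 0 < \<mu> \<and> \<mu> \<le> \<mu>b \<longrightarrow> level V' \<mu> = 0) \<and> (\<forall>\<mu>>\<mu>b. level V' \<mu> < 0) \<and>
      (\<forall>\<mu>>\<mu>b. \<exists>u. is_ground_state \<epsilon> p q \<alpha> \<beta> V' \<mu> u) \<and>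
      (\<forall>\<mu>. 0 < \<mu> \<and> \<mu> < \<mu>b \<longrightarrow> \<not> (\<exists>u. is_ground_state \<epsilon> p q \<alpha> \<beta> V' \<mu> u))"
      using 2 by simp
  qed
qed

end
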